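(* Let $\{\mathcal T_h\}$ be a shape-regular family of simplicial meshes of $\Omega$, let $V_h^{k-1},V_h^k$ be one of the stable pairs described in the context, and let $(\sigma,u,p)$, $\rho=\mathrm du$ be the exact solution of the Hodge–Laplace problem on $k$-forms with data $f\in L^2\Lambda^k(\Omega)$, $(\sigma_h,u_h,p_h)$ the FEEC solution, and $\hat u_h^{\mathrm{nor}},\hat\rho_h^{\mathrm{nor}}$ the approximate normal traces of the hybridized FEEC method. Then for each $K\in\mathcal T_h$, $$\||\widehat P_hu^{\mathrm{nor}}-\hat u_h^{\mathrm{nor}}|\|_{\partial K}\lesssim\|P_hu-u_h\|_K+h_K\|\sigma-\sigma_h\|_K,$$ $$\||\widehat P_h\rho^{\mathrm{nor}}-\hat\rho_h^{\mathrm{nor}}|\|_{\partial K}\lesssim\|P_h\mathrm d(u-u_h)\|_K+h_K\bigl(\|\mathrm d(\sigma-\sigma_h)\|_K+\|p-p_h\|_K\bigr),$$ where $P_h$ denotes $L^2$ projection onto $W_h$. Consequently, $$\||\widehat P_hu^{\mathrm{nor}}-\hat u_h^{\mathrm{nor}}|\|_{\partial\mathcal T_h}\lesssim\|P_hu-u_h\|_{\mathcal T_h}+h\|\sigma-\sigma_h\|_\Omega,$$ $$\||\widehat P_h\rho^{\mathrm{nor}}-\hat\rho_h^{\mathrm{nor}}|\|_{\partial\mathcal T_h}\lesssim\|P_h\mathrm d(u-u_h)\|_{\mathcal T_h}+h\bigl(\|\mathrm d(\sigma-\sigma_h)\|_\Omega+\|p-p_h\|_\Omega\bigr).$$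
   Context: Function spaces. $\Omega\subset\mathbb R^n$ is a bounded Lipschitz polyhedral domain. $L^2\Lambda^k(\Omega)$ has inner product $(v,w)_\Omega=\int_\Omega v\wedge\star w$ and norm $\|\cdot\|_\Omega$; $\mathrm d$ is the exterior derivative and $\delta=(-1)^k\star^{-1}\mathrm d\star$ the codifferential on $k$-forms. $H\Lambda^k(\Omega)=\{v\in L^2\Lambda^k:\mathrm dv\in L^2\}$, $H^*\Lambda^k(\Omega)=\{v\in L^2\Lambda^k:\delta v\in L^2\}$. Spaces of forms of degree outside $\{0,\dots,n\}$ are zero. Same notation on elements $K$. For $\tau\in H\Lambda^{j}(K)$ and $v\in H^*\Lambda^{j+1}(K)$, the pairing of tangential and normal traces is $\langle\tau^{\mathrm{tan}},v^{\mathrm{nor}}\rangle_{\partial K}=(\mathrm d\tau,v)_K-(\tau,\delta v)_K$ (for smooth forms $\tau^{\mathrm{tan}}=\operatorname{tr}\tau$ is the pullback to $\partial K$, $v^{\mathrm{nor}}=\hat\star^{-1}\operatorname{tr}\star v$, and the pairing is the $L^2$ inner product of $j$-forms on $\partial K$). Hodge–Laplace problem. $\mathfrak H^k=\{v\in H\Lambda^k(\Omega):\mathrm dv=0,\ v\perp_{L^2}\mathrm dH\Lambda^{k-1}(\Omega)\}$. Given $f$, $(\sigma,u,p)\in H\Lambda^{k-1}(\Omega)\times H\Lambda^k(\Omega)\times\mathfrak H^k$ is the unique solution of $(\sigma,\tau)_\Omega-(u,\mathrm d\tau)_\Omega=0$ for all $\tau\in H\Lambda^{k-1}(\Omega)$;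 $(\mathrm d\sigma,v)_\Omega+(\mathrm du,\mathrm dv)_\Omega+(p,v)_\Omega=(f,v)_\Omega$ for all $v\in H\Lambda^k(\Omega)$; $(u,q)_\Omega=0$ for all $q\in\mathfrak H^k$. (Thus $\sigma=\delta u$ and $u$, $\rho=\mathrm du$ have well-defined normal traces.) Discrete spaces. $\mathcal T_h$ is a conforming simplicial mesh of $\Omega$, $h_K=\operatorname{diam}K$, $h=\max_Kh_K$; the family is shape-regular (not necessarily quasi-uniform). $\mathcal P_r\Lambda^k(K)$ is the space of $k$-forms on $K$ with polynomial coefficients of degree $\le r$; $\mathcal P_r^-\Lambda^k(K)=\mathcal P_{r-1}\Lambda^k(K)+\kappa\mathcal P_{r-1}\Lambda^{k+1}(K)$ with $\kappa$ the contraction with the position vector field $x$. $\mathcal P_r^\pm\Lambda^k(\mathcal T_h)$ ($\mathcal P^\pm$ meaning either $\mathcal P$ or $\mathcal P^-$) is the set of $v\in H\Lambda^k(\Omega)$ with $v|_K\in\mathcal P_r^\pm\Lambda^k(K)$ for all $K$. Stable pairs: $V_h^{k-1}=\mathcal P_{r+1}^\pm\Lambda^{k-1}(\mathcal T_h)$ (either choice) and $V_h^k=\mathcal P_r\Lambda^k(\mathcal T_h)$ (if $r\ge1$) or $V_h^k=\mathcal P_{r+1}^-\Lambda^k(\mathcal T_h)$, $r\ge 0$. $W_h^j(K)$ is the corresponding polynomial space on $K$ ($W_h^j(K)=V_h^j|_K$), $W_h^j=\prod_KW_h^j(K)$; these are part of a polynomial complex, the next space $W_h^{k+1}$ satisfying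 $\mathrm dW_h^k\subset W_h^{k+1}$. $P_h$ is the ($L^2$-orthogonal) projection onto $W_h^k$ when applied to $k$-forms and onto $W_h^{k+1}$ when applied to $(k+1)$-forms. $(\cdot,\cdot)_{\mathcal T_h}=\sum_K(\cdot,\cdot)_K$, $\|\cdot\|_{\mathcal T_h}^2=\sum_K\|\cdot\|_K^2$, $\langle\cdot,\cdot\rangle_{\partial\mathcal T_h}=\sum_K\langle\cdot,\cdot\rangle_{\partial K}$. FEEC and hybridized FEEC. $\mathfrak H_h^k=\{v\in V_h^k:\mathrm dv=0,\ v\perp\mathrm dV_h^{k-1}\}$. The FEEC solution $(\sigma_h,u_h,p_h)\in V_h^{k-1}\times V_h^k\times\mathfrak H_h^k$ satisfies $(\sigma_h,\tau_h)_\Omega-(u_h,\mathrm d\tau_h)_\Omega=0$ for all $\tau_h\in V_h^{k-1}$; $(\mathrm d\sigma_h,v_h)_\Omega+(\mathrm du_h,\mathrm dv_h)_\Omega+(p_h,v_h)_\Omega=(f,v_h)_\Omega$ for all $v_h\in V_h^k$; $(u_h,q_h)_\Omega=0$ for all $q_h\in\mathfrak H_h^k$. Let $\widehat W_h^{j,\mathrm{tan}}=\{v_h^{\mathrm{tan}}:v_h\in W_h^j\}\subset L^2\Lambda^j(\partial\mathcal T_h)$, $\partial\mathcal T_h=\bigsqcup_K\partial K$; its dual is identified with itself through the $L^2$ inner product $\langle\cdot,\cdot\rangle_{\partial\mathcal T_h}$. The hybrid normal traces $\hat u_h^{\mathrm{nor}}\in\widehat W_h^{k-1,\mathrm{tan}}$,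 $\hat\rho_h^{\mathrm{nor}}\in\widehat W_h^{k,\mathrm{tan}}$ are uniquely determined by $(\sigma_h,\tau_h)_{\mathcal T_h}-(u_h,\mathrm d\tau_h)_{\mathcal T_h}+\langle\hat u_h^{\mathrm{nor}},\tau_h^{\mathrm{tan}}\rangle_{\partial\mathcal T_h}=0$ for all $\tau_h\in W_h^{k-1}$, and $(\mathrm d\sigma_h,v_h)_{\mathcal T_h}+(\mathrm du_h,\mathrm dv_h)_{\mathcal T_h}+(p_h,v_h)_{\mathcal T_h}-\langle\hat\rho_h^{\mathrm{nor}},v_h^{\mathrm{tan}}\rangle_{\partial\mathcal T_h}=(f,v_h)_{\mathcal T_h}$ for all $v_h\in W_h^k$. Projections and norms. $\widehat P_hu^{\mathrm{nor}}\in\widehat W_h^{k-1,\mathrm{tan}}$ is defined by $\langle\widehat P_hu^{\mathrm{nor}},\hat\tau_h\rangle_{\partial\mathcal T_h}=\langle u^{\mathrm{nor}},\hat\tau_h\rangle_{\partial\mathcal T_h}$ for all $\hat\tau_h\in\widehat W_h^{k-1,\mathrm{tan}}$, and $\widehat P_h\rho^{\mathrm{nor}}\in\widehat W_h^{k,\mathrm{tan}}$ analogously by testing $\rho^{\mathrm{nor}}$ against $\widehat W_h^{k,\mathrm{tan}}$. Scaled norms: $\||\cdot|\|_{\partial K}=h_K^{1/2}\|\cdot\|_{L^2(\partial K)}$, $\||\cdot|\|_{\partial\mathcal T_h}^2=\sum_K\||\cdot|\|_{\partial K}^2$. $A\lesssim B$ means $A\le CB$ with $C$ independent of $h$, of $K\in\mathcal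 T_h$ and of $f$ and the solutions (it may depend on $\Omega$, $n$, $k$, the polynomial degree and the shape-regularity constant). *)

theory Defs
  imports "HOL-Analysis.Analysis"
begin

section \<open>Alternating forms on Euclidean space\<close>

text \<open>
  An element of the exterior algebra of \<open>real^'n\<close> is stored by its coefficients with respect to the
  basis \<open>dx\<^sub>I = dx\<^sub>i\<^sub>1 \<and> \<dots> \<and> dx\<^sub>i\<^sub>k\<close>, where \<open>I = {i\<^sub>1 < \<dots> < i\<^sub>k}\<close>. The linear order on the index type
  \<open>'n\<close> fixes the order of the coordinates, hence the orientation. The basis is orthonormal, so the
  inner product of \<open>real^('n set)\<close> is the usual inner product of alternating forms.
  Degrees are integers; a form of degree outside \<open>{0..n}\<close> is zero.
\<close>

type_synonym 'n pt = "(real, 'n) vec"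
type_synonym 'n form = "(real, 'n set) vec"
type_synonym 'n dform = "'n pt \<Rightarrow> 'n form"

definition has_degree :: "int \<Rightarrow> 'n::finite form \<Rightarrow> bool" where
  "has_degree j \<omega> \<longleftrightarrow> (\<forall>I. \<omega> $ I \<noteq> 0 \<longrightarrow> int (card I) = j)"

text \<open>For disjoint \<open>I\<close>, \<open>M\<close>: \<open>dx\<^sub>I \<and> dx\<^sub>M = shuffle_sign I M dx\<^sub>I\<^sub>\<union>\<^sub>M\<close>.\<close>

definition shuffle_sign :: "'n::{finite,linorder} set \<Rightarrow> 'n set \<Rightarrow> real" where
  "shuffle_sign I M = (-1) ^ card {(i, m). i \<in> I \<and> m \<in> M \<and> m < i}"

definition wedge :: "'n::{finite,linorder} form \<Rightarrow> 'n form \<Rightarrow> 'n form" where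
  "wedge \<alpha> \<beta> = (\<chi> J. \<Sum>I\<in>Pow J. shuffle_sign I (J - I) * \<alpha> $ I * \<beta> $ (J - I))"

text \<open>\<open>\<star>dx\<^sub>I = shuffle_sign I (- I) dx\<^sub>-\<^sub>I\<close>, so that \<open>dx\<^sub>I \<and> \<star>dx\<^sub>I\<close> is the volume form.\<close>

definition hodge :: "'n::{finite,linorder} form \<Rightarrow> 'n form" where
  "hodge \<beta> = (\<chi> J. shuffle_sign (- J) J * \<beta> $ (- J))"

text \<open>Interior product of a vector with a form (insertion into the first slot).\<close>

definition contract :: "'n::{finite,linorder} pt \<Rightarrow> 'n form \<Rightarrow> 'n form" where
  "contract v \<omega> = (\<chi> I. \<Sum>i\<in>- I. v $ i * shuffle_sign {i} I * \<omega> $ insert i I)"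

text \<open>The value \<open>\<omega>(v\<^sub>1, \<dots>, v\<^sub>k)\<close> of a form on a list of vectors.\<close>

definition form_apply :: "'n::{finite,linorder} form \<Rightarrow> 'n pt list \<Rightarrow> real" where
  "form_apply \<omega> vs = fold contract vs \<omega> $ {}"

text \<open>Pullback under a linear map; its coefficients are the values of \<open>(L\<^sup>*\<omega>)(v\<^sub>1, \<dots>) = \<omega>(L v\<^sub>1, \<dots>)\<close>
  on increasing tuples of basis vectors.\<close>

definition form_pullback :: "('n pt \<Rightarrow> 'n pt) \<Rightarrow> 'n::{finite,linorder} form \<Rightarrow> 'n form" where
  "form_pullback L \<omega> = (\<chi> J. form_apply \<omega> (map (\<lambda>j. L (axis j 1)) (sorted_list_of_set J)))"

lemma shuffle_sign_square [simp]: "shuffle_sign I M * shuffle_sign I M = 1"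
  by (simp add: shuffle_sign_def flip: power_mult_distrib)

lemma hodge_Compl_nth:
  "hodge \<beta> $ (- I) = shuffle_sign I (- I) * \<beta> $ I"
  by (simp add: hodge_def)

lemma bij_hodge: "bij (hodge :: 'n::{finite,linorder} form \<Rightarrow> 'n form)"
proof (rule o_bij)
  let ?g = "\<lambda>\<gamma> :: 'n form. (\<chi> I. shuffle_sign I (- I) * \<gamma> $ (- I)) :: 'n form"
  show "?g \<circ> hodge = id"
    by (auto simp: hodge_def vec_eq_iff fun_eq_iff simp flip: mult.assoc)
  show "hodge \<circ> ?g = id"
    by (auto simp: hodge_def vec_eq_iff fun_eq_iff simp flip: mult.assoc)
qed

lemma wedge_hodge: "wedge \<alpha> (hodge \<beta>) $ UNIV = \<alpha> \<bullet> \<beta>"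
proof -
  have "wedge \<alpha> (hodge \<beta>) $ UNIV
      = (\<Sum>I\<in>UNIV. shuffle_sign I (- I) * \<alpha> $ I * (shuffle_sign I (- I) * \<beta> $ I))"
    by (simp add: wedge_def hodge_Compl_nth flip: Compl_eq_Diff_UNIV)
  also have "\<dots> = (\<Sum>I\<in>UNIV. (shuffle_sign I (- I) * shuffle_sign I (- I)) * (\<alpha> $ I * \<beta> $ I))"
    by (simp only: mult_ac)
  finally show ?thesis
    by (simp add: inner_vec_def)
qed


section \<open>Differential forms and Sobolev spaces\<close>

definition form_integral :: "'n pt set \<Rightarrow> 'n::{finite,linorder} dform \<Rightarrow> real" where
  "form_integral S \<alpha> = (LINT x|lebesgue_on S. \<alpha> x $ UNIV)"

definition L2_inner :: "'n pt set \<Rightarrow> 'n::{finite,linorder} dform \<Rightarrow> 'n dform \<Rightarrow> real" where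
  "L2_inner S v w = form_integral S (\<lambda>x. wedge (v x) (hodge (w x)))"

lemma L2_inner_eq: "L2_inner S v w = (LINT x|lebesgue_on S. v x \<bullet> w x)"
  by (simp add: L2_inner_def form_integral_def wedge_hodge)

definition L2_norm :: "'n pt set \<Rightarrow> 'n::{finite,linorder} dform \<Rightarrow> real" where
  "L2_norm S v = sqrt (L2_inner S v v)"

text \<open>Elements of the \<open>L\<^sup>2\<close> spaces are represented by functions; all notions below depend only on the
  values almost everywhere in \<open>S\<close>.\<close>

definition L2_forms :: "'n pt set \<Rightarrow> int \<Rightarrow> 'n::{finite,linorder} dform set" where
  "L2_forms S j = {v. v \<in> borel_measurable (lebesgue_on S) \<and>
     integrable (lebesgue_on S) (\<lambda>x. (norm (v x))\<^sup>2) \<and> (\<forall>x\<in>S. has_degree j (v x))}"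

definition partial :: "'n::finite \<Rightarrow> ('n pt \<Rightarrow> 'b::real_normed_vector) \<Rightarrow> 'n pt \<Rightarrow> 'b" where
  "partial i f x = frechet_derivative f (at x) (axis i 1)"

definition smooth :: "('n::finite pt \<Rightarrow> 'b::real_normed_vector) \<Rightarrow> bool" where
  "smooth f \<longleftrightarrow> (\<forall>is x. foldr partial is f differentiable at x)"

text \<open>The classical exterior derivative \<open>\<Sum>\<^sub>i dx\<^sub>i \<and> \<partial>\<^sub>i\<eta>\<close>.\<close>

definition ext_deriv :: "'n::{finite,linorder} dform \<Rightarrow> 'n dform" where
  "ext_deriv \<eta> x = (\<Sum>i\<in>UNIV. wedge (axis {i} 1) (partial i \<eta> x))"

definition test_forms :: "'n pt set \<Rightarrow> int \<Rightarrow> 'n::{finite,linorder} dform set" where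
  "test_forms S j = {\<eta>. smooth \<eta> \<and> (\<forall>x. has_degree j (\<eta> x)) \<and>
     (\<exists>C. compact C \<and> C \<subseteq> interior S \<and> (\<forall>x. x \<notin> C \<longrightarrow> \<eta> x = 0))}"

text \<open>\<open>w \<in> L\<^sup>2\<close> is the distributional exterior derivative of the \<open>j\<close>-form \<open>v\<close> in the interior of \<open>S\<close>;
  the sign comes from \<open>d(v \<and> \<eta>) = dv \<and> \<eta> + (-1)\<^sup>j v \<and> d\<eta>\<close>.\<close>

definition has_weak_d :: "'n pt set \<Rightarrow> int \<Rightarrow> 'n::{finite,linorder} dform \<Rightarrow> 'n dform \<Rightarrow> bool" where
  "has_weak_d S j v w \<longleftrightarrow> w \<in> L2_forms S (j + 1) \<and>
     (\<forall>\<eta>\<in>test_forms S (int CARD('n) - j - 1).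
        form_integral S (\<lambda>x. wedge (w x) (\<eta> x))
        = (-1) powi (j + 1) * form_integral S (\<lambda>x. wedge (v x) (ext_deriv \<eta> x)))"

definition H_forms :: "'n pt set \<Rightarrow> int \<Rightarrow> 'n::{finite,linorder} dform set" where
  "H_forms S j = {v \<in> L2_forms S j. \<exists>w. has_weak_d S j v w}"

text \<open>The derivative is unique up to null sets, the argument \<open>j\<close> is the degree of \<open>v\<close>.\<close>

definition weak_d :: "'n pt set \<Rightarrow> int \<Rightarrow> 'n::{finite,linorder} dform \<Rightarrow> 'n dform" where
  "weak_d S j v = (SOME w. has_weak_d S j v w)"

definition weak_codiff :: "'n pt set \<Rightarrow> int \<Rightarrow> 'n::{finite,linorder} dform \<Rightarrow> 'n dform" where
  "weak_codiff S j v =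
     (\<lambda>x. (-1) powi j *\<^sub>R inv hodge (weak_d S (int CARD('n) - j) (\<lambda>y. hodge (v y)) x))"

text \<open>The pairing of the tangential trace of a \<open>j\<close>-form \<open>\<tau>\<close> with the normal trace of a
  \<open>(j+1)\<close>-form \<open>v\<close> on the boundary of \<open>K\<close>.\<close>

definition trace_pairing :: "'n pt set \<Rightarrow> int \<Rightarrow> 'n::{finite,linorder} dform \<Rightarrow> 'n dform \<Rightarrow> real" where
  "trace_pairing K j \<tau> v = L2_inner K (weak_d K j \<tau>) v - L2_inner K \<tau> (weak_codiff K (j + 1) v)"


section \<open>The mixed Hodge--Laplace problem\<close>

text \<open>The continuous problem and its Galerkin discretization have the same form and differ only in the
  spaces \<open>X\<close> of \<open>(k-1)\<close>-forms and \<open>Y\<close> of \<open>k\<close>-forms.\<close>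

definition harmonic :: "'n pt set \<Rightarrow> int \<Rightarrow> 'n::{finite,linorder} dform set \<Rightarrow> 'n dform set
    \<Rightarrow> 'n dform set" where
  "harmonic \<Omega> k X Y = {v \<in> Y. has_weak_d \<Omega> k v (\<lambda>x. 0) \<and>
     (\<forall>\<tau>\<in>X. L2_inner \<Omega> v (weak_d \<Omega> (k - 1) \<tau>) = 0)}"

definition hodge_laplace :: "'n pt set \<Rightarrow> int \<Rightarrow> 'n::{finite,linorder} dform set \<Rightarrow> 'n dform set
    \<Rightarrow> 'n dform \<Rightarrow> 'n dform \<Rightarrow> 'n dform \<Rightarrow> 'n dform \<Rightarrow> bool" where
  "hodge_laplace \<Omega> k X Y f \<sigma> u p \<longleftrightarrow>
     \<sigma> \<in> X \<and> u \<in> Y \<and> p \<in> harmonic \<Omega> k X Y \<and>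
     (\<forall>\<tau>\<in>X. L2_inner \<Omega> \<sigma> \<tau> - L2_inner \<Omega> u (weak_d \<Omega> (k - 1) \<tau>) = 0) \<and>
     (\<forall>v\<in>Y. L2_inner \<Omega> (weak_d \<Omega> (k - 1) \<sigma>) v + L2_inner \<Omega> (weak_d \<Omega> k u) (weak_d \<Omega> k v)
              + L2_inner \<Omega> p v = L2_inner \<Omega> f v) \<and>
     (\<forall>q\<in>harmonic \<Omega> k X Y. L2_inner \<Omega> u q = 0)"


section \<open>Domains and meshes\<close>

definition lipschitz_polyhedral_domain :: "'n::finite pt set \<Rightarrow> bool" where
  "lipschitz_polyhedral_domain \<Omega> \<longleftrightarrow>
     open \<Omega> \<and> connected \<Omega> \<and> \<Omega> \<noteq> {} \<and> bounded \<Omega> \<and>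
     (\<exists>P. finite P \<and> (\<forall>Q\<in>P. polytope Q) \<and> closure \<Omega> = \<Union>P) \<and>
     (\<forall>x\<in>frontier \<Omega>. \<exists>U e L g. open U \<and> x \<in> U \<and> norm e = 1 \<and>
        L-lipschitz_on {y. y \<bullet> e = 0} g \<and>
        \<Omega> \<inter> U = {y \<in> U. y \<bullet> e < (g (y - (y \<bullet> e) *\<^sub>R e) :: real)})"

text \<open>The library's triangulations are conforming: two cells meet in a common face.\<close>

definition simplicial_mesh :: "'n::finite pt set \<Rightarrow> 'n pt set set \<Rightarrow> bool" where
  "simplicial_mesh \<Omega> \<T> \<longleftrightarrow>
     triangulation \<T> \<and> (\<forall>K\<in>\<T>. int CARD('n) simplex K) \<and> \<Union>\<T> = closure \<Omega>"

definition inball_diameter :: "'n::finite pt set \<Rightarrow> real" where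
  "inball_diameter K = Sup {2 * r |r x. 0 \<le> r \<and> cball x r \<subseteq> K}"

definition shape_regular_family :: "'n::finite pt set \<Rightarrow> 'n pt set set set \<Rightarrow> bool" where
  "shape_regular_family \<Omega> MM \<longleftrightarrow>
     (\<forall>\<T>\<in>MM. simplicial_mesh \<Omega> \<T>) \<and>
     (\<exists>\<gamma>>0. \<forall>\<T>\<in>MM. \<forall>K\<in>\<T>. diameter K \<le> \<gamma> * inball_diameter K)"

definition mesh_size :: "'n::finite pt set set \<Rightarrow> real" where
  "mesh_size \<T> = Max (diameter ` \<T>)"


section \<open>Polynomial differential forms\<close>

text \<open>A polynomial form on a simplex \<open>K\<close> of full dimension has a unique polynomial extension to the
  whole space and is identified with it; the polynomial spaces below therefore do not mention \<open>K\<close>.\<close>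

definition full_poly_forms :: "nat \<Rightarrow> int \<Rightarrow> 'n::{finite,linorder} dform set" where
  "full_poly_forms r j = {\<omega>. \<exists>c. (\<forall>a. has_degree j (c a)) \<and>
     (\<forall>x. \<omega> x = (\<Sum>a | (\<Sum>i\<in>UNIV. a i) \<le> r. (\<Prod>i\<in>UNIV. (x $ i) ^ (a i :: nat)) *\<^sub>R c a))}"

text \<open>\<open>\<P>\<^sub>r\<^sup>-\<Lambda>\<^sup>j = \<P>\<^sub>r\<^sub>-\<^sub>1\<Lambda>\<^sup>j + \<kappa>\<P>\<^sub>r\<^sub>-\<^sub>1\<Lambda>\<^sup>j\<^sup>+\<^sup>1\<close>; the case distinction accounts for \<open>\<P>\<^sub>-\<^sub>1 = 0\<close>.\<close>

definition trimmed_poly_forms :: "nat \<Rightarrow> int \<Rightarrow> 'n::{finite,linorder} dform set" where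
  "trimmed_poly_forms r j =
     (if r = 0 then {\<lambda>x. 0}
      else {\<lambda>x. \<alpha> x + contract x (\<beta> x) |\<alpha> \<beta>.
              \<alpha> \<in> full_poly_forms (r - 1) j \<and> \<beta> \<in> full_poly_forms (r - 1) (j + 1)})"

datatype poly_family = Full nat | Trimmed nat

fun poly_forms :: "poly_family \<Rightarrow> int \<Rightarrow> 'n::{finite,linorder} dform set" where
  "poly_forms (Full r) j = full_poly_forms r j"
| "poly_forms (Trimmed r) j = trimmed_poly_forms r j"

definition stable_pair :: "poly_family \<Rightarrow> poly_family \<Rightarrow> bool" where
  "stable_pair A B \<longleftrightarrow> (\<exists>r. A \<in> {Full (r + 1), Trimmed (r + 1)} \<and>
     (1 \<le> r \<and> B = Full r \<or> B = Trimmed (r + 1)))"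

definition fe_space :: "'n pt set \<Rightarrow> 'n pt set set \<Rightarrow> poly_family \<Rightarrow> int
    \<Rightarrow> 'n::{finite,linorder} dform set" where
  "fe_space \<Omega> \<T> A j =
     {v \<in> H_forms \<Omega> j. \<forall>K\<in>\<T>. \<exists>q\<in>poly_forms A j. AE x in lebesgue_on K. v x = q x}"


section \<open>Broken forms and their projection\<close>

text \<open>A broken form assigns to every cell \<open>K\<close> a form on \<open>K\<close>; only its values on the cells
  of the mesh are relevant.\<close>

type_synonym 'n broken = "'n pt set \<Rightarrow> 'n pt \<Rightarrow> 'n form"

definition broken_space :: "'n pt set set \<Rightarrow> poly_family \<Rightarrow> int \<Rightarrow> 'n::{finite,linorder} broken set" where
  "broken_space \<T> A j = {w. \<forall>K\<in>\<T>. w K \<in> poly_forms A j}"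

definition broken_inner :: "'n pt set set \<Rightarrow> 'n::{finite,linorder} broken \<Rightarrow> 'n broken \<Rightarrow> real" where
  "broken_inner \<T> v w = (\<Sum>K\<in>\<T>. L2_inner K (v K) (w K))"

definition broken_norm :: "'n pt set set \<Rightarrow> 'n::{finite,linorder} broken \<Rightarrow> real" where
  "broken_norm \<T> v = sqrt (\<Sum>K\<in>\<T>. (L2_norm K (v K))\<^sup>2)"

definition broken_proj :: "'n pt set set \<Rightarrow> poly_family \<Rightarrow> int \<Rightarrow> 'n::{finite,linorder} dform
    \<Rightarrow> 'n broken" where
  "broken_proj \<T> A j v = (SOME w. w \<in> broken_space \<T> A j \<and>
     (\<forall>z\<in>broken_space \<T> A j. broken_inner \<T> w z = broken_inner \<T> (\<lambda>K. v) z))"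


section \<open>Traces on cell boundaries\<close>

text \<open>The sign of the normal is irrelevant for everything below.\<close>

definition facet_normal :: "'n pt set \<Rightarrow> 'n::finite pt" where
  "facet_normal F = (SOME \<nu>. norm \<nu> = 1 \<and> (\<forall>x\<in>F. \<forall>y\<in>F. (x - y) \<bullet> \<nu> = 0))"

text \<open>Surface measure on a facet \<open>F\<close>: the image under orthogonal projection onto the hyperplane of
  \<open>F\<close> of Lebesgue measure on the right prism of height one over \<open>F\<close>.\<close>

definition facet_measure :: "'n::finite pt set \<Rightarrow> 'n pt measure" where
  "facet_measure F =
     distr (lebesgue_on {x + t *\<^sub>R facet_normal F |x t. x \<in> F \<and> 0 \<le> t \<and> t \<le> 1})
           borel (closest_point (affine hull F))"

text \<open>An alternating form on the tangent space \<open>T\<close> of a facet is identified (isometrically) with its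
  pullback under the orthogonal projection onto \<open>T\<close>, i.e. with the form on the whole space that agrees
  with it on \<open>T\<close> and annihilates the normal. With this identification the pullback of \<open>\<omega>\<close> to
  the facet is the following form.\<close>

definition tan_part :: "'n pt set \<Rightarrow> 'n::{finite,linorder} form \<Rightarrow> 'n form" where
  "tan_part F \<omega> = form_pullback (\<lambda>v. v - (v \<bullet> facet_normal F) *\<^sub>R facet_normal F) \<omega>"

text \<open>Forms on the disjoint union of the cell boundaries: the value depends on the cell \<open>K\<close>, the facet
  \<open>F\<close> of \<open>K\<close> and the point of \<open>F\<close>.\<close>

type_synonym 'n bdform = "'n pt set \<Rightarrow> 'n pt set \<Rightarrow> 'n pt \<Rightarrow> 'n form"

definition tan_trace :: "'n::{finite,linorder} broken \<Rightarrow> 'n bdform" where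
  "tan_trace w = (\<lambda>K F x. tan_part F (w K x))"

definition hat_space :: "'n pt set set \<Rightarrow> poly_family \<Rightarrow> int \<Rightarrow> 'n::{finite,linorder} bdform set" where
  "hat_space \<T> A j = tan_trace ` broken_space \<T> A j"

definition bd_inner :: "'n pt set \<Rightarrow> 'n::{finite,linorder} bdform \<Rightarrow> 'n bdform \<Rightarrow> real" where
  "bd_inner K a b = (\<Sum>F | F facet_of K. LINT x|facet_measure F. a K F x \<bullet> b K F x)"

definition mesh_bd_inner :: "'n pt set set \<Rightarrow> 'n::{finite,linorder} bdform \<Rightarrow> 'n bdform \<Rightarrow> real" where
  "mesh_bd_inner \<T> a b = (\<Sum>K\<in>\<T>. bd_inner K a b)"

definition scaled_bd_norm :: "'n pt set \<Rightarrow> 'n::{finite,linorder} bdform \<Rightarrow> real" where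
  "scaled_bd_norm K a = sqrt (diameter K) * sqrt (bd_inner K a a)"

definition scaled_mesh_bd_norm :: "'n pt set set \<Rightarrow> 'n::{finite,linorder} bdform \<Rightarrow> real" where
  "scaled_mesh_bd_norm \<T> a = sqrt (\<Sum>K\<in>\<T>. (scaled_bd_norm K a)\<^sup>2)"

text \<open>\<open>q\<close> is the projection of the normal trace of the \<open>(j+1)\<close>-form \<open>v\<close> onto the tangential traces of broken
  \<open>j\<close>-forms. Every element of the test space is \<open>tan_trace \<tau>\<close> for a broken form \<open>\<tau>\<close>.\<close>

definition is_nor_proj :: "'n pt set set \<Rightarrow> poly_family \<Rightarrow> int \<Rightarrow> 'n::{finite,linorder} dform
    \<Rightarrow> 'n bdform \<Rightarrow> bool" where
  "is_nor_proj \<T> A j v q \<longleftrightarrow> q \<in> hat_space \<T> A j \<and>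
     (\<forall>\<tau>\<in>broken_space \<T> A j.
        mesh_bd_inner \<T> q (tan_trace \<tau>) = (\<Sum>K\<in>\<T>. trace_pairing K j (\<tau> K) v))"

text \<open>The hybrid normal traces \<open>uhat\<close>, \<open>rhohat\<close> belonging to a discrete solution \<open>(\<sigma>, u, p)\<close>.\<close>

definition hybrid_traces :: "'n pt set \<Rightarrow> 'n pt set set \<Rightarrow> poly_family \<Rightarrow> poly_family \<Rightarrow> int
    \<Rightarrow> 'n::{finite,linorder} dform \<Rightarrow> 'n dform \<Rightarrow> 'n dform \<Rightarrow> 'n dform \<Rightarrow> 'n bdform \<Rightarrow> 'n bdform \<Rightarrow> bool" where
  "hybrid_traces \<Omega> \<T> A B k f \<sigma> u p uhat rhohat \<longleftrightarrow>
     uhat \<in> hat_space \<T> A (k - 1) \<and> rhohat \<in> hat_space \<T> B k \<and>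
     (\<forall>\<tau>\<in>broken_space \<T> A (k - 1).
        broken_inner \<T> (\<lambda>K. \<sigma>) \<tau> - broken_inner \<T> (\<lambda>K. u) (\<lambda>K. weak_d K (k - 1) (\<tau> K))
        + mesh_bd_inner \<T> uhat (tan_trace \<tau>) = 0) \<and>
     (\<forall>v\<in>broken_space \<T> B k.
        broken_inner \<T> (\<lambda>K. weak_d \<Omega> (k - 1) \<sigma>) v
        + broken_inner \<T> (\<lambda>K. weak_d \<Omega> k u) (\<lambda>K. weak_d K k (v K))
        + broken_inner \<T> (\<lambda>K. p) v
        - mesh_bd_inner \<T> rhohat (tan_trace v) = broken_inner \<T> (\<lambda>K. f) v)"

end

theory Submission
  imports Defs "HOL-Library.Function_Algebras" "HOL-Real_Asymp.Real_Asymp"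
begin

text \<open>
  On a cell \<open>K\<close> the codifferential of \<open>u\<close> is \<open>\<sigma>\<close>, so subtracting the equation of the hybrid trace from
  the one defining the projection of the normal trace gives
  \<open>\<langle>e\<^sub>u, \<tau>\<rangle> = (d\<tau>, P\<^sub>h u - u\<^sub>h)\<^sub>K - (\<tau>, \<sigma> - \<sigma>\<^sub>h)\<^sub>K\<close> for all polynomial \<open>\<tau>\<close>, because \<open>d\<tau>\<close> lies in the space onto which
  \<open>P\<^sub>h\<close> projects; the trace of \<open>\<rho>\<close> is treated in the same way with \<open>\<delta>\<rho> = f - d\<sigma> - p\<close>.
  It remains to test with a polynomial \<open>\<tau>\<close> that has tangential trace \<open>e\<^sub>u\<close> and for which \<open>\<parallel>\<tau>\<parallel>\<^sub>K\<close> and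
  \<open>h\<^sub>K \<parallel>d\<tau>\<parallel>\<^sub>K\<close> are bounded by \<open>h\<^sub>K\<^sup>1\<^sup>/\<^sup>2 \<parallel>e\<^sub>u\<parallel>\<close>. Such a lifting is found on a reference simplex by finite
  dimensionality and transported by affine pullback, which preserves the polynomial spaces and
  tangential traces; shape regularity bounds the linear part, divided by \<open>h\<^sub>K\<close>, and its inverse.
\<close>

section \<open>Exterior algebra\<close>

text \<open>A polynomial form is not determined by its tangential trace, so the boundary product is
  only a semi-inner product on polynomial forms, and a lifting reproduces a trace up to an element
  of seminorm zero; this is why the finite-dimensional theory is developed without definiteness. The
  normal traces of u and \<rho> enter only through differences of volume integrals, so what has to
  be known about them is the codifferential on each cell. Since \<open>weak_d\<close> is a choice,
  this calls for uniqueness of weak derivatives, hence for smooth bumps and integration by parts on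
  the whole space, and the cell interiors must lie inside \<Omega>, which is where the Lipschitz
  condition enters. Scaling is arranged so that the degree of a form does not matter: pullbacks are
  taken along the linear part divided by the diameter, so powers of h arise only from measures and
  from one differentiation. The transformation factors of surface and volume integrals differ by one
  power of h up to constants, and this is the source of the weight h^(1/2).\<close>

lemma shuffle_sign_Un_left:
  fixes I M :: "'n::{finite,linorder} set"
  assumes "I \<inter> I' = {}"
  shows "shuffle_sign (I \<union> I') M = shuffle_sign I M * shuffle_sign I' M"
proof -
  have "{(i, m). i \<in> I \<union> I' \<and> m \<in> M \<and> m < i}
      = {(i, m). i \<in> I \<and> m \<in> M \<and> m < i} \<union> {(i, m). i \<in> I' \<and> m \<in> M \<and> m < i}"
    by auto
  moreover have "{(i, m). i \<in> I \<and> m \<in> M \<and> m < i} \<inter> {(i, m). i \<in> I' \<and> m \<in> M \<and> m < i} = {}"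
    using assms by auto
  ultimately show ?thesis
    by (simp add: shuffle_sign_def card_Un_disjoint power_add)
qed

lemma shuffle_sign_Un_right:
  fixes I M :: "'n::{finite,linorder} set"
  assumes "M \<inter> M' = {}"
  shows "shuffle_sign I (M \<union> M') = shuffle_sign I M * shuffle_sign I M'"
proof -
  have "{(i, m). i \<in> I \<and> m \<in> M \<union> M' \<and> m < i}
      = {(i, m). i \<in> I \<and> m \<in> M \<and> m < i} \<union> {(i, m). i \<in> I \<and> m \<in> M' \<and> m < i}"
    by auto
  moreover have "{(i, m). i \<in> I \<and> m \<in> M \<and> m < i} \<inter> {(i, m). i \<in> I \<and> m \<in> M' \<and> m < i} = {}"
    using assms by auto
  ultimately show ?thesis
    by (simp add: shuffle_sign_def card_Un_disjoint power_add)
qed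

lemma shuffle_sign_insert_left:
  "i \<notin> I \<Longrightarrow> shuffle_sign (insert i I) M = shuffle_sign {i} M * shuffle_sign I M"
  using shuffle_sign_Un_left[of "{i}" I M] by simp

lemma shuffle_sign_insert_right:
  "m \<notin> M \<Longrightarrow> shuffle_sign I (insert m M) = shuffle_sign I {m} * shuffle_sign I M"
  using shuffle_sign_Un_right[of "{m}" M I] by simp

text \<open>Every pair in the product of I and M is an inversion for exactly one of the two
  orders.\<close>

lemma shuffle_sign_swap:
  fixes I M :: "'n::{finite,linorder} set"
  assumes "I \<inter> M = {}"
  shows "shuffle_sign I M * shuffle_sign M I = (-1) ^ (card I * card M)"
proof -
  have "I \<times> M = {(i, m). i \<in> I \<and> m \<in> M \<and> m < i} \<union> {(i, m). i \<in> I \<and> m \<in> M \<and> i < m}"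
    using assms by (auto simp: neq_iff)
  moreover have "{(i, m). i \<in> I \<and> m \<in> M \<and> m < i} \<inter> {(i, m). i \<in> I \<and> m \<in> M \<and> i < m} = {}"
    by auto
  ultimately have "card (I \<times> M) = card {(i, m). i \<in> I \<and> m \<in> M \<and> m < i}
      + card {(i, m). i \<in> I \<and> m \<in> M \<and> i < m}"
    by (simp add: card_Un_disjoint)
  moreover have "card {(i, m). i \<in> I \<and> m \<in> M \<and> i < m} = card {(m, i). m \<in> M \<and> i \<in> I \<and> i < m}"
    by (rule bij_betw_same_card[where f = prod.swap]) (auto simp: bij_betw_def inj_on_def image_iff)
  ultimately show ?thesis
    by (simp add: shuffle_sign_def card_cartesian_product flip: power_add)
qed

lemma shuffle_sign_neq_0 [simp]: "shuffle_sign I M \<noteq> 0"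
  by (simp add: shuffle_sign_def)

lemma shuffle_sign_eq_iff: "shuffle_sign I M * a = b \<longleftrightarrow> a = shuffle_sign I M * b"
  by (metis shuffle_sign_square mult.assoc mult.left_neutral)

section \<open>Interior products and pullbacks\<close>

lemma linear_contract: "linear (contract v)"
  by (rule linearI)
    (auto simp: contract_def vec_eq_iff distrib_left sum.distrib sum_distrib_left mult_ac)

lemma linear_contract_left: "linear (\<lambda>v. contract v \<omega>)"
  by (rule linearI)
    (auto simp: contract_def vec_eq_iff algebra_simps sum.distrib sum_distrib_left)

lemma bilinear_contract: "bilinear contract"
  by (simp add: bilinear_def linear_contract linear_contract_left)

text \<open>Written out, a double contraction is a sum over ordered pairs of distinct indices
  outside I. Exchanging the roles of i and m leaves the coefficient of \<omega> unchanged and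
  reverses only the sign \<open>shuffle_sign {m} {i}\<close>.\<close>

lemma contract_contract_swap: "contract v (contract w \<omega>) = - contract w (contract v \<omega>)"
proof -
  have eq: "contract v (contract w \<omega>) $ I
      = (\<Sum>i\<in>UNIV. \<Sum>m\<in>UNIV. if i \<notin> I \<and> m \<notin> I \<and> i \<noteq> m then
          v $ i * w $ m * (shuffle_sign {i} I * shuffle_sign {m} I * shuffle_sign {m} {i})
            * \<omega> $ insert m (insert i I) else 0)" for v w :: "'a pt" and I
  proof -
    have "contract v (contract w \<omega>) $ I
      = (\<Sum>i\<in>-I. \<Sum>m\<in>- insert i I. v $ i * w $ m * (shuffle_sign {i} I * shuffle_sign {m} (insert i I))
            * \<omega> $ insert m (insert i I))"
      unfolding contract_def vec_lambda_beta sum_distrib_left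
      by (rule sum.cong[OF refl], rule sum.cong[OF refl]) (simp only: ac_simps)
    also have "\<dots> = (\<Sum>i\<in>-I. \<Sum>m\<in>- insert i I. v $ i * w $ m *
        (shuffle_sign {i} I * shuffle_sign {m} I * shuffle_sign {m} {i}) * \<omega> $ insert m (insert i I))"
      by (rule sum.cong[OF refl], rule sum.cong[OF refl])
        (simp add: shuffle_sign_insert_right[of "_" I])
    also have "\<dots> = (\<Sum>i\<in>-I. \<Sum>m\<in>UNIV. if m \<notin> I \<and> i \<noteq> m then v $ i * w $ m *
        (shuffle_sign {i} I * shuffle_sign {m} I * shuffle_sign {m} {i}) * \<omega> $ insert m (insert i I) else 0)"
      by (rule sum.cong[OF refl], rule sum.mono_neutral_cong_left) auto
    also have "\<dots> = (\<Sum>i\<in>UNIV. \<Sum>m\<in>UNIV. if i \<notin> I \<and> m \<notin> I \<and> i \<noteq> m then v $ i * w $ m *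
        (shuffle_sign {i} I * shuffle_sign {m} I * shuffle_sign {m} {i}) * \<omega> $ insert m (insert i I) else 0)"
      by (rule sum.mono_neutral_cong_left) auto
    finally show ?thesis .
  qed
  have sw: "shuffle_sign {m} {i} = - shuffle_sign {i} {m}" if "i \<noteq> m" for i m :: 'a
    using shuffle_sign_swap[of "{i}" "{m}"] that shuffle_sign_square[of "{i}" "{m}"]
    by (simp add: shuffle_sign_eq_iff)
  show ?thesis
  proof (rule vec_eq_iff[THEN iffD2], rule allI)
    fix I
    have "contract v (contract w \<omega>) $ I = (\<Sum>m\<in>UNIV. \<Sum>i\<in>UNIV. if i \<notin> I \<and> m \<notin> I \<and> i \<noteq> m then
          v $ i * w $ m * (shuffle_sign {i} I * shuffle_sign {m} I * shuffle_sign {m} {i})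
            * \<omega> $ insert m (insert i I) else 0)"
      unfolding eq by (rule sum.swap)
    also have "\<dots> = (\<Sum>m\<in>UNIV. \<Sum>i\<in>UNIV. - (if m \<notin> I \<and> i \<notin> I \<and> m \<noteq> i then
          w $ m * v $ i * (shuffle_sign {m} I * shuffle_sign {i} I * shuffle_sign {i} {m})
            * \<omega> $ insert i (insert m I) else 0))"
    proof (rule sum.cong[OF refl], rule sum.cong[OF refl])
      fix m i
      show "(if i \<notin> I \<and> m \<notin> I \<and> i \<noteq> m then
          v $ i * w $ m * (shuffle_sign {i} I * shuffle_sign {m} I * shuffle_sign {m} {i})
            * \<omega> $ insert m (insert i I) else 0)
        = - (if m \<notin> I \<and> i \<notin> I \<and> m \<noteq> i then
          w $ m * v $ i * (shuffle_sign {m} I * shuffle_sign {i} I * shuffle_sign {i} {m})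
            * \<omega> $ insert i (insert m I) else 0)"
        using sw[of i m] insert_commute[of m i I] by auto
    qed
    also have "\<dots> = (- contract w (contract v \<omega>)) $ I"
      by (simp add: eq sum_negf)
    finally show "contract v (contract w \<omega>) $ I = (- contract w (contract v \<omega>)) $ I" .
  qed
qed

lemma contract_contract_same [simp]: "contract v (contract v \<omega>) = 0"
  using contract_contract_swap[of v v \<omega>] by (simp add: eq_neg_iff_add_eq_0 flip: scaleR_2)

lemma linear_fold_contract: "linear (fold contract vs)"
proof (induction vs)
  case Nil
  then show ?case by (simp add: linear_id[unfolded id_def])
next
  case (Cons v vs)
  then show ?case using linear_compose[OF linear_contract] by (simp add: comp_def)
qed

lemma linear_form_apply: "linear (\<lambda>\<omega>. form_apply \<omega> vs)"
  unfolding form_apply_def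
  by (rule linearI) (simp_all add: linear_add[OF linear_fold_contract] linear_scale[OF linear_fold_contract])

lemma linear_form_pullback: "linear (form_pullback L)"
  by (rule linearI)
    (simp_all add: form_pullback_def vec_eq_iff linear_add[OF linear_form_apply] linear_scale[OF linear_form_apply])

text \<open>Alternation: by anticommutativity the first contraction with \<open>g i\<close> is
  carried past the others until it meets its second occurrence, where the two cancel.\<close>

lemma fold_contract_eq_0:
  assumes "i \<in> set xs"
  shows "fold contract (map g xs) (contract (g i) \<omega>) = 0"
  using assms
proof (induction xs arbitrary: \<omega>)
  case (Cons y ys)
  show ?case
  proof (cases "y = i")
    case True
    then show ?thesis by (simp add: linear_0[OF linear_fold_contract])
  next
    case False
    have "fold contract (map g ys) (contract (g y) (contract (g i) \<omega>))
        = fold contract (map g ys) (contract (g i) (- contract (g y) \<omega>))"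
      by (subst contract_contract_swap) (simp add: linear_neg[OF linear_contract])
    with Cons False show ?thesis by simp
  qed
qed simp

text \<open>Carrying \<open>g i\<close> from its sorted position to the front passes exactly the
  entries below i, and each passage costs a sign.\<close>

lemma fold_contract_insort:
  fixes i :: "'n::{finite,linorder}"
  assumes "sorted xs" "i \<notin> set xs"
  shows "fold contract (map g (insort i xs)) \<omega>
    = (-1) ^ card {m \<in> set xs. m < i} *\<^sub>R fold contract (map g xs) (contract (g i) \<omega>)"
  using assms
proof (induction xs arbitrary: \<omega>)
  case Nil
  then show ?case by simp
next
  case (Cons y ys)
  show ?case
  proof (cases "i \<le> y")
    case True
    then have "{m \<in> set (y # ys). m < i} = {}"
      using Cons.prems by force
    then have "card {m \<in> set (y # ys). m < i} = 0"
      by (simp only: card.empty)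
    with True show ?thesis by (simp del: list.set card_0_eq)
  next
    case False
    have ys: "{m \<in> set (y # ys). m < i} = insert y {m \<in> set ys. m < i}"
      using False by auto
    \<comment> \<open>The list may have repetitions, whereas the exponent counts a set. A repeated
      entry makes both sides vanish.\<close>
    show ?thesis
    proof (cases "y \<in> set ys")
      case y: True
      have "fold contract (map g (insort i ys)) (contract (g y) \<omega>) = 0"
        using y by (intro fold_contract_eq_0) (simp add: set_insort_key)
      moreover have "fold contract (map g ys) (contract (g y) (contract (g i) \<omega>)) = 0"
        using y by (rule fold_contract_eq_0)
      ultimately show ?thesis using False by simp
    next
      case y: False
      have "fold contract (map g (insort i ys)) (contract (g y) \<omega>)
        = (-1) ^ card {m \<in> set ys. m < i} *\<^sub>R fold contract (map g ys) (contract (g i) (contract (g y) \<omega>))"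
        using Cons by simp
      also have "\<dots> = - ((-1) ^ card {m \<in> set ys. m < i}) *\<^sub>R fold contract (map g ys) (contract (g y) (contract (g i) \<omega>))"
        by (subst contract_contract_swap) (simp add: linear_neg[OF linear_fold_contract])
      finally have "fold contract (map g (insort i ys)) (contract (g y) \<omega>) = \<dots>" .
      moreover have "card {m \<in> set (y # ys). m < i} = Suc (card {m \<in> set ys. m < i})"
        unfolding ys using y by simp
      ultimately show ?thesis
        using False by (simp del: list.set)
    qed
  qed
qed

lemma contract_axis:
  "contract (axis i 1) \<omega> $ I = (if i \<in> I then 0 else shuffle_sign {i} I * \<omega> $ insert i I)"
proof -
  have "contract (axis i 1) \<omega> $ I = (\<Sum>m\<in>- I. if m = i then shuffle_sign {i} I * \<omega> $ insert i I else 0)"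
    unfolding contract_def vec_lambda_beta by (intro sum.cong) (auto simp: axis_def)
  then show ?thesis by simp
qed

text \<open>Both sides are linear in \<open>v\<close>, so it suffices to compare them on basis vectors, where inserting
  \<open>L e\<^sub>i\<close> into the first slot or into its sorted position differ by a shuffle sign.\<close>

lemma form_pullback_contract:
  fixes L :: "'n::{finite,linorder} pt \<Rightarrow> 'n pt"
  assumes "linear L"
  shows "contract v (form_pullback L \<omega>) = form_pullback L (contract (L v) \<omega>)"
proof -
  have axis: "contract (axis i 1) (form_pullback L \<omega>) = form_pullback L (contract (L (axis i 1)) \<omega>)" for i
  proof (rule vec_eq_iff[THEN iffD2], rule allI)
    fix I :: "'n set"
    let ?g = "\<lambda>j. L (axis j 1)"
    show "contract (axis i 1) (form_pullback L \<omega>) $ I = form_pullback L (contract (L (axis i 1)) \<omega>) $ I"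
    proof (cases "i \<in> I")
      case True
      then show ?thesis
        using fold_contract_eq_0[of i "sorted_list_of_set I" ?g \<omega>]
        by (simp add: contract_axis form_pullback_def form_apply_def)
    next
      case False
      have "{(j, m). j \<in> {i} \<and> m \<in> I \<and> m < j} = Pair i ` {m \<in> I. m < i}"
        by auto
      then have "card {(j, m). j \<in> {i} \<and> m \<in> I \<and> m < j} = card {m \<in> I. m < i}"
        by (simp add: card_image inj_on_def)
      then have s: "shuffle_sign {i} I = (-1) ^ card {m \<in> I. m < i}"
        unfolding shuffle_sign_def by presburger
      have "form_pullback L \<omega> $ insert i I = shuffle_sign {i} I * form_pullback L (contract (?g i) \<omega>) $ I"
        using False fold_contract_insort[of "sorted_list_of_set I" i ?g \<omega>]
        by (simp add: form_pullback_def form_apply_def s)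
      with False show ?thesis
        by (simp add: contract_axis flip: mult.assoc)
    qed
  qed
  have "contract v (form_pullback L \<omega>) = contract (\<Sum>i\<in>UNIV. v $ i *\<^sub>R axis i 1) (form_pullback L \<omega>)"
    using basis_expansion[of v] by (simp add: scalar_mult_eq_scaleR)
  also have "\<dots> = (\<Sum>i\<in>UNIV. v $ i *\<^sub>R form_pullback L (contract (L (axis i 1)) \<omega>))"
    by (simp add: linear_sum[OF linear_contract_left] linear_scale[OF linear_contract_left] axis)
  also have "\<dots> = form_pullback L (contract (L (\<Sum>i\<in>UNIV. v $ i *\<^sub>R axis i 1)) \<omega>)"
    by (simp add: linear_sum[OF linear_contract_left] linear_scale[OF linear_contract_left] 
        linear_sum[OF linear_form_pullback] linear_scale[OF linear_form_pullback]
        linear_sum[OF assms] linear_scale[OF assms])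
  finally show ?thesis
    using basis_expansion[of v] by (simp add: scalar_mult_eq_scaleR)
qed

lemma form_apply_pullback:
  assumes "linear L"
  shows "form_apply (form_pullback L \<omega>) vs = form_apply \<omega> (map L vs)"
proof (induction vs arbitrary: \<omega>)
  case Nil
  then show ?case by (simp add: form_apply_def form_pullback_def)
next
  case (Cons v vs)
  then show ?case
    using form_pullback_contract[OF assms, of v \<omega>] by (simp add: form_apply_def)
qed

text \<open>The coefficients of a pullback are its values on basis tuples only; functoriality rests
  on \<open>form_apply_pullback\<close>, which supplies the values on all tuples.\<close>

lemma form_pullback_compose:
  assumes "linear L"
  shows "form_pullback M (form_pullback L \<omega>) = form_pullback (L \<circ> M) \<omega>"
  unfolding form_pullback_def[of M] form_apply_pullback[OF assms]
  by (simp add: form_pullback_def comp_def)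

text \<open>Basis vectors removed in increasing order produce no sign among themselves; only the
  signs against J remain. For empty J this shows that evaluation on a sorted basis tuple returns the
  coefficient.\<close>

lemma fold_contract_axis:
  fixes \<omega> :: "'n::{finite,linorder} form"
  assumes "distinct xs" "sorted xs" "set xs \<inter> J = {}"
  shows "fold contract (map (\<lambda>j. axis j 1) xs) \<omega> $ J = (\<Prod>x\<leftarrow>xs. shuffle_sign {x} J) * \<omega> $ (set xs \<union> J)"
  using assms
proof (induction xs arbitrary: \<omega>)
  case (Cons x xs)
  have "{(j, m). j \<in> {x} \<and> m \<in> set xs \<and> m < j} = {}"
    using Cons.prems by force
  then have 1: "shuffle_sign {x} (set xs) = 1"
    unfolding shuffle_sign_def by (simp only: card.empty power_0)
  have "shuffle_sign {x} (set xs \<union> J) = shuffle_sign {x} J"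
    using Cons.prems 1 by (subst shuffle_sign_Un_right) auto
  then show ?case using Cons by (simp add: contract_axis mult_ac)
qed simp

lemma form_pullback_id [simp]: "form_pullback (\<lambda>v. v) \<omega> = \<omega>"
proof -
  have "(\<Prod>x\<leftarrow>xs. shuffle_sign {x} {}) = 1" for xs :: "'a list"
    by (induction xs) (auto simp: shuffle_sign_def)
  then show ?thesis
    using fold_contract_axis[of "sorted_list_of_set J" "{}" \<omega> for J]
    by (simp add: vec_eq_iff form_pullback_def form_apply_def)
qed

section \<open>Degrees of forms\<close>

lemma has_degree_0 [simp]: "has_degree j 0"
  by (simp add: has_degree_def)

lemma has_degree_add: "has_degree j a \<Longrightarrow> has_degree j b \<Longrightarrow> has_degree j (a + b)"
  by (auto simp: has_degree_def) (metis add_cancel_right_left)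

lemma has_degree_scaleR: "has_degree j a \<Longrightarrow> has_degree j (c *\<^sub>R a)"
  by (auto simp: has_degree_def)

lemma has_degree_diff: "has_degree j a \<Longrightarrow> has_degree j b \<Longrightarrow> has_degree j (a - b)"
  using has_degree_add[of j a "(-1) *\<^sub>R b"] has_degree_scaleR[of j b "-1"] by simp

lemma has_degree_sum: "(\<And>i. i \<in> A \<Longrightarrow> has_degree j (f i)) \<Longrightarrow> has_degree j (sum f A)"
  by (induction A rule: infinite_finite_induct) (auto intro: has_degree_add)

lemma has_degree_axis: "has_degree j (axis I c) \<longleftrightarrow> c = 0 \<or> int (card I) = j"
  by (auto simp: has_degree_def axis_def)

lemma has_degree_contract:
  assumes "has_degree (j + 1) \<omega>"
  shows "has_degree j (contract v \<omega>)"
  unfolding has_degree_def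
proof (intro allI impI)
  fix I assume "contract v \<omega> $ I \<noteq> 0"
  then obtain i where "i \<notin> I" "\<omega> $ insert i I \<noteq> 0"
    unfolding contract_def by (auto elim!: sum.not_neutral_contains_not_neutral)
  with assms show "int (card I) = j"
    by (force simp: has_degree_def)
qed

lemma has_degree_fold_contract:
  "has_degree j \<omega> \<Longrightarrow> has_degree (j - int (length vs)) (fold contract vs \<omega>)"
proof (induction vs arbitrary: j \<omega>)
  case (Cons v vs)
  then show ?case
    using has_degree_contract[of "j - 1" \<omega> v] Cons.IH[of "j - 1" "contract v \<omega>"]
    by (simp add: algebra_simps)
qed simp

text \<open>After \<open>card I\<close> contractions the degree has dropped to j -
  \<open>card I\<close>, and the coefficient at the empty set survives only in degree 0.\<close>

lemma has_degree_form_pullback: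
  assumes "has_degree j \<omega>"
  shows "has_degree j (form_pullback L \<omega>)"
  unfolding has_degree_def
proof (intro allI impI)
  fix I assume *: "form_pullback L \<omega> $ I \<noteq> 0"
  have "has_degree (j - int (card I)) (fold contract (map (\<lambda>j. L (axis j 1)) (sorted_list_of_set I)) \<omega>)"
    using has_degree_fold_contract[OF assms, of "map (\<lambda>j. L (axis j 1)) (sorted_list_of_set I)"] by simp
  with * show "int (card I) = j"
    by (auto simp: form_pullback_def form_apply_def has_degree_def)
qed

lemma has_degree_hodge:
  fixes \<omega> :: "'n::{finite,linorder} form"
  assumes "has_degree j \<omega>"
  shows "has_degree (int CARD('n) - j) (hodge \<omega>)"
  unfolding has_degree_def
proof (intro allI impI)
  fix I :: "'n set" assume "hodge \<omega> $ I \<noteq> 0"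
  then have "int (card (- I)) = j"
    using assms by (simp add: hodge_def has_degree_def)
  moreover have "card I \<le> CARD('n)"
    by (rule card_mono) auto
  ultimately show "int (card I) = int CARD('n) - j"
    by (simp add: Compl_eq_Diff_UNIV card_Diff_subset)
qed

section \<open>Linearity and commutation of wedge products\<close>

lemma linear_hodge: "linear hodge"
  by (rule linearI) (simp_all add: hodge_def vec_eq_iff distrib_left mult_ac)

lemma linear_wedge_right: "linear (wedge \<alpha>)"
  by (rule linearI) (simp_all add: wedge_def vec_eq_iff distrib_left sum.distrib sum_distrib_left mult_ac)

lemma linear_wedge_left: "linear (\<lambda>\<alpha>. wedge \<alpha> \<beta>)"
  by (rule linearI)
    (simp_all add: wedge_def vec_eq_iff distrib_left distrib_right sum.distrib sum_distrib_left mult_ac)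

lemma wedge_axis:
  "wedge (axis {i} 1) \<beta> $ J = (if i \<in> J then shuffle_sign {i} (J - {i}) * \<beta> $ (J - {i}) else 0)"
proof -
  have "wedge (axis {i} 1) \<beta> $ J
      = (\<Sum>I\<in>Pow J. if I = {i} then shuffle_sign {i} (J - {i}) * \<beta> $ (J - {i}) else 0)"
    unfolding wedge_def vec_lambda_beta by (intro sum.cong) (auto simp: axis_def)
  also have "\<dots> = (if {i} \<in> Pow J then shuffle_sign {i} (J - {i}) * \<beta> $ (J - {i}) else 0)"
    by (rule sum.delta) simp
  finally show ?thesis by simp
qed

lemma wedge_UNIV: "wedge \<alpha> \<beta> $ UNIV = (\<Sum>I\<in>UNIV. shuffle_sign I (- I) * \<alpha> $ I * \<beta> $ (- I))"
  by (simp add: wedge_def Compl_eq_Diff_UNIV)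

lemma has_degree_wedge_axis:
  assumes "has_degree j \<beta>"
  shows "has_degree (j + 1) (wedge (axis {i} 1) \<beta>)"
  unfolding has_degree_def
proof (intro allI impI)
  fix J assume "wedge (axis {i} 1) \<beta> $ J \<noteq> 0"
  then have "i \<in> J" "int (card (J - {i})) = j"
    using assms by (auto simp: wedge_axis has_degree_def split: if_splits)
  moreover have "card J = Suc (card (J - {i}))"
    using card.remove[of J i] \<open>i \<in> J\<close> by simp
  ultimately show "int (card J) = j + 1"
    by linarith
qed

text \<open>Only complementary index sets contribute to the top coefficient, so the degree of
  \<alpha> alone fixes the sign.\<close>

lemma wedge_UNIV_commute:
  fixes \<alpha> \<beta> :: "'n::{finite,linorder} form"
  assumes "has_degree j \<alpha>" "0 \<le> j"
  shows "wedge \<beta> \<alpha> $ UNIV = (-1) ^ (nat j * (CARD('n) - nat j)) * wedge \<alpha> \<beta> $ UNIV"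
proof -
  have "wedge \<beta> \<alpha> $ UNIV = (\<Sum>I\<in>UNIV. shuffle_sign (- I) I * \<beta> $ (- I) * \<alpha> $ I)"
    unfolding wedge_UNIV
    by (rule sum.reindex_bij_witness[where i = uminus and j = uminus]) auto
  also have "\<dots> = (\<Sum>I\<in>UNIV. (-1) ^ (nat j * (CARD('n) - nat j)) * (shuffle_sign I (- I) * \<alpha> $ I * \<beta> $ (- I)))"
  proof (intro sum.cong refl)
    fix I :: "'n set"
    show "shuffle_sign (- I) I * \<beta> $ (- I) * \<alpha> $ I
      = (-1) ^ (nat j * (CARD('n) - nat j)) * (shuffle_sign I (- I) * \<alpha> $ I * \<beta> $ (- I))"
    proof (cases "\<alpha> $ I = 0")
      case False
      then have "card I = nat j" "card (- I) = CARD('n) - nat j"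
        using assms by (auto simp: has_degree_def Compl_eq_Diff_UNIV card_Diff_subset)
      then have "shuffle_sign (- I) I = (-1) ^ (nat j * (CARD('n) - nat j)) * shuffle_sign I (- I)"
        using shuffle_sign_swap[of I "- I"] by (simp add: shuffle_sign_eq_iff mult.commute)
      then show ?thesis by simp
    qed simp
  qed
  finally show ?thesis by (simp add: wedge_UNIV sum_distrib_left)
qed

text \<open>Each coefficient of a pullback comes from at most \<open>CARD('n)\<close> contractions
  with vectors of length at most B, so the constant depends on B but not on M.\<close>

lemma norm_form_pullback_bound:
  assumes "0 \<le> B"
  obtains C where "0 \<le> C"
    "\<And>(M :: 'n::{finite,linorder} pt \<Rightarrow> 'n pt) \<omega>. (\<And>x. norm (M x) \<le> B * norm x) \<Longrightarrow>
      norm (form_pullback M \<omega>) \<le> C * norm \<omega>"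
proof -
  obtain K where K: "0 < K" "\<And>v \<omega>. norm (contract v (\<omega> :: 'n form)) \<le> K * norm v * norm \<omega>"
    using bilinear_bounded_pos[OF bilinear_contract] by auto
  \<comment> \<open>At least 1, so that the number of contractions can be replaced by its
    maximum.\<close>
  define b where "b = max 1 (K * B)"
  have fold: "norm (fold contract vs \<omega>) \<le> b ^ length vs * norm \<omega>"
    if "\<And>v. v \<in> set vs \<Longrightarrow> norm v \<le> B" for vs and \<omega> :: "'n form"
    using that
  proof (induction vs arbitrary: \<omega>)
    case (Cons v vs)
    have "norm (contract v \<omega>) \<le> K * norm v * norm \<omega>"
      by (rule K)
    also have "\<dots> \<le> b * norm \<omega>"
      using Cons.prems[of v] \<open>0 < K\<close> unfolding b_def
      by (intro mult_right_mono) (auto simp: le_max_iff_disj)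
    finally have "norm (contract v \<omega>) \<le> b * norm \<omega>" .
    then have "b ^ length vs * norm (contract v \<omega>) \<le> b ^ length vs * (b * norm \<omega>)"
      by (intro mult_left_mono) (auto simp: b_def)
    with Cons.IH[of "contract v \<omega>"] Cons.prems show ?case
      by (force simp: mult_ac)
  qed simp
  show ?thesis
  proof (rule that[of "CARD('n set) * b ^ CARD('n)"])
    fix M :: "'n pt \<Rightarrow> 'n pt" and \<omega> :: "'n form"
    assume M: "\<And>x. norm (M x) \<le> B * norm x"
    have "\<bar>form_pullback M \<omega> $ J\<bar> \<le> b ^ CARD('n) * norm \<omega>" for J
    proof -
      let ?vs = "map (\<lambda>j. M (axis j 1)) (sorted_list_of_set J)"
      have len: "length ?vs \<le> CARD('n)"
        by (simp add: card_mono)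
      have "\<bar>form_pullback M \<omega> $ J\<bar> \<le> norm (fold contract ?vs \<omega>)"
        unfolding form_pullback_def form_apply_def by (simp add: component_le_norm_cart)
      also have "\<dots> \<le> b ^ length ?vs * norm \<omega>"
        using M[of "axis _ 1"] by (intro fold) (auto simp: norm_axis_1)
      also have "\<dots> \<le> b ^ CARD('n) * norm \<omega>"
        using len by (intro mult_right_mono power_increasing) (auto simp: b_def)
      finally show ?thesis .
    qed
    then have "(\<Sum>J\<in>UNIV. \<bar>form_pullback M \<omega> $ J\<bar>) \<le> (\<Sum>J\<in>(UNIV::'n set set). b ^ CARD('n) * norm \<omega>)"
      by (intro sum_mono) auto
    then show "norm (form_pullback M \<omega>) \<le> CARD('n set) * b ^ CARD('n) * norm \<omega>"
      using norm_le_l1_cart[of "form_pullback M \<omega>"] by simp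
  qed (simp add: b_def)
qed


section \<open>Smooth functions\<close>

lemma partial_eq: "(f has_derivative f') (at x) \<Longrightarrow> partial i f x = f' (axis i 1)"
  unfolding partial_def using frechet_derivative_at by metis

lemma smooth_differentiable: "smooth f \<Longrightarrow> f differentiable at x"
  unfolding smooth_def by (metis foldr.simps(1) id_apply)

lemma smooth_partial: "smooth f \<Longrightarrow> smooth (partial i f)"
  unfolding smooth_def
proof (intro allI)
  fix "is" x
  assume "\<forall>is x. foldr partial is f differentiable at x"
  then have "foldr partial (is @ [i]) f differentiable at x" by blast
  then show "foldr partial is (partial i f) differentiable at x" by simp
qed

lemma smooth_continuous_on: "smooth f \<Longrightarrow> continuous_on S f"
  by (meson continuous_at_imp_continuous_on differentiable_imp_continuous_within smooth_differentiable)

lemma partial_add: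
  assumes "f differentiable at x" "g differentiable at x"
  shows "partial i (\<lambda>x. f x + g x) x = partial i f x + partial i g x"
proof -
  obtain f' g' where "(f has_derivative f') (at x)" "(g has_derivative g') (at x)"
    using assms by (auto simp: differentiable_def)
  from partial_eq[OF this(1)] partial_eq[OF this(2)] partial_eq[OF has_derivative_add[OF this]]
  show ?thesis by simp
qed

lemma smooth_add:
  assumes "smooth f" "smooth g"
  shows "smooth (\<lambda>x. f x + g x)"
proof -
  have "foldr partial is (\<lambda>x. f x + g x) = (\<lambda>x. foldr partial is f x + foldr partial is g x)" for "is"
  proof (induction "is")
    case (Cons i "is")
    have "partial i (\<lambda>x. foldr partial is f x + foldr partial is g x) x
        = partial i (foldr partial is f) x + partial i (foldr partial is g) x" for x
      using assms by (intro partial_add) (auto simp: smooth_def)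
    then show ?case
      by (simp add: Cons fun_eq_iff)
  qed simp
  then show ?thesis
    using assms by (simp add: smooth_def differentiable_add)
qed

lemma partial_const [simp]: "partial i (\<lambda>x. c) = (\<lambda>x. 0)"
  by (rule ext) (simp add: partial_def)

lemma partial_nth:
  assumes "f differentiable at x"
  shows "partial i f x $ I = partial i (\<lambda>x. f x $ I) x"
proof -
  obtain f' where f': "(f has_derivative f') (at x)"
    using assms by (auto simp: differentiable_def)
  then have "((\<lambda>x. f x $ I) has_derivative (\<lambda>h. f' h $ I)) (at x)"
    by (rule bounded_linear.has_derivative[OF bounded_linear_vec_nth])
  with f' show ?thesis by (simp add: partial_eq)
qed

lemma has_degree_partial:
  assumes "f differentiable at x" "\<And>x. has_degree j (f x)"
  shows "has_degree j (partial i f x)"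
  unfolding has_degree_def
proof (intro allI impI)
  fix I assume *: "partial i f x $ I \<noteq> 0"
  show "int (card I) = j"
  proof (rule ccontr)
    assume "int (card I) \<noteq> j"
    then have "(\<lambda>x. f x $ I) = (\<lambda>x. 0)"
      using assms(2) by (auto simp: has_degree_def)
    with * show False
      using assms(1) by (simp add: partial_nth)
  qed
qed

lemma has_degree_ext_deriv:
  assumes "f differentiable at x" "\<And>x. has_degree j (f x)"
  shows "has_degree (j + 1) (ext_deriv f x)"
  unfolding ext_deriv_def
  by (intro has_degree_sum has_degree_wedge_axis has_degree_partial assms)

lemma continuous_on_ext_deriv:
  assumes "smooth f"
  shows "continuous_on S (ext_deriv f)"
  unfolding ext_deriv_def
  by (intro continuous_on_sum linear_continuous_on_compose[OF _ linear_wedge_right]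
      smooth_continuous_on smooth_partial assms)

section \<open>Smoothness of products of one-variable functions\<close>

primrec times_differentiable :: "nat \<Rightarrow> (real \<Rightarrow> real) \<Rightarrow> bool" where
  "times_differentiable 0 f \<longleftrightarrow> (\<forall>x. f field_differentiable at x)"
| "times_differentiable (Suc n) f \<longleftrightarrow> (\<forall>x. f field_differentiable at x) \<and> times_differentiable n (deriv f)"

lemma times_differentiableD: "times_differentiable n f \<Longrightarrow> f field_differentiable at x"
  by (cases n) auto

lemma times_differentiable_Suc: "times_differentiable (Suc n) f \<Longrightarrow> times_differentiable n f"
  by (induction n arbitrary: f) auto

lemma times_differentiable_const: "times_differentiable n (\<lambda>x. c)"
  by (induction n arbitrary: c) auto

lemma times_differentiable_add:
  "times_differentiable n f \<Longrightarrow> times_differentiable n g \<Longrightarrow> times_differentiable n (\<lambda>x. f x + g x)"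
proof (induction n arbitrary: f g)
  case (Suc n)
  then have "deriv (\<lambda>x. f x + g x) = (\<lambda>x. deriv f x + deriv g x)"
    by (auto intro!: deriv_add)
  with Suc show ?case by (auto intro: field_differentiable_add)
qed (auto intro: field_differentiable_add)

lemma times_differentiable_mult:
  "times_differentiable n f \<Longrightarrow> times_differentiable n g \<Longrightarrow> times_differentiable n (\<lambda>x. f x * g x)"
proof (induction n arbitrary: f g)
  case (Suc n)
  then have "deriv (\<lambda>x. f x * g x) = (\<lambda>x. f x * deriv g x + deriv f x * g x)"
    by (auto intro!: deriv_mult)
  moreover have "times_differentiable n f" "times_differentiable n g"
    using Suc.prems by (blast intro: times_differentiable_Suc)+
  ultimately show ?case
    using Suc by (auto intro: field_differentiable_mult times_differentiable_add)
qed (auto intro: field_differentiable_mult)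

lemma times_differentiable_affine:
  "times_differentiable n f \<Longrightarrow> times_differentiable n (\<lambda>x. f (c * x + d))"
proof (induction n arbitrary: f)
  case 0
  have "(\<lambda>x. c * x + d) field_differentiable at x" for x
    by (auto simp: field_differentiable_def intro!: exI derivative_eq_intros)
  then show ?case
    using field_differentiable_compose[of "\<lambda>x. c * x + d" _ f] 0
    by (auto simp: comp_def)
next
  case (Suc n)
  have *: "((\<lambda>x. f (c * x + d)) has_field_derivative deriv f (c * x + d) * c) (at x)" for x
  proof -
    have "(f has_field_derivative deriv f (c * x + d)) (at (c * x + d))"
      using Suc.prems times_differentiableD field_differentiable_derivI by blast
    moreover have "((\<lambda>x. c * x + d) has_field_derivative c) (at x)"
      by (auto intro!: derivative_eq_intros)
    ultimately show ?thesis
      by (rule DERIV_chain2[of f _ "\<lambda>x. c * x + d"])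
  qed
  then have "deriv (\<lambda>x. f (c * x + d)) = (\<lambda>x. deriv f (c * x + d) * c)"
    using DERIV_imp_deriv by blast
  moreover have "times_differentiable n (\<lambda>x. deriv f (c * x + d) * c)"
    using Suc by (auto intro: times_differentiable_mult times_differentiable_const)
  ultimately show ?case
    using * by (auto simp: field_differentiable_def)
qed

lemma times_differentiable_ident: "times_differentiable n (\<lambda>x. x)"
  by (cases n) (auto intro: field_differentiable_ident times_differentiable_const)

lemma times_differentiable_power: "times_differentiable n (\<lambda>x. x ^ a)"
  by (induction a) (auto intro: times_differentiable_const times_differentiable_mult times_differentiable_ident)

text \<open>The factor s^k makes the induction along the Horner form of p close: passing from p to
  \<open>pCons a p\<close> raises k by one.\<close>

lemma tendsto_poly_times_exp: "((\<lambda>s. s ^ k * poly p s * exp (- s)) \<longlongrightarrow> (0::real)) at_top"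
proof (induction p arbitrary: k)
  case 0
  then show ?case by simp
next
  case (pCons a p)
  have "((\<lambda>s::real. a * (s ^ k / exp s)) \<longlongrightarrow> a * 0) at_top"
    by (intro tendsto_mult tendsto_const tendsto_power_div_exp_0)
  moreover have "((\<lambda>s. s ^ Suc k * poly p s * exp (- s)) \<longlongrightarrow> 0) at_top"
    by (rule pCons)
  ultimately have "((\<lambda>s. a * (s ^ k / exp s) + s ^ Suc k * poly p s * exp (- s)) \<longlongrightarrow> a * 0 + 0) at_top"
    by (rule tendsto_add)
  then show ?case
    by (simp add: algebra_simps exp_minus divide_inverse)
qed

text \<open>The classical flat function exp(-1/t), with a polynomial in 1/t in front so that the
  family is closed under differentiation.\<close>

definition exp_germ :: "real poly \<Rightarrow> real \<Rightarrow> real" where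
  "exp_germ p t = (if 0 < t then poly p (1 / t) * exp (- (1 / t)) else 0)"

text \<open>With s = 1/t one has d/dt = - s^2 d/ds, so p(s) exp(-s) becomes s^2 (p(s) - p'(s))
  exp(-s), and \<open>[:0, 0, 1:]\<close> is s^2. At the origin the difference quotient from the
  right is s p(s) exp(-s), which tends to 0 as s tends to infinity.\<close>

lemma has_field_derivative_exp_germ:
  "(exp_germ p has_field_derivative exp_germ ([:0, 0, 1:] * (p - pderiv p)) t) (at t)"
proof (cases t "0 :: real" rule: linorder_cases)
  case less
  have "((\<lambda>x. 0) has_field_derivative 0) (at t)" by simp
  moreover have "\<forall>\<^sub>F x in nhds t. exp_germ p x = 0"
    using less eventually_nhds_in_open[of "{..<0}" t]
    by (auto simp: exp_germ_def elim!: eventually_mono)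
  ultimately show ?thesis
    using less DERIV_cong_ev[of t t "exp_germ p" "\<lambda>x. 0" 0 0] by (simp add: exp_germ_def)
next
  case greater
  have "((\<lambda>t. poly p (1 / t) * exp (- (1 / t))) has_field_derivative
      exp_germ ([:0, 0, 1:] * (p - pderiv p)) t) (at t)"
    using greater
    by (auto intro!: derivative_eq_intros poly_DERIV[THEN DERIV_chain2]
        simp: exp_germ_def field_simps power2_eq_square)
  moreover have "\<forall>\<^sub>F x in nhds t. exp_germ p x = poly p (1 / x) * exp (- (1 / x))"
    using greater eventually_nhds_in_open[of "{0<..}" t]
    by (auto simp: exp_germ_def elim!: eventually_mono)
  ultimately show ?thesis
    using DERIV_cong_ev[of t t "exp_germ p" "\<lambda>t. poly p (1 / t) * exp (- (1 / t))"] by blast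
next
  case equal
  have "((\<lambda>s. s ^ 1 * poly p s * exp (- s)) \<longlongrightarrow> (0::real)) at_top"
    by (rule tendsto_poly_times_exp)
  then have "((\<lambda>h. (1 / h) * poly p (1 / h) * exp (- (1 / h))) \<longlongrightarrow> (0::real)) (at_right 0)"
    by (simp add: filterlim_at_right_to_top divide_inverse)
  then have "((\<lambda>h. exp_germ p h / h) \<longlongrightarrow> 0) (at_right 0)"
    by (rule Lim_transform_eventually)
      (auto simp: exp_germ_def eventually_at_right_less intro!: eventually_mono[OF eventually_at_right_less])
  moreover have "((\<lambda>h. exp_germ p h / h) \<longlongrightarrow> 0) (at_left 0)"
    by (rule Lim_transform_eventually[OF tendsto_const])
      (auto simp: exp_germ_def eventually_at_left_field intro!: exI[of _ "-1"])
  ultimately have "((\<lambda>h. exp_germ p h / h) \<longlongrightarrow> 0) (at 0)"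
    by (simp add: filterlim_split_at)
  then show ?thesis
    using equal by (simp add: DERIV_def exp_germ_def)
qed

lemma times_differentiable_exp_germ: "times_differentiable n (exp_germ p)"
proof (induction n arbitrary: p)
  case 0
  then show ?case using has_field_derivative_exp_germ by (auto simp: field_differentiable_def)
next
  case (Suc n)
  have "deriv (exp_germ p) = exp_germ ([:0, 0, 1:] * (p - pderiv p))"
    using has_field_derivative_exp_germ DERIV_imp_deriv by blast
  with Suc show ?case
    using has_field_derivative_exp_germ by (auto simp: field_differentiable_def)
qed

lemma partial_prod:
  fixes F :: "'n::finite \<Rightarrow> real \<Rightarrow> real"
  assumes "\<And>i x. F i field_differentiable at x"
  shows "((\<lambda>x. (\<Prod>i\<in>UNIV. F i (x $ i)) *\<^sub>R c) differentiable at x)"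
    and "partial m (\<lambda>x. (\<Prod>i\<in>UNIV. F i (x $ i)) *\<^sub>R c) x
      = (\<Prod>i\<in>UNIV. (F(m := deriv (F m))) i (x $ i)) *\<^sub>R c"
proof -
  have "((\<lambda>x. F i (x $ i)) has_derivative (\<lambda>y. deriv (F i) (x $ i) * y $ i)) (at x)" for i
  proof -
    have "(F i has_derivative (\<lambda>h. deriv (F i) (x $ i) * h)) (at (x $ i))"
      using assms field_differentiable_derivI has_field_derivative_def by blast
    then show ?thesis
      by (rule has_derivative_compose[rotated])
        (auto intro: bounded_linear.has_derivative[OF bounded_linear_vec_nth])
  qed
  then have D: "((\<lambda>x. (\<Prod>i\<in>UNIV. F i (x $ i)) *\<^sub>R c) has_derivative
      (\<lambda>y. (\<Sum>i\<in>UNIV. deriv (F i) (x $ i) * y $ i * (\<Prod>j\<in>UNIV - {i}. F j (x $ j))) *\<^sub>R c)) (at x)"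
    by (intro has_derivative_scaleR_left has_derivative_prod) 
  then show "(\<lambda>x. (\<Prod>i\<in>UNIV. F i (x $ i)) *\<^sub>R c) differentiable at x"
    by (auto simp: differentiable_def)
  have "(\<Sum>i\<in>UNIV. deriv (F i) (x $ i) * axis m 1 $ i * (\<Prod>j\<in>UNIV - {i}. F j (x $ j)))
      = (\<Sum>i\<in>UNIV. if i = m then deriv (F m) (x $ m) * (\<Prod>j\<in>UNIV - {m}. F j (x $ j)) else 0)"
    by (intro sum.cong) (auto simp: axis_def)
  also have "\<dots> = deriv (F m) (x $ m) * (\<Prod>j\<in>UNIV - {m}. F j (x $ j))"
    by simp
  also have "\<dots> = (\<Prod>i\<in>UNIV. (F(m := deriv (F m))) i (x $ i))"
    by (subst prod.remove[of UNIV m]) auto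
  finally show "partial m (\<lambda>x. (\<Prod>i\<in>UNIV. F i (x $ i)) *\<^sub>R c) x
      = (\<Prod>i\<in>UNIV. (F(m := deriv (F m))) i (x $ i)) *\<^sub>R c"
    using partial_eq[OF D, of m] by simp
qed

text \<open>A partial derivative replaces a single factor by its derivative, so iterated partial
  derivatives remain products of the same kind. Monomials and the bumps of boxes both have this
  form.\<close>

lemma smooth_prod:
  fixes F :: "'n::finite \<Rightarrow> real \<Rightarrow> real"
  assumes "\<And>n i. times_differentiable n (F i)"
  shows "smooth (\<lambda>x. (\<Prod>i\<in>UNIV. F i (x $ i)) *\<^sub>R c)"
proof -
  have *: "\<exists>G. (\<forall>n i. times_differentiable n (G i)) \<and>
      foldr partial is (\<lambda>x. (\<Prod>i\<in>UNIV. F i (x $ i)) *\<^sub>R c) = (\<lambda>x. (\<Prod>i\<in>UNIV. G i (x $ i)) *\<^sub>R c)" for "is"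
  proof (induction "is")
    case Nil
    then show ?case using assms by auto
  next
    case (Cons m "is")
    then obtain G where G: "\<And>n i. times_differentiable n (G i)"
      "foldr partial is (\<lambda>x. (\<Prod>i\<in>UNIV. F i (x $ i)) *\<^sub>R c) = (\<lambda>x. (\<Prod>i\<in>UNIV. G i (x $ i)) *\<^sub>R c)"
      by blast
    have "times_differentiable n ((G(m := deriv (G m))) i)" for n i
      using G(1)[of n i] G(1)[of "Suc n" m] by auto
    moreover have "foldr partial (m # is) (\<lambda>x. (\<Prod>i\<in>UNIV. F i (x $ i)) *\<^sub>R c)
        = (\<lambda>x. (\<Prod>i\<in>UNIV. (G(m := deriv (G m))) i (x $ i)) *\<^sub>R c)"
      using partial_prod(2)[of G m c] times_differentiableD[OF G(1)] by (simp add: G(2) fun_eq_iff)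
    ultimately show ?case by blast
  qed
  have "foldr partial is (\<lambda>x. (\<Prod>i\<in>UNIV. F i (x $ i)) *\<^sub>R c) differentiable at x" for "is" x
  proof -
    from *[of "is"] obtain G where G: "\<And>n i. times_differentiable n (G i)"
      "foldr partial is (\<lambda>x. (\<Prod>i\<in>UNIV. F i (x $ i)) *\<^sub>R c) = (\<lambda>x. (\<Prod>i\<in>UNIV. G i (x $ i)) *\<^sub>R c)"
      by blast
    show ?thesis
      unfolding G(2) by (rule partial_prod) (rule times_differentiableD[OF G(1)])
  qed
  then show ?thesis
    unfolding smooth_def by blast
qed


section \<open>Uniqueness of weak derivatives\<close>

text \<open>Passes from the restricted Lebesgue measure to \<open>lborel\<close> on the whole space,
  where translation invariance is available.\<close>

lemma integral_lebesgue_on_compact_support: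
  fixes h :: "'a::euclidean_space \<Rightarrow> real"
  assumes "continuous_on UNIV h" "compact C" "C \<subseteq> S" "S \<in> sets lebesgue" "\<And>x. x \<notin> C \<Longrightarrow> h x = 0"
  shows "(LINT x|lebesgue_on S. h x) = (LINT x|lborel. h x)" "integrable lborel h"
    "integrable (lebesgue_on S) h"
proof -
  have eq: "(\<lambda>x. indicator C x *\<^sub>R h x) = h" "(\<lambda>x. indicator S x *\<^sub>R h x) = h"
    using assms(3,5) by (auto simp: indicator_def fun_eq_iff)
  have meas: "h \<in> borel_measurable lborel"
    using assms(1) by (simp add: borel_measurable_continuous_onI)
  have "integrable lborel (\<lambda>x. indicator C x *\<^sub>R h x)"
    by (intro borel_integrable_compact assms(2) continuous_on_subset[OF assms(1)]) auto
  then show int: "integrable lborel h"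
    by (simp only: eq(1))
  have "(LINT x|lebesgue_on S. h x) = (LINT x|lebesgue. indicator S x *\<^sub>R h x)"
    using assms(4) by (subst integral_restrict_space) auto
  also have "\<dots> = (LINT x|lborel. h x)"
    using meas unfolding eq(2) by (simp add: integral_completion)
  finally show "(LINT x|lebesgue_on S. h x) = (LINT x|lborel. h x)" .
  have "integrable lebesgue (\<lambda>x. indicator S x *\<^sub>R h x)"
    using int meas unfolding eq(2) by (simp add: integrable_completion)
  then show "integrable (lebesgue_on S) h"
    using assms(4) by (subst integrable_restrict_space) auto
qed

text \<open>The partial derivative is the limit of difference quotients, whose integrals vanish
  because Lebesgue measure is invariant under translations.\<close>

lemma integral_partial_eq_0:
  fixes \<phi> :: "'n::finite pt \<Rightarrow> real"
  assumes diff: "\<And>x. \<phi> differentiable at x" and cont: "continuous_on UNIV (partial i \<phi>)"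
    and C: "compact C" "\<And>x. x \<notin> C \<Longrightarrow> \<phi> x = 0"
  shows "(LINT x|lborel. partial i \<phi> x) = 0"
proof -
  let ?e = "axis i 1 :: 'n pt"
  have \<phi>_cont: "continuous_on UNIV \<phi>"
    using diff by (simp add: continuous_on_eq_continuous_at differentiable_imp_continuous_within)
  have line: "((\<lambda>t. \<phi> (x + t *\<^sub>R ?e)) has_real_derivative partial i \<phi> (x + t *\<^sub>R ?e)) (at t)" for x t
  proof -
    obtain f' where f': "(\<phi> has_derivative f') (at (x + t *\<^sub>R ?e))"
      using diff by (auto simp: differentiable_def)
    have "((\<lambda>t. x + t *\<^sub>R ?e) has_derivative (\<lambda>s. s *\<^sub>R ?e)) (at t)"
      by (auto intro!: derivative_eq_intros)
    from has_derivative_compose[OF this f']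
    have "((\<lambda>t. \<phi> (x + t *\<^sub>R ?e)) has_derivative (\<lambda>s. f' (s *\<^sub>R ?e))) (at t)" .
    moreover have "(\<lambda>s. f' (s *\<^sub>R ?e)) = (*) (partial i \<phi> (x + t *\<^sub>R ?e))"
      using linear_scale[OF has_derivative_linear[OF f']] by (simp add: partial_eq[OF f'] fun_eq_iff)
    ultimately show ?thesis
      by (simp add: has_field_derivative_def)
  qed
  have supp: "partial i \<phi> x = 0" if "x \<notin> C" for x
  proof -
    have "open (- C)" using compact_imp_closed[OF C(1)] by (rule open_Compl)
    then have "(\<phi> has_derivative (\<lambda>h. 0)) (at x)"
      by (rule has_derivative_transform_within_open[OF has_derivative_const]) (use that C(2) in auto)
    then show ?thesis by (simp add: partial_eq)
  qed
  obtain M where M: "\<And>x. \<bar>partial i \<phi> x\<bar> \<le> M" "0 \<le> M"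
  proof -
    have "bounded (partial i \<phi> ` C)"
      by (intro compact_imp_bounded compact_continuous_image continuous_on_subset[OF cont] C) auto
    then obtain M where M: "0 < M" "\<And>x. x \<in> C \<Longrightarrow> \<bar>partial i \<phi> x\<bar> \<le> M"
      by (auto simp: bounded_pos)
    have "\<bar>partial i \<phi> x\<bar> \<le> M" for x
      using M supp[of x] by (cases "x \<in> C") auto
    with M(1) show ?thesis by (intro that[of M]) auto
  qed
  obtain R where R: "C \<subseteq> cball 0 R" "0 < R"
    using compact_imp_bounded[OF C(1)] by (auto simp: bounded_pos subset_eq)
  define t :: "nat \<Rightarrow> real" where "t n = inverse (Suc n)" for n
  have t: "0 < t n" "t n \<le> 1" for n
    by (auto simp: t_def inverse_le_1_iff)
  define D where "D n x = (\<phi> (x + t n *\<^sub>R ?e) - \<phi> x) / t n" for n x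
  have int\<phi>: "integrable lborel \<phi>"
    by (rule integral_lebesgue_on_compact_support(2)[of _ C UNIV]) (use \<phi>_cont C in auto)
  have D0: "integral\<^sup>L lborel (D n) = 0" for n
  proof -
    have meas: "\<phi> \<in> borel_measurable borel"
      using \<phi>_cont by (simp add: borel_measurable_continuous_onI)
    have i: "integrable lborel (\<lambda>x. \<phi> (t n *\<^sub>R ?e + x))"
      using integrable_distr_eq[of "(+) (t n *\<^sub>R ?e)" lborel borel \<phi>] meas int\<phi>
      by (simp add: lborel_distr_plus)
    have "integral\<^sup>L lborel \<phi> = (LINT x|lborel. \<phi> (t n *\<^sub>R ?e + x))"
      using integral_distr[of "(+) (t n *\<^sub>R ?e)" lborel borel \<phi>] meas
      by (simp add: lborel_distr_plus)
    with i int\<phi> show ?thesis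
      unfolding D_def by (simp add: add.commute)
  qed
  \<comment> \<open>The mean value theorem bounds the quotients by M, and since the steps have
    length at most 1, all quotients vanish outside the ball of radius R + 1.\<close>
  have "(\<lambda>n. integral\<^sup>L lborel (D n)) \<longlonglongrightarrow> (LINT x|lborel. partial i \<phi> x)"
  proof (rule integral_dominated_convergence[where w = "\<lambda>x. M * indicator (cball 0 (R + 1)) x"])
    show "partial i \<phi> \<in> borel_measurable lborel"
      using cont by (simp add: borel_measurable_continuous_onI)
    show "D n \<in> borel_measurable lborel" for n
      unfolding D_def by simp
        (intro borel_measurable_continuous_onI continuous_intros continuous_on_compose2[OF \<phi>_cont], auto simp: t_def)
    show "integrable lborel (\<lambda>x :: 'n pt. M * indicator (cball 0 (R + 1)) x :: real)"
      by (intro integrable_mult_right integrable_real_indicator) 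
        (use emeasure_bounded_finite[of "cball 0 (R + 1) :: 'n pt set"] in auto)
    show "AE x in lborel. (\<lambda>n. D n x) \<longlonglongrightarrow> partial i \<phi> x"
    proof (rule AE_I2)
      fix x
      have "((\<lambda>h. (\<phi> (x + h *\<^sub>R ?e) - \<phi> x) / h) \<longlongrightarrow> partial i \<phi> x) (at 0)"
        using line[of x 0] by (simp add: DERIV_def)
      moreover have "filterlim t (at 0) sequentially"
        unfolding filterlim_at using t(1) LIMSEQ_inverse_real_of_nat
        by (auto simp: t_def[abs_def] inverse_eq_divide intro!: always_eventually)
      ultimately show "(\<lambda>n. D n x) \<longlonglongrightarrow> partial i \<phi> x"
        unfolding D_def by (rule filterlim_compose)
    qed
    show "AE x in lborel. norm (D n x) \<le> M * indicator (cball 0 (R + 1)) x" for n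
    proof (rule AE_I2)
      fix x
      obtain z where z: "0 < z" "z < t n" "\<phi> (x + t n *\<^sub>R ?e) - \<phi> (x + 0 *\<^sub>R ?e) = (t n - 0) * partial i \<phi> (x + z *\<^sub>R ?e)"
        using MVT2[OF t(1)[of n], of "\<lambda>t. \<phi> (x + t *\<^sub>R ?e)" "\<lambda>t. partial i \<phi> (x + t *\<^sub>R ?e)"] line by blast
      then have D: "D n x = partial i \<phi> (x + z *\<^sub>R ?e)"
        using t(1)[of n] by (simp add: D_def)
      show "norm (D n x) \<le> M * indicator (cball 0 (R + 1)) x"
      proof (cases "x \<in> cball 0 (R + 1)")
        case False
        have "norm x \<le> norm (x + z *\<^sub>R ?e) + norm (z *\<^sub>R ?e)"
          using norm_triangle_sub[of x "x + z *\<^sub>R ?e"] by simp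
        with False z t(2)[of n] have "x + z *\<^sub>R ?e \<notin> cball 0 R"
          by (auto simp: norm_axis_1)
        with R(1) have "x + z *\<^sub>R ?e \<notin> C" by blast
        with supp show ?thesis using False by (simp add: D)
      qed (use M D in auto)
    qed
  qed
  moreover have "(\<lambda>n. integral\<^sup>L lborel (D n)) \<longlonglongrightarrow> 0"
    by (simp add: D0)
  ultimately show ?thesis
    using LIMSEQ_unique by blast
qed

text \<open>Pairs (J, i) with i in J correspond to pairs (i, I) with i not in I through I = J - {i}.
  This sorts the terms of an exterior derivative by the coefficient that is differentiated.\<close>

lemma sum_insert_swap:
  fixes G :: "'n::finite \<Rightarrow> 'n set \<Rightarrow> 'b::comm_monoid_add"
  shows "(\<Sum>J\<in>UNIV. \<Sum>i\<in>J. G i (J - {i})) = (\<Sum>i\<in>UNIV. \<Sum>I | i \<notin> I. G i I)"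
proof -
  have "(\<Sum>J\<in>UNIV. \<Sum>i\<in>J. G i (J - {i})) = (\<Sum>(J, i)\<in>(SIGMA J:UNIV. J). G i (J - {i}))"
    by (rule sum.Sigma) auto
  also have "\<dots> = (\<Sum>(i, I)\<in>(SIGMA i:UNIV. {I. i \<notin> I}). G i I)"
    by (rule sum.reindex_bij_witness[where i = "\<lambda>(i, I). (insert i I, i)" and j = "\<lambda>(J, i). (i, J - {i})"])
      (auto simp: insert_absorb)
  also have "\<dots> = (\<Sum>i\<in>UNIV. \<Sum>I | i \<notin> I. G i I)"
    by (rule sum.Sigma[symmetric]) auto
  finally show ?thesis .
qed

text \<open>The Leibniz rule for the top coefficient, arranged as a combination of full partial
  derivatives of scalar products, each of which integrates to zero once \<zeta> has compact
  support.\<close>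

lemma wedge_ext_deriv_expand:
  fixes \<eta> \<zeta> :: "'n::{finite,linorder} dform"
  assumes \<eta>: "\<eta> differentiable at x" "\<And>x. has_degree j (\<eta> x)" and \<zeta>: "\<zeta> differentiable at x"
  shows "wedge (ext_deriv \<eta> x) (\<zeta> x) $ UNIV - (-1) powi (j + 1) * wedge (\<eta> x) (ext_deriv \<zeta> x) $ UNIV
    = (\<Sum>i\<in>UNIV. \<Sum>I | i \<notin> I. shuffle_sign (insert i I) (- insert i I) * shuffle_sign {i} I
         * partial i (\<lambda>x. \<eta> x $ I * \<zeta> x $ (- insert i I)) x)"
proof -
  have nth: "ext_deriv f x $ J = (\<Sum>i\<in>J. shuffle_sign {i} (J - {i}) * partial i f x $ (J - {i}))"
    for f :: "'n dform" and J
  proof -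
    have "ext_deriv f x $ J = (\<Sum>i\<in>UNIV. if i \<in> J then shuffle_sign {i} (J - {i}) * partial i f x $ (J - {i}) else 0)"
      by (simp add: ext_deriv_def wedge_axis)
    then show ?thesis by (simp add: sum.If_cases)
  qed
  have "wedge (ext_deriv \<eta> x) (\<zeta> x) $ UNIV
      = (\<Sum>J\<in>UNIV. \<Sum>i\<in>J. shuffle_sign (insert i (J - {i})) (- insert i (J - {i})) * shuffle_sign {i} (J - {i})
          * (partial i \<eta> x $ (J - {i}) * \<zeta> x $ (- insert i (J - {i}))))"
    unfolding wedge_UNIV nth sum_distrib_left sum_distrib_right
    by (rule sum.cong[OF refl], rule sum.cong[OF refl]) (simp add: insert_absorb)
  also have "\<dots> = (\<Sum>i\<in>UNIV. \<Sum>I | i \<notin> I. shuffle_sign (insert i I) (- insert i I) * shuffle_sign {i} I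
      * (partial i \<eta> x $ I * \<zeta> x $ (- insert i I)))"
    by (rule sum_insert_swap)
  finally have 1: "wedge (ext_deriv \<eta> x) (\<zeta> x) $ UNIV = \<dots>" .
  have "wedge (\<eta> x) (ext_deriv \<zeta> x) $ UNIV
      = (\<Sum>J\<in>UNIV. shuffle_sign (- J) J * \<eta> x $ (- J) * ext_deriv \<zeta> x $ J)"
    unfolding wedge_UNIV
    by (rule sum.reindex_bij_witness[where i = uminus and j = uminus]) auto
  also have "\<dots> = (\<Sum>J\<in>UNIV. \<Sum>i\<in>J. shuffle_sign (- insert i (J - {i})) (insert i (J - {i})) * shuffle_sign {i} (J - {i})
          * (\<eta> x $ (- insert i (J - {i})) * partial i \<zeta> x $ (J - {i})))"
    unfolding nth sum_distrib_left sum_distrib_right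
    by (rule sum.cong[OF refl], rule sum.cong[OF refl]) (simp add: insert_absorb)
  also have "\<dots> = (\<Sum>i\<in>UNIV. \<Sum>M | i \<notin> M. shuffle_sign (- insert i M) (insert i M) * shuffle_sign {i} M
          * (\<eta> x $ (- insert i M) * partial i \<zeta> x $ M))"
    by (rule sum_insert_swap)
  \<comment> \<open>For fixed i, complementation within the indices other than i is an involution;
    it makes \<eta> carry the same index set I as in the first expansion.\<close>
  also have "\<dots> = (\<Sum>i\<in>UNIV. \<Sum>I | i \<notin> I. shuffle_sign I (- I) * shuffle_sign {i} (- insert i I)
          * (\<eta> x $ I * partial i \<zeta> x $ (- insert i I)))"
  proof (rule sum.cong[OF refl], goal_cases)
    case (1 i)
    have *: "- insert i (- insert i I) = I" "insert i (- insert i I) = - I" if "i \<notin> I" for I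
      using that by auto
    show ?case
      by (rule sum.reindex_bij_witness[where i = "\<lambda>I. - insert i I" and j = "\<lambda>I. - insert i I"])
        (auto simp: *)
  qed
  finally have 2: "wedge (\<eta> x) (ext_deriv \<zeta> x) $ UNIV = \<dots>" .
  have "shuffle_sign (insert i I) (- insert i I) * shuffle_sign {i} I * (partial i \<eta> x $ I * \<zeta> x $ (- insert i I))
      - (-1) powi (j + 1) * (shuffle_sign I (- I) * shuffle_sign {i} (- insert i I)
          * (\<eta> x $ I * partial i \<zeta> x $ (- insert i I)))
      = shuffle_sign (insert i I) (- insert i I) * shuffle_sign {i} I
         * partial i (\<lambda>x. \<eta> x $ I * \<zeta> x $ (- insert i I)) x" (is "?l = ?r")
    if "i \<notin> I" for i I
  proof (cases "int (card I) = j")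
    case False
    then have "(\<lambda>x. \<eta> x $ I) = (\<lambda>x. 0)"
      using \<eta>(2) by (auto simp: has_degree_def)
    moreover from this have "\<eta> x $ I = 0" by metis
    moreover have "(\<lambda>x. \<eta> x $ I * \<zeta> x $ (- insert i I)) = (\<lambda>x. 0)"
      using fun_cong[OF \<open>(\<lambda>x. \<eta> x $ I) = (\<lambda>x. 0)\<close>] by simp
    ultimately show ?thesis
      by (simp add: partial_nth[OF \<eta>(1)])
  next
    case True
    let ?M = "- insert i I"
    obtain d\<eta> d\<zeta> where d: "(\<eta> has_derivative d\<eta>) (at x)" "(\<zeta> has_derivative d\<zeta>) (at x)"
      using \<eta>(1) \<zeta> by (auto simp: differentiable_def)
    have "((\<lambda>x. \<eta> x $ I * \<zeta> x $ ?M) has_derivative (\<lambda>h. \<eta> x $ I * d\<zeta> h $ ?M + d\<eta> h $ I * \<zeta> x $ ?M)) (at x)"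
      by (intro has_derivative_mult bounded_linear.has_derivative[OF bounded_linear_vec_nth] d)
    then have p: "partial i (\<lambda>x. \<eta> x $ I * \<zeta> x $ ?M) x
        = \<eta> x $ I * partial i \<zeta> x $ ?M + partial i \<eta> x $ I * \<zeta> x $ ?M"
      using d by (simp add: partial_eq)
    \<comment> \<open>These factorizations reduce the signs of both terms to one common product, up
      to the factor (-1)^\<open>card I\<close>, which is compensated by the sign in
      \<open>has_weak_d\<close>.\<close>
    have s1: "shuffle_sign I (- I) = shuffle_sign I {i} * shuffle_sign I ?M"
    proof -
      have "- I = insert i ?M" using that by auto
      then show ?thesis using shuffle_sign_insert_right[of i ?M I] by simp
    qed
    have s2: "shuffle_sign (insert i I) ?M = shuffle_sign {i} ?M * shuffle_sign I ?M"
      using that by (rule shuffle_sign_insert_left)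
    have s3: "shuffle_sign {i} I = (-1) ^ card I * shuffle_sign I {i}"
      using shuffle_sign_swap[of "{i}" I] that by (simp add: shuffle_sign_eq_iff mult.commute)
    have "(-1) powi (j + 1) = - ((-1 :: real) ^ card I)"
      using True by (simp add: power_int_add flip: True)
    then show ?thesis
      unfolding p s1 s2 s3 by (simp add: algebra_simps flip: power_add mult_2)
  qed
  then show ?thesis
    unfolding 1 2 sum_distrib_left by (simp add: sum_subtractf[symmetric])
qed

text \<open>Compact support of the test form removes all boundary terms: the difference of the two
  sides is a combination of integrals of partial derivatives of compactly supported
  functions.\<close>

lemma has_weak_d_smooth:
  fixes \<eta> :: "'n::{finite,linorder} dform"
  assumes \<eta>: "smooth \<eta>" "\<And>x. has_degree j (\<eta> x)" and S: "bounded S" "S \<in> sets lebesgue"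
  shows "has_weak_d S j \<eta> (ext_deriv \<eta>)"
  unfolding has_weak_d_def
proof (intro conjI ballI)
  note diff = smooth_differentiable[OF \<eta>(1)]
  obtain R where R: "S \<subseteq> cball 0 R"
    using S(1) by (auto simp: bounded_iff subset_eq)
  have "S \<in> lmeasurable"
    using S by (simp add: bounded_set_imp_lmeasurable)
  then interpret finite_measure "lebesgue_on S"
    by (rule finite_measure_lebesgue_on)
  have cont: "continuous_on UNIV (ext_deriv \<eta>)"
    by (rule continuous_on_ext_deriv[OF \<eta>(1)])
  have meas: "ext_deriv \<eta> \<in> borel_measurable (lebesgue_on S)"
    by (rule measurable_restrict_space1)
      (use borel_measurable_continuous_onI[OF cont] in \<open>simp add: measurable_completion\<close>)
  have "compact (ext_deriv \<eta> ` cball 0 R)"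
    by (intro compact_continuous_image continuous_on_subset[OF cont]) auto
  then obtain M where M: "\<And>x. x \<in> cball 0 R \<Longrightarrow> norm (ext_deriv \<eta> x) \<le> M"
    by (meson compact_imp_bounded bounded_iff imageI)
  have "integrable (lebesgue_on S) (\<lambda>x. (norm (ext_deriv \<eta> x))\<^sup>2)"
  proof (rule integrable_const_bound[where B = "M\<^sup>2"])
    show "AE x in lebesgue_on S. norm ((norm (ext_deriv \<eta> x))\<^sup>2) \<le> M\<^sup>2"
      using M R by (intro AE_I2) (auto simp: space_restrict_space intro!: power_mono)
  qed (use meas in measurable)
  then show "ext_deriv \<eta> \<in> L2_forms S (j + 1)"
    using meas has_degree_ext_deriv[OF diff \<eta>(2)] by (simp add: L2_forms_def)
next
  fix \<zeta> :: "'n dform" assume "\<zeta> \<in> test_forms S (int CARD('n) - j - 1)"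
  then obtain C where \<zeta>: "smooth \<zeta>" and C: "compact C" "C \<subseteq> interior S" "\<And>x. x \<notin> C \<Longrightarrow> \<zeta> x = 0"
    by (auto simp: test_forms_def)
  have CS: "C \<subseteq> S" using C interior_subset by blast
  note diff = smooth_differentiable[OF \<eta>(1)] smooth_differentiable[OF \<zeta>]
  have part_supp: "partial i \<zeta> x = 0" if "x \<notin> C" for i x
  proof -
    have "open (- C)" using compact_imp_closed[OF C(1)] by (rule open_Compl)
    then have "(\<zeta> has_derivative (\<lambda>h. 0)) (at x)"
      by (rule has_derivative_transform_within_open[OF has_derivative_const]) (use that C(3) in auto)
    then show ?thesis by (simp add: partial_eq)
  qed
  have cnth: "continuous_on UNIV (\<lambda>x. f x $ I)" if "continuous_on UNIV f" for f :: "'n dform" and I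
    using that by (intro continuous_intros)
  have cwedge: "continuous_on UNIV (\<lambda>x. wedge (f x) (g x) $ UNIV)"
    if "continuous_on UNIV f" "continuous_on UNIV g" for f g :: "'n dform"
    unfolding wedge_UNIV using that by (intro continuous_intros) 
  note cont = smooth_continuous_on[OF \<eta>(1)] smooth_continuous_on[OF \<zeta>]
    continuous_on_ext_deriv[OF \<eta>(1)] continuous_on_ext_deriv[OF \<zeta>]
  have l: "(LINT x|lebesgue_on S. wedge (ext_deriv \<eta> x) (\<zeta> x) $ UNIV)
      = (LINT x|lborel. wedge (ext_deriv \<eta> x) (\<zeta> x) $ UNIV)"
    "integrable lborel (\<lambda>x. wedge (ext_deriv \<eta> x) (\<zeta> x) $ UNIV)"
    using C(3) by (auto intro!: integral_lebesgue_on_compact_support[OF cwedge C(1) CS S(2)] cont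
        simp: linear_0[OF linear_wedge_right])
  have \<zeta>0: "ext_deriv \<zeta> x = 0" if "x \<notin> C" for x
    using part_supp[OF that] by (simp add: ext_deriv_def linear_0[OF linear_wedge_right])
  have r: "(LINT x|lebesgue_on S. wedge (\<eta> x) (ext_deriv \<zeta> x) $ UNIV)
      = (LINT x|lborel. wedge (\<eta> x) (ext_deriv \<zeta> x) $ UNIV)"
    "integrable lborel (\<lambda>x. wedge (\<eta> x) (ext_deriv \<zeta> x) $ UNIV)"
    using \<zeta>0 by (auto intro!: integral_lebesgue_on_compact_support[OF cwedge C(1) CS S(2)] cont
        simp: linear_0[OF linear_wedge_right])
  have prod: "(LINT x|lborel. partial i (\<lambda>x. \<eta> x $ I * \<zeta> x $ M) x) = 0"
      "integrable lborel (partial i (\<lambda>x. \<eta> x $ I * \<zeta> x $ M))" for i I M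
  proof -
    have "\<exists>D. ((\<lambda>x. \<eta> x $ I * \<zeta> x $ M) has_derivative D) (at x) \<and>
        D (axis i 1) = \<eta> x $ I * partial i \<zeta> x $ M + partial i \<eta> x $ I * \<zeta> x $ M" for x
    proof -
      obtain d\<eta> d\<zeta> where d: "(\<eta> has_derivative d\<eta>) (at x)" "(\<zeta> has_derivative d\<zeta>) (at x)"
        using diff by (metis differentiable_def)
      have "((\<lambda>x. \<eta> x $ I * \<zeta> x $ M) has_derivative (\<lambda>h. \<eta> x $ I * d\<zeta> h $ M + d\<eta> h $ I * \<zeta> x $ M)) (at x)"
        by (intro has_derivative_mult bounded_linear.has_derivative[OF bounded_linear_vec_nth] d)
      then show ?thesis
        using d by (intro exI conjI) (auto simp: partial_eq)
    qed
    then have d: "((\<lambda>x. \<eta> x $ I * \<zeta> x $ M) differentiable at x)"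
      and p: "partial i (\<lambda>x. \<eta> x $ I * \<zeta> x $ M) x
        = \<eta> x $ I * partial i \<zeta> x $ M + partial i \<eta> x $ I * \<zeta> x $ M" for x
      by (metis differentiable_def, metis partial_eq)
    have c: "continuous_on UNIV (partial i (\<lambda>x. \<eta> x $ I * \<zeta> x $ M))"
      unfolding p[abs_def] 
      by (intro continuous_intros cont smooth_continuous_on[OF smooth_partial] \<eta>(1) \<zeta>)
    show "(LINT x|lborel. partial i (\<lambda>x. \<eta> x $ I * \<zeta> x $ M) x) = 0"
      by (rule integral_partial_eq_0[OF d c C(1)]) (simp add: C(3))
    show "integrable lborel (partial i (\<lambda>x. \<eta> x $ I * \<zeta> x $ M))"
      by (rule integral_lebesgue_on_compact_support(2)[OF c C(1) CS S(2)]) (simp add: p C(3) part_supp)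
  qed
  have "(LINT x|lborel. wedge (ext_deriv \<eta> x) (\<zeta> x) $ UNIV)
      - (-1) powi (j + 1) * (LINT x|lborel. wedge (\<eta> x) (ext_deriv \<zeta> x) $ UNIV)
      = (LINT x|lborel. wedge (ext_deriv \<eta> x) (\<zeta> x) $ UNIV - (-1) powi (j + 1) * wedge (\<eta> x) (ext_deriv \<zeta> x) $ UNIV)"
    using l(2) r(2) by simp
  also have "\<dots> = 0"
  proof -
    have sum: "(LINT x|lborel. (\<Sum>i\<in>UNIV. \<Sum>I | i \<notin> I. c i I * p i I x))
        = (\<Sum>i\<in>UNIV. \<Sum>I | i \<notin> I. c i I * (LINT x|lborel. p i I x))"
      if "\<And>i I. integrable lborel (p i I)" for c :: "'n \<Rightarrow> 'n set \<Rightarrow> real" and p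
      using that by simp
    show ?thesis
      unfolding wedge_ext_deriv_expand[OF diff(1) \<eta>(2) diff(2)] sum[OF prod(2)] prod(1) by simp
  qed
  finally show "form_integral S (\<lambda>x. wedge (ext_deriv \<eta> x) (\<zeta> x))
      = (-1) powi (j + 1) * form_integral S (\<lambda>x. wedge (\<eta> x) (ext_deriv \<zeta> x))"
    by (simp add: form_integral_def l r)
qed


section \<open>The fundamental lemma of the calculus of variations\<close>

lemma AE_eq_0_if_box_integrals_eq_0:
  fixes f :: "'a::euclidean_space \<Rightarrow> real"
  assumes f: "integrable lebesgue f" and U: "open U"
    and box: "\<And>a b. cbox a b \<subseteq> U \<Longrightarrow> integral (cbox a b) f = 0"
  shows "AE x in lebesgue. x \<in> U \<longrightarrow> f x = 0"
proof -
  have "f absolutely_integrable_on UNIV"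
    using f by (simp add: set_integrable_def)
  then have "f integrable_on cbox a b" for a b
    by (meson absolutely_integrable_on_def integrable_on_subcbox subset_UNIV)
  \<comment> \<open>Lebesgue differentiation: off a null set, f x is the limit of the averages of f
    over cubes with lower corner x.\<close>
  then obtain N where N: "negligible N"
    "\<And>x e. x \<notin> N \<Longrightarrow> 0 < e \<Longrightarrow> \<exists>d>0. \<forall>h. 0 < h \<and> h < d \<longrightarrow>
        norm (integral (cbox x (x + h *\<^sub>R One)) f /\<^sub>R h ^ DIM('a) - f x) < e"
    by (rule integrable_ccontinuous_explicit) blast
  have "f x = 0" if x: "x \<in> U" "x \<notin> N" for x
  proof (rule ccontr)
    assume "f x \<noteq> 0"
    then obtain d where d: "0 < d" "\<And>h. 0 < h \<Longrightarrow> h < d \<Longrightarrow>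
        norm (integral (cbox x (x + h *\<^sub>R One)) f /\<^sub>R h ^ DIM('a) - f x) < \<bar>f x\<bar>"
      using N(2)[OF x(2), of "\<bar>f x\<bar>"] by auto
    obtain r where r: "0 < r" "ball x r \<subseteq> U"
      using U x(1) open_contains_ball by blast
    \<comment> \<open>The second bound keeps the cube with corner x and side h inside the ball of
      radius r, because the l1 distance of its points from x is at most \<open>DIM('a)\<close> times
      h.\<close>
    define h where "h = min (d / 2) (r / (2 * (real DIM('a) + 1)))"
    have h: "0 < h" "h < d" "h * (real DIM('a) + 1) \<le> r / 2"
    proof -
      have "h \<le> r / (2 * (real DIM('a) + 1))" by (simp add: h_def)
      then show "h * (real DIM('a) + 1) \<le> r / 2" by (simp add: field_simps)
    qed (use d(1) r(1) in \<open>auto simp: h_def\<close>)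
    have "cbox x (x + h *\<^sub>R One) \<subseteq> U"
    proof
      fix y assume y: "y \<in> cbox x (x + h *\<^sub>R One)"
      have "norm (y - x) \<le> (\<Sum>b\<in>Basis. \<bar>(y - x) \<bullet> b\<bar>)"
        by (rule norm_le_l1)
      also have "\<dots> \<le> (\<Sum>b\<in>(Basis :: 'a set). h)"
        using y by (intro sum_mono) (auto simp: mem_box inner_simps)
      also have "\<dots> < r"
        using h r(1) by (simp add: algebra_simps)
      finally show "y \<in> U"
        using r(2) by (auto simp: dist_norm norm_minus_commute)
    qed
    then show False
      using d(2)[OF h(1,2)] box by simp
  qed
  then have "AE x in lebesgue. x \<notin> N \<longrightarrow> (x \<in> U \<longrightarrow> f x = 0)"
    by (intro AE_I2) blast
  moreover have "AE x in lebesgue. x \<notin> N"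
    using N(1) by (intro AE_not_in) (simp add: negligible_iff_null_sets)
  ultimately show ?thesis by (auto elim: eventually_elim2)
qed

text \<open>Smooth functions below the indicator of an open box that converge to it pointwise:
  exp(-1/((m+1)t)) tends to 1 for every t > 0.\<close>

definition box_bump :: "nat \<Rightarrow> 'n::finite pt \<Rightarrow> 'n pt \<Rightarrow> 'n pt \<Rightarrow> real" where
  "box_bump m a b x = (\<Prod>i\<in>UNIV. exp_germ 1 (real (Suc m) * (x $ i - a $ i))
     * exp_germ 1 (real (Suc m) * (b $ i - x $ i)))"

lemma smooth_box_bump: "smooth (\<lambda>x. box_bump m a b x *\<^sub>R c)"
proof -
  have "times_differentiable n (\<lambda>t. exp_germ 1 (real (Suc m) * (t - a $ i)) * exp_germ 1 (real (Suc m) * (b $ i - t)))" for n i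
  proof -
    have "times_differentiable n (\<lambda>t. exp_germ 1 (real (Suc m) * t + - real (Suc m) * a $ i)
        * exp_germ 1 (- real (Suc m) * t + real (Suc m) * b $ i))"
      by (intro times_differentiable_mult times_differentiable_affine times_differentiable_exp_germ)
    then show ?thesis by (simp add: algebra_simps)
  qed
  from smooth_prod[of "\<lambda>i t. exp_germ 1 (real (Suc m) * (t - a $ i)) * exp_germ 1 (real (Suc m) * (b $ i - t))", OF this]
  show ?thesis by (simp only: box_bump_def)
qed

lemma exp_germ_1_bounds: "0 \<le> exp_germ 1 t" "exp_germ 1 t \<le> 1"
  by (auto simp: exp_germ_def)

lemma box_bump_bounds: "0 \<le> box_bump m a b x" "box_bump m a b x \<le> 1"
  unfolding box_bump_def
  by (auto intro!: prod_nonneg prod_le_1 mult_le_one mult_nonneg_nonneg exp_germ_1_bounds)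

lemma box_bump_eq_0: 
  assumes "x \<notin> box a b"
  shows "box_bump m a b x = 0"
proof -
  obtain i where "x $ i \<le> a $ i \<or> b $ i \<le> x $ i"
    using assms by (auto simp: mem_box_cart not_less)
  then have "exp_germ 1 (real (Suc m) * (x $ i - a $ i)) * exp_germ 1 (real (Suc m) * (b $ i - x $ i)) = 0"
    by (auto simp: exp_germ_def zero_less_mult_iff)
  then show ?thesis
    unfolding box_bump_def by (intro prod_zero) auto
qed

lemma box_bump_tendsto: "(\<lambda>m. box_bump m a b x) \<longlonglongrightarrow> indicator (box a b) x"
proof (cases "x \<in> box a b")
  case True
  have germ: "(\<lambda>m. exp_germ 1 (real (Suc m) * t)) \<longlonglongrightarrow> 1" if "0 < t" for t
  proof -
    have "(\<lambda>m. exp (- (1 / (real (Suc m) * t)))) \<longlonglongrightarrow> 1"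
      using that by real_asymp
    then show ?thesis
      using that by (simp add: exp_germ_def)
  qed
  have "(\<lambda>m. box_bump m a b x) \<longlonglongrightarrow> (\<Prod>i\<in>(UNIV :: 'a set). 1 * 1)"
    unfolding box_bump_def
    by (intro tendsto_prod tendsto_mult germ) (use True in \<open>auto simp: mem_box_cart\<close>)
  with True show ?thesis by simp
qed (simp add: box_bump_eq_0)

lemma L2_forms_integrable_nth:
  assumes "v \<in> L2_forms S j" "S \<in> lmeasurable"
  shows "integrable (lebesgue_on S) (\<lambda>x. v x $ I)"
proof -
  interpret finite_measure "lebesgue_on S"
    using assms(2) by (rule finite_measure_lebesgue_on)
  have meas: "(\<lambda>x. v x $ I) \<in> borel_measurable (lebesgue_on S)"
    using assms(1)
    by (intro measurable_compose[of v _ borel "\<lambda>y. y $ I"] borel_measurable_continuous_onI)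
      (auto simp: L2_forms_def intro!: continuous_intros)
  show ?thesis
  proof (rule Bochner_Integration.integrable_bound)
    show "integrable (lebesgue_on S) (\<lambda>x. 1 + (norm (v x))\<^sup>2)"
      using assms(1) by (simp add: L2_forms_def)
    have "\<bar>v x $ I\<bar> \<le> 1 + (norm (v x))\<^sup>2" for x
    proof -
      have "\<bar>v x $ I\<bar> \<le> norm (v x)" by (rule component_le_norm_cart)
      moreover have "0 \<le> (norm (v x) - 1)\<^sup>2" by simp
      ultimately show ?thesis by (simp add: power2_eq_square algebra_simps)
    qed
    then show "AE x in lebesgue_on S. norm (v x $ I) \<le> norm (1 + (norm (v x))\<^sup>2)"
      by simp
  qed (rule meas)
qed

text \<open>Bumps times a constant basis form isolate one coefficient of the difference; in the
  limit its integrals over all boxes in the interior vanish. Coefficients of the wrong degree are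
  zero by the definition of \<open>L2_forms\<close>.\<close>

lemma weak_d_unique:
  fixes v :: "'n::{finite,linorder} dform"
  assumes w: "has_weak_d S j v w" "has_weak_d S j v w'" and S: "bounded S" "S \<in> sets lebesgue"
  shows "AE x in lebesgue. x \<in> interior S \<longrightarrow> w x = w' x"
proof -
  have SL: "S \<in> lmeasurable"
    using S by (simp add: bounded_set_imp_lmeasurable)
  have L2: "w \<in> L2_forms S (j + 1)" "w' \<in> L2_forms S (j + 1)"
    using w by (auto simp: has_weak_d_def)
  have comp: "AE x in lebesgue. x \<in> interior S \<longrightarrow> w x $ I - w' x $ I = 0" for I
  proof (cases "int (card I) = j + 1")
    case False
    have "w x $ I - w' x $ I = 0" if "x \<in> S" for x
      using that L2 False by (auto simp: L2_forms_def has_degree_def) (metis diff_self)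
    then show ?thesis
      using interior_subset by (intro AE_I2) blast
  next
    case True
    define f where "f x = w x $ I - w' x $ I" for x
    have f: "integrable (lebesgue_on S) f"
      unfolding f_def using L2 SL by (intro Bochner_Integration.integrable_diff L2_forms_integrable_nth)
    have zero: "(LINT x|lebesgue_on S. f x * box_bump m a b x) = 0" if "cbox a b \<subseteq> interior S" for m a b
    proof -
      \<comment> \<open>In a wedge product with the basis form of the complement of I, only
        coefficient I reaches the top degree.\<close>
      define \<eta> where "\<eta> x = box_bump m a b x *\<^sub>R axis (- I) (1::real)" for x
      have "smooth \<eta>"
        unfolding \<eta>_def by (rule smooth_box_bump)
      moreover have "int (card (- I)) = int CARD('n) - j - 1"
        using True card_mono[of UNIV I] by (simp add: Compl_eq_Diff_UNIV card_Diff_subset)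
      then have "has_degree (int CARD('n) - j - 1) (\<eta> x)" for x
        unfolding \<eta>_def by (intro has_degree_scaleR) (simp add: has_degree_axis)
      moreover have "\<eta> x = 0" if "x \<notin> cbox a b" for x
      proof -
        have "x \<notin> box a b" using that box_subset_cbox by blast
        then show ?thesis by (simp add: \<eta>_def box_bump_eq_0)
      qed
      ultimately have \<eta>: "\<eta> \<in> test_forms S (int CARD('n) - j - 1)"
        unfolding test_forms_def mem_Collect_eq using that compact_cbox[of a b] by metis
      have wedge: "wedge \<alpha> (\<eta> x) $ UNIV = shuffle_sign I (- I) * (\<alpha> $ I * box_bump m a b x)" for \<alpha> x
      proof -
        have "wedge \<alpha> (\<eta> x) $ UNIV = (\<Sum>M\<in>UNIV. if M = I then shuffle_sign I (- I) * (\<alpha> $ I * box_bump m a b x) else 0)"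
          unfolding wedge_UNIV by (rule sum.cong) (auto simp: \<eta>_def axis_def)
        then show ?thesis by simp
      qed
      have "form_integral S (\<lambda>x. wedge (w x) (\<eta> x)) = form_integral S (\<lambda>x. wedge (w' x) (\<eta> x))"
        using w \<eta> by (simp add: has_weak_d_def)
      then have eq: "(LINT x|lebesgue_on S. w x $ I * box_bump m a b x) = (LINT x|lebesgue_on S. w' x $ I * box_bump m a b x)"
        by (simp add: form_integral_def wedge)
      have "continuous_on UNIV (\<lambda>x. box_bump m a b x *\<^sub>R (1 :: real))"
        by (rule smooth_continuous_on[OF smooth_box_bump])
      then have "box_bump m a b \<in> borel_measurable borel"
        by (intro borel_measurable_continuous_onI) simp
      then have meas: "box_bump m a b \<in> borel_measurable (lebesgue_on S)"
        by (intro measurable_restrict_space1 measurable_completion) simp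
      have int: "integrable (lebesgue_on S) (\<lambda>x. g x $ I * box_bump m a b x)" if "g \<in> L2_forms S (j + 1)" for g
      proof (rule Bochner_Integration.integrable_bound[OF L2_forms_integrable_nth[OF that SL, of I]])
        show "(\<lambda>x. g x $ I * box_bump m a b x) \<in> borel_measurable (lebesgue_on S)"
          using meas borel_measurable_integrable[OF L2_forms_integrable_nth[OF that SL, of I]] by measurable
        show "AE x in lebesgue_on S. norm (g x $ I * box_bump m a b x) \<le> norm (g x $ I)"
          using box_bump_bounds[of m a b] by (intro AE_I2) (auto simp: abs_mult intro!: mult_left_le)
      qed
      show ?thesis
        using eq int[OF L2(1)] int[OF L2(2)] by (simp add: f_def left_diff_distrib)
    qed
    have box: "(LINT x|lebesgue_on S. f x * indicator (box a b) x) = 0" if "cbox a b \<subseteq> interior S" for a b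
    proof -
      have "(\<lambda>m. LINT x|lebesgue_on S. f x * box_bump m a b x) \<longlonglongrightarrow> (LINT x|lebesgue_on S. f x * indicator (box a b) x)"
      proof (rule integral_dominated_convergence[where w = "\<lambda>x. \<bar>f x\<bar>"])
        have fm: "f \<in> borel_measurable (lebesgue_on S)"
          using f by simp
        show "(\<lambda>x. f x * indicator (box a b) x) \<in> borel_measurable (lebesgue_on S)"
          by (intro borel_measurable_times fm measurable_restrict_space1 borel_measurable_indicator) simp
        fix m
        have "continuous_on UNIV (\<lambda>x. box_bump m a b x *\<^sub>R (1 :: real))"
          by (rule smooth_continuous_on[OF smooth_box_bump])
        then have "box_bump m a b \<in> borel_measurable borel"
          by (intro borel_measurable_continuous_onI) simp
        then have "box_bump m a b \<in> borel_measurable (lebesgue_on S)"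
          by (intro measurable_restrict_space1 measurable_completion) simp
        with fm show "(\<lambda>x. f x * box_bump m a b x) \<in> borel_measurable (lebesgue_on S)"
          by measurable
        show "AE x in lebesgue_on S. norm (f x * box_bump m a b x) \<le> \<bar>f x\<bar>"
          using box_bump_bounds[of m a b] by (intro AE_I2) (auto simp: abs_mult intro!: mult_left_le)
      qed (use f in \<open>auto intro!: tendsto_mult box_bump_tendsto\<close>)
      then show ?thesis
        using zero[OF that] by (simp add: LIMSEQ_const_iff)
    qed
    \<comment> \<open>Extension by zero, because the averages over cubes are formed on the whole
      space.\<close>
    define g where "g x = indicator S x *\<^sub>R f x" for x
    have g: "integrable lebesgue g"
      using f S(2) by (simp add: g_def[abs_def] integrable_restrict_space)
    have "AE x in lebesgue. x \<in> interior S \<longrightarrow> g x = 0"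
    proof (rule AE_eq_0_if_box_integrals_eq_0[OF g])
      fix a b assume ab: "cbox a b \<subseteq> interior S"
      have gi: "set_integrable lebesgue (box a b) g"
        using integrable_mult_indicator[OF _ g, of "box a b"] by (simp add: set_integrable_def)
      have "integral (cbox a b) g = integral (box a b) g"
        by (metis integral_open_interval)
      also have "\<dots> = (LINT x:box a b|lebesgue. g x)"
        using set_lebesgue_integral_eq_integral(2)[OF gi] by simp
      also have "\<dots> = (LINT x|lebesgue. indicator S x *\<^sub>R (f x * indicator (box a b) x))"
        by (simp add: set_lebesgue_integral_def g_def mult_ac)
      also have "\<dots> = (LINT x|lebesgue_on S. f x * indicator (box a b) x)"
        using S(2) by (simp add: integral_restrict_space)
      finally show "integral (cbox a b) g = 0"
        using box[OF ab] by simp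
    qed simp
    then show ?thesis
      by eventually_elim (use interior_subset in \<open>auto simp: g_def f_def indicator_def split: if_splits\<close>)
  qed
  have "AE x in lebesgue. \<forall>I\<in>UNIV. x \<in> interior S \<longrightarrow> w x $ I - w' x $ I = 0"
    using comp by (subst AE_finite_all) auto
  then show ?thesis
    by eventually_elim (simp add: vec_eq_iff)
qed

text \<open>\<open>weak_d\<close> is a choice among weak derivatives, and these are determined only
  in the interior; a negligible remainder extends the identification to all of S.\<close>

lemma weak_d_AE_eq:
  assumes "has_weak_d S j v w" "bounded S" "S \<in> sets lebesgue" "negligible (S - interior S)"
  shows "AE x in lebesgue_on S. weak_d S j v x = w x"
proof -
  have "has_weak_d S j v (weak_d S j v)"
    using someI[of "has_weak_d S j v" w] assms(1) by (simp add: weak_d_def)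
  then have "AE x in lebesgue. x \<in> interior S \<longrightarrow> weak_d S j v x = w x"
    using assms by (intro weak_d_unique)
  moreover have "AE x in lebesgue. x \<notin> S - interior S"
    using assms(4) by (intro AE_not_in) (simp add: negligible_iff_null_sets)
  ultimately have "AE x in lebesgue. x \<in> S \<longrightarrow> weak_d S j v x = w x"
    by eventually_elim auto
  then show ?thesis
    using assms(3) by (simp add: AE_restrict_space_iff)
qed


section \<open>Semi-inner products on finite-dimensional spaces\<close>

instantiation "fun" :: (type, real_vector) real_vector
begin

definition scaleR_fun_def: "c *\<^sub>R f = (\<lambda>x. c *\<^sub>R f x)"

instance
  by standard (auto simp: scaleR_fun_def fun_eq_iff algebra_simps)

end

lemma scaleR_fun_apply [simp]: "(c *\<^sub>R f) x = c *\<^sub>R f x"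
  by (simp add: scaleR_fun_def)

lemma sum_fun_apply: "(\<Sum>a\<in>A. f a) x = (\<Sum>a\<in>A. f a x)"
  by (induction A rule: infinite_finite_induct) auto

text \<open>Definiteness is left out since the boundary product vanishes on polynomial forms without
  tangential trace. The laws are restricted to W because the integrals behind the instances are
  additive only on integrable functions.\<close>

locale semi_inner =
  fixes W :: "'a::real_vector set" and s :: "'a \<Rightarrow> 'a \<Rightarrow> real"
  assumes subspace: "subspace W"
    and add_left: "\<lbrakk>x \<in> W; y \<in> W; z \<in> W\<rbrakk> \<Longrightarrow> s (x + y) z = s x z + s y z"
    and scale_left: "\<lbrakk>x \<in> W; z \<in> W\<rbrakk> \<Longrightarrow> s (c *\<^sub>R x) z = c * s x z"
    and commute: "\<lbrakk>x \<in> W; y \<in> W\<rbrakk> \<Longrightarrow> s x y = s y x"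
    and nonneg: "x \<in> W \<Longrightarrow> 0 \<le> s x x"
begin

lemmas mem [intro] = subspace_add[OF subspace] subspace_scale[OF subspace] subspace_sum[OF subspace]
  subspace_diff[OF subspace] subspace_0[OF subspace]

lemma zero_left: "z \<in> W \<Longrightarrow> s 0 z = 0"
  using scale_left[of 0 z 0] mem by auto

lemma diff_left: "\<lbrakk>x \<in> W; y \<in> W; z \<in> W\<rbrakk> \<Longrightarrow> s (x - y) z = s x z - s y z"
  using add_left[of x "(-1) *\<^sub>R y" z] scale_left[of y z "-1"] mem(2)[of y "-1"] by simp

lemma sum_left:
  "\<lbrakk>\<And>e. e \<in> E \<Longrightarrow> f e \<in> W; z \<in> W\<rbrakk> \<Longrightarrow> s (\<Sum>e\<in>E. c e *\<^sub>R f e) z = (\<Sum>e\<in>E. c e * s (f e) z)"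
proof (induction E rule: infinite_finite_induct)
  case (insert x F)
  then have "(\<Sum>e\<in>F. c e *\<^sub>R f e) \<in> W" "c x *\<^sub>R f x \<in> W"
    by (auto intro!: mem)
  with insert show ?case by (simp add: add_left scale_left)
qed (auto simp: zero_left)

text \<open>Otherwise the square of x + c y would be a nonconstant affine function of c and hence
  take negative values; the chosen c makes it -1. This is the case of the Cauchy-Schwarz inequality
  in which one cannot divide by \<open>s y y\<close>.\<close>

lemma null_right:
  assumes "x \<in> W" "y \<in> W" "s y y = 0"
  shows "s x y = 0"
proof (rule ccontr)
  assume ne: "s x y \<noteq> 0"
  define c where "c = - (s x x + 1) / (2 * s x y)"
  have yx: "s y x = s x y"
    using assms by (intro commute)
  have m: "c *\<^sub>R y \<in> W" "x + c *\<^sub>R y \<in> W"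
    using assms by (auto intro!: mem)
  have "s (x + c *\<^sub>R y) (x + c *\<^sub>R y) = s x (x + c *\<^sub>R y) + c * s y (x + c *\<^sub>R y)"
    using assms m by (simp add: add_left scale_left)
  also have "s x (x + c *\<^sub>R y) = s x x + c * s x y"
    using assms m by (subst commute) (simp_all add: add_left scale_left yx)
  also have "s y (x + c *\<^sub>R y) = s x y"
    using assms m by (subst commute) (simp_all add: add_left scale_left)
  finally have "s (x + c *\<^sub>R y) (x + c *\<^sub>R y) = -1"
    using ne by (simp add: c_def field_simps)
  with nonneg[OF m(2)] show False by simp
qed

definition orthonormal :: "'a set \<Rightarrow> bool" where
  "orthonormal E \<longleftrightarrow> finite E \<and> E \<subseteq> W \<and> (\<forall>e\<in>E. \<forall>e'\<in>E. s e e' = (if e = e' then 1 else 0))"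

lemma orthonormal_independent:
  assumes "orthonormal E"
  shows "independent E"
proof -
  have E: "finite E" "E \<subseteq> W" "\<And>e e'. e \<in> E \<Longrightarrow> e' \<in> E \<Longrightarrow> s e e' = (if e = e' then 1 else 0)"
    using assms by (auto simp: orthonormal_def)
  have "u v = 0" if "(\<Sum>v\<in>E. u v *\<^sub>R v) = 0" "v \<in> E" for u v
  proof -
    have "0 = s (\<Sum>v\<in>E. u v *\<^sub>R v) v"
      using that E by (auto simp: zero_left)
    also have "\<dots> = (\<Sum>e\<in>E. u e * s e v)"
      using that E by (intro sum_left) auto
    also have "\<dots> = (\<Sum>e\<in>E. if e = v then u v else 0)"
      using that E by (intro sum.cong) auto
    finally show ?thesis using that E by simp
  qed
  then show ?thesis
    using E by (auto simp: dependent_finite)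
qed

text \<open>An orthonormal family of maximal cardinality: the remainder of an element with nonzero seminorm
  could be normalized and adjoined.\<close>

lemma orthonormal_complete:
  assumes "W \<subseteq> span B" "finite B"
  obtains E where "orthonormal E"
    "\<And>w. w \<in> W \<Longrightarrow> s (w - (\<Sum>e\<in>E. s w e *\<^sub>R e)) (w - (\<Sum>e\<in>E. s w e *\<^sub>R e)) = 0"
proof -
  have bound: "card E \<le> card B" if "orthonormal E" for E
    using independent_span_bound[OF assms(2) orthonormal_independent[OF that]] that assms(1)
    by (auto simp: orthonormal_def)
  have "orthonormal {}" by (simp add: orthonormal_def)
  then obtain E where E: "orthonormal E" and max: "\<And>E'. orthonormal E' \<Longrightarrow> card E' \<le> card E"
    using ex_has_greatest_nat[of orthonormal "{}" card "Suc (card B)"] bound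
    by (metis le_imp_less_Suc)
  have EW: "finite E" "E \<subseteq> W" "\<And>e e'. e \<in> E \<Longrightarrow> e' \<in> E \<Longrightarrow> s e e' = (if e = e' then 1 else 0)"
    using E by (auto simp: orthonormal_def)
  show ?thesis
  proof (rule that[OF E], rule ccontr)
    fix w assume w: "w \<in> W"
    define r where "r = w - (\<Sum>e\<in>E. s w e *\<^sub>R e)"
    assume "s (w - (\<Sum>e\<in>E. s w e *\<^sub>R e)) (w - (\<Sum>e\<in>E. s w e *\<^sub>R e)) \<noteq> 0"
    then have rr: "s r r \<noteq> 0" by (simp add: r_def)
    have S: "(\<Sum>e\<in>E. s w e *\<^sub>R e) \<in> W"
      using EW by (intro mem) auto
    have r: "r \<in> W" unfolding r_def by (rule mem(4)[OF w S])
    with rr nonneg have pos: "0 < s r r" by (simp add: less_le)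
    have re: "s r e = 0" if "e \<in> E" for e
    proof -
      have eW: "e \<in> W" using that EW by auto
      have "s (\<Sum>e\<in>E. s w e *\<^sub>R e) e = (\<Sum>e'\<in>E. s w e' * s e' e)"
        using EW eW by (intro sum_left) auto
      also have "\<dots> = (\<Sum>e'\<in>E. if e' = e then s w e else 0)"
        using EW that by (intro sum.cong) auto
      also have "\<dots> = s w e" using EW that by simp
      finally show ?thesis
        unfolding r_def using w S eW by (simp add: diff_left)
    qed
    define g where "g = (1 / sqrt (s r r)) *\<^sub>R r"
    have g: "g \<in> W" unfolding g_def by (rule mem(2)[OF r])
    have ge: "s g e = 0" "s e g = 0" if "e \<in> E" for e
    proof -
      have eW: "e \<in> W" using that EW by auto
      show "s g e = 0" unfolding g_def using r eW re[OF that] by (simp add: scale_left)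
      then show "s e g = 0" using commute[OF g eW] by simp
    qed
    have "s g g = 1"
    proof -
      have "s g g = (1 / sqrt (s r r)) * s r g"
        using scale_left[OF r g, of "1 / sqrt (s r r)"] by (simp flip: g_def)
      also have "s r g = (1 / sqrt (s r r)) * s r r"
        using scale_left[OF r r, of "1 / sqrt (s r r)"] by (simp add: commute[OF r g] flip: g_def)
      finally show ?thesis using pos by (simp add: field_simps flip: real_sqrt_mult)
    qed
    moreover have "g \<notin> E"
      using ge \<open>s g g = 1\<close> by force
    ultimately have "orthonormal (insert g E)"
      using EW g ge by (auto simp: orthonormal_def)
    from max[OF this] \<open>g \<notin> E\<close> EW(1) show False by simp
  qed
qed

lemma Cauchy_Schwarz:
  assumes "x \<in> W" "y \<in> W"
  shows "\<bar>s x y\<bar> \<le> sqrt (s x x) * sqrt (s y y)"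
proof (cases "s y y = 0")
  case True
  with null_right[OF assms] show ?thesis by simp
next
  case False
  then have pos: "0 < s y y" using nonneg[OF assms(2)] by simp
  define c where "c = s x y / s y y"
  have m: "c *\<^sub>R y \<in> W" "x - c *\<^sub>R y \<in> W"
    using assms by (auto intro!: mem)
  have yx: "s y x = s x y"
    using assms by (intro commute)
  have "s (x - c *\<^sub>R y) (x - c *\<^sub>R y) = s x (x - c *\<^sub>R y) - c * s y (x - c *\<^sub>R y)"
    using assms m by (simp add: diff_left scale_left)
  also have "s x (x - c *\<^sub>R y) = s x x - c * s x y"
    using assms m by (subst commute) (simp_all add: diff_left scale_left yx)
  also have "s y (x - c *\<^sub>R y) = s x y - c * s y y"
    using assms m by (subst commute) (simp_all add: diff_left scale_left)
  finally have "s (x - c *\<^sub>R y) (x - c *\<^sub>R y) = s x x - (s x y)\<^sup>2 / s y y"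
    using pos by (simp add: c_def field_simps power2_eq_square)
  with nonneg[OF m(2)] pos have "(s x y)\<^sup>2 \<le> s x x * s y y"
    by (simp add: field_simps)
  from real_sqrt_le_mono[OF this] show ?thesis
    by (simp add: real_sqrt_mult)
qed

text \<open>Expanding w in an orthonormal system discards its component in the kernel of s, and the
  coefficients that remain are at most \<open>sqrt (s w w)\<close>. For w itself a bound of N by the
  seminorm would fail in general, which is why w' is introduced.\<close>

lemma bounded_representative:
  assumes "W \<subseteq> span B" "finite B"
    and N_add: "\<And>x y. \<lbrakk>x \<in> W; y \<in> W\<rbrakk> \<Longrightarrow> N (x + y) \<le> N x + N y"
    and N_scale: "\<And>x c. x \<in> W \<Longrightarrow> N (c *\<^sub>R x) = \<bar>c\<bar> * N x"
  obtains C :: real where "0 \<le> C"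
    "\<And>w. w \<in> W \<Longrightarrow> \<exists>w'\<in>W. s (w - w') (w - w') = 0 \<and> N w' \<le> C * sqrt (s w w)"
proof -
  obtain E where E: "orthonormal E"
    "\<And>w. w \<in> W \<Longrightarrow> s (w - (\<Sum>e\<in>E. s w e *\<^sub>R e)) (w - (\<Sum>e\<in>E. s w e *\<^sub>R e)) = 0"
    using orthonormal_complete[OF assms(1,2)] by metis
  have EW: "finite E" "E \<subseteq> W" "\<And>e. e \<in> E \<Longrightarrow> s e e = 1"
    using E(1) by (auto simp: orthonormal_def)
  have N0: "N 0 = 0" using N_scale[of 0 0] mem by auto
  have N_nonneg: "0 \<le> N x" if "x \<in> W" for x
    using N_add[OF that mem(2)[OF that, of "-1"]] N_scale[OF that, of "-1"] by (simp add: N0)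
  have N_sum: "N (\<Sum>e\<in>F. c e *\<^sub>R e) \<le> (\<Sum>e\<in>F. \<bar>c e\<bar> * N e)" if "finite F" "F \<subseteq> W" for F c
    using that
  proof (induction F rule: finite_induct)
    case (insert x F)
    have "N (c x *\<^sub>R x + (\<Sum>e\<in>F. c e *\<^sub>R e)) \<le> N (c x *\<^sub>R x) + N (\<Sum>e\<in>F. c e *\<^sub>R e)"
      using insert.prems by (intro N_add mem) auto
    with insert show ?case by (simp add: N_scale)
  qed (simp add: N0)
  show ?thesis
  proof (rule that[of "\<Sum>e\<in>E. N e"])
    show "0 \<le> (\<Sum>e\<in>E. N e)"
      using EW N_nonneg by (intro sum_nonneg) auto
    fix w assume w: "w \<in> W"
    show "\<exists>w'\<in>W. s (w - w') (w - w') = 0 \<and> N w' \<le> (\<Sum>e\<in>E. N e) * sqrt (s w w)"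
    proof (intro bexI conjI)
      have "N (\<Sum>e\<in>E. s w e *\<^sub>R e) \<le> (\<Sum>e\<in>E. \<bar>s w e\<bar> * N e)"
        using EW by (intro N_sum)
      also have "\<dots> \<le> (\<Sum>e\<in>E. sqrt (s w w) * N e)"
      proof (intro sum_mono mult_right_mono)
        fix e assume "e \<in> E"
        then show "\<bar>s w e\<bar> \<le> sqrt (s w w)" "0 \<le> N e"
          using Cauchy_Schwarz[OF w, of e] EW N_nonneg by auto
      qed
      finally show "N (\<Sum>e\<in>E. s w e *\<^sub>R e) \<le> (\<Sum>e\<in>E. N e) * sqrt (s w w)"
        by (simp add: sum_distrib_right mult.commute)
      show "(\<Sum>e\<in>E. s w e *\<^sub>R e) \<in> W"
        using EW by (intro mem) auto
    qed (rule E(2)[OF w])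
  qed
qed

text \<open>Riesz representation in a possibly degenerate space: l must vanish on the kernel of s,
  and its values on an orthonormal system are the coefficients of the representing element.\<close>

lemma representation:
  assumes "W \<subseteq> span B" "finite B"
    and l_add: "\<And>x y. \<lbrakk>x \<in> W; y \<in> W\<rbrakk> \<Longrightarrow> l (x + y) = l x + l y"
    and l_scale: "\<And>x c. x \<in> W \<Longrightarrow> l (c *\<^sub>R x) = c * l x"
    and l_null: "\<And>x. x \<in> W \<Longrightarrow> s x x = 0 \<Longrightarrow> l x = 0"
  obtains w where "w \<in> W" "\<And>z. z \<in> W \<Longrightarrow> s w z = l z"
proof -
  obtain E where E: "orthonormal E"
    "\<And>w. w \<in> W \<Longrightarrow> s (w - (\<Sum>e\<in>E. s w e *\<^sub>R e)) (w - (\<Sum>e\<in>E. s w e *\<^sub>R e)) = 0"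
    using orthonormal_complete[OF assms(1,2)] by metis
  have EW: "finite E" "E \<subseteq> W"
    using E(1) by (auto simp: orthonormal_def)
  have l_sum: "l (\<Sum>e\<in>F. c e *\<^sub>R e) = (\<Sum>e\<in>F. c e * l e)" if "finite F" "F \<subseteq> W" for F c
    using that
  proof (induction F rule: finite_induct)
    case empty
    show ?case using l_scale[of 0 0] mem by auto
  next
    case (insert x F)
    have "l (c x *\<^sub>R x + (\<Sum>e\<in>F. c e *\<^sub>R e)) = l (c x *\<^sub>R x) + l (\<Sum>e\<in>F. c e *\<^sub>R e)"
      using insert.prems by (intro l_add mem) auto
    with insert show ?case by (simp add: l_scale)
  qed
  show ?thesis
  proof (rule that[of "\<Sum>e\<in>E. l e *\<^sub>R e"])
    show "(\<Sum>e\<in>E. l e *\<^sub>R e) \<in> W"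
      using EW by (intro mem) auto
    fix z assume z: "z \<in> W"
    have S: "(\<Sum>e\<in>E. s z e *\<^sub>R e) \<in> W"
      using EW by (intro mem) auto
    have "l (z - (\<Sum>e\<in>E. s z e *\<^sub>R e)) = 0"
      by (rule l_null[OF mem(4)[OF z S] E(2)[OF z]])
    moreover have "l z = l (z - (\<Sum>e\<in>E. s z e *\<^sub>R e)) + l (\<Sum>e\<in>E. s z e *\<^sub>R e)"
      using S z by (subst l_add[symmetric]) (auto intro: mem)
    ultimately have "l z = (\<Sum>e\<in>E. s z e * l e)"
      using l_sum[OF EW] by simp
    also have "\<dots> = (\<Sum>e\<in>E. l e * s e z)"
      using EW z by (intro sum.cong refl) (auto simp: commute)
    also have "\<dots> = s (\<Sum>e\<in>E. l e *\<^sub>R e) z"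
      using EW z by (intro sum_left[symmetric]) auto
    finally show "s (\<Sum>e\<in>E. l e *\<^sub>R e) z = l z" by simp
  qed
qed

end


section \<open>Spaces of polynomial forms\<close>

definition monomial_form :: "('n::finite \<Rightarrow> nat) \<Rightarrow> 'n form \<Rightarrow> 'n dform" where
  "monomial_form a c x = (\<Prod>i\<in>UNIV. (x $ i) ^ a i) *\<^sub>R c"

lemma finite_multi_indices: "finite {a :: 'n::finite \<Rightarrow> nat. (\<Sum>i\<in>UNIV. a i) \<le> r}"
proof (rule finite_subset)
  have "a i \<le> r" if "(\<Sum>i\<in>UNIV. a i) \<le> r" for a :: "'n \<Rightarrow> nat" and i
    using member_le_sum[of i UNIV a] that by simp
  then show "{a :: 'n \<Rightarrow> nat. (\<Sum>i\<in>UNIV. a i) \<le> r} \<subseteq> {a. \<forall>i. (i \<in> UNIV \<longrightarrow> a i \<in> {..r}) \<and> (i \<notin> UNIV \<longrightarrow> a i = 0)}"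
    by auto
  show "finite {a :: 'n \<Rightarrow> nat. \<forall>i. (i \<in> UNIV \<longrightarrow> a i \<in> {..r}) \<and> (i \<notin> UNIV \<longrightarrow> a i = 0)}"
    by (rule finite_set_of_finite_funs) auto
qed

lemma full_poly_forms_iff:
  "\<omega> \<in> full_poly_forms r j \<longleftrightarrow>
    (\<exists>c. (\<forall>a. has_degree j (c a)) \<and> \<omega> = (\<Sum>a | (\<Sum>i\<in>UNIV. a i) \<le> r. monomial_form a (c a)))"
  by (simp add: full_poly_forms_def monomial_form_def fun_eq_iff sum_fun_apply)

lemma monomial_form_linear:
  "monomial_form a (c + d) = monomial_form a c + monomial_form a d"
  "monomial_form a (t *\<^sub>R c) = t *\<^sub>R monomial_form a c"
  "monomial_form a 0 = 0"
  by (auto simp: monomial_form_def fun_eq_iff algebra_simps)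

lemma subspace_full_poly_forms: "subspace (full_poly_forms r j)"
proof (rule subspaceI)
  show "0 \<in> full_poly_forms r j"
    unfolding full_poly_forms_iff
    by (intro exI[of _ "\<lambda>a. 0"]) (simp add: monomial_form_linear)
next
  fix v w :: "'a dform" assume "v \<in> full_poly_forms r j" "w \<in> full_poly_forms r j"
  then obtain c d where "\<forall>a. has_degree j (c a)" "\<forall>a. has_degree j (d a)"
    "v = (\<Sum>a | (\<Sum>i\<in>UNIV. a i) \<le> r. monomial_form a (c a))"
    "w = (\<Sum>a | (\<Sum>i\<in>UNIV. a i) \<le> r. monomial_form a (d a))"
    unfolding full_poly_forms_iff by blast
  then show "v + w \<in> full_poly_forms r j"
    unfolding full_poly_forms_iff
    by (intro exI[of _ "\<lambda>a. c a + d a"]) (simp add: monomial_form_linear has_degree_add sum.distrib)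
next
  fix t and v :: "'a dform" assume "v \<in> full_poly_forms r j"
  then obtain c where "\<forall>a. has_degree j (c a)"
    "v = (\<Sum>a | (\<Sum>i\<in>UNIV. a i) \<le> r. monomial_form a (c a))"
    unfolding full_poly_forms_iff by blast
  then show "t *\<^sub>R v \<in> full_poly_forms r j"
    unfolding full_poly_forms_iff
    by (intro exI[of _ "\<lambda>a. t *\<^sub>R c a"]) (simp add: monomial_form_linear has_degree_scaleR scaleR_right.sum)
qed

lemmas full_poly_forms_sum = subspace_sum[OF subspace_full_poly_forms]
  and full_poly_forms_scale = subspace_scale[OF subspace_full_poly_forms]
  and full_poly_forms_add = subspace_add[OF subspace_full_poly_forms]

lemma monomial_form_in_full_poly_forms:
  assumes "has_degree j c" "(\<Sum>i\<in>UNIV. a i) \<le> r"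
  shows "monomial_form a c \<in> full_poly_forms r j"
  unfolding full_poly_forms_iff
proof (intro exI conjI allI)
  have "(\<Sum>a' | (\<Sum>i\<in>UNIV. a' i) \<le> r. monomial_form a' (if a' = a then c else 0))
      = (\<Sum>a' | (\<Sum>i\<in>UNIV. a' i) \<le> r. if a' = a then monomial_form a c else 0)"
    by (intro sum.cong) (auto simp: monomial_form_linear)
  also have "\<dots> = monomial_form a c"
    using assms(2) by (subst sum.delta[OF finite_multi_indices]) simp
  finally show "monomial_form a c = (\<Sum>a' | (\<Sum>i\<in>UNIV. a' i) \<le> r. monomial_form a' (if a' = a then c else 0))" ..
  show "has_degree j (if a' = a then c else 0)" for a'
    using assms(1) by simp
qed

lemma full_poly_forms_induct [consumes 1, case_names monomial add]:
  assumes "\<omega> \<in> full_poly_forms r j"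
    and "\<And>a c. has_degree j c \<Longrightarrow> (\<Sum>i\<in>UNIV. a i) \<le> r \<Longrightarrow> P (monomial_form a c)"
    and "\<And>v w. P v \<Longrightarrow> P w \<Longrightarrow> P (v + w)"
  shows "P \<omega>"
proof -
  obtain c where c: "\<forall>a. has_degree j (c a)"
    "\<omega> = (\<Sum>a | (\<Sum>i\<in>UNIV. a i) \<le> r. monomial_form a (c a))"
    using assms(1) unfolding full_poly_forms_iff by blast
  have P0: "P 0"
    using assms(2)[of 0 "\<lambda>i. 0"] by (simp add: monomial_form_linear)
  have "A \<subseteq> {a. (\<Sum>i\<in>UNIV. a i) \<le> r} \<Longrightarrow> P (\<Sum>a\<in>A. monomial_form a (c a))" for A
    by (induction A rule: infinite_finite_induct) (use assms(2,3) c(1) P0 in auto)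
  then show ?thesis using c(2) by blast
qed

lemma full_poly_forms_mono: "r \<le> r' \<Longrightarrow> full_poly_forms r j \<subseteq> full_poly_forms r' j"
proof
  fix \<omega> :: "'a dform" assume "\<omega> \<in> full_poly_forms r j" "r \<le> r'"
  then show "\<omega> \<in> full_poly_forms r' j"
    by (induction rule: full_poly_forms_induct)
      (auto intro: monomial_form_in_full_poly_forms full_poly_forms_add)
qed

lemma full_poly_forms_degree: "\<omega> \<in> full_poly_forms r j \<Longrightarrow> has_degree j (\<omega> x)"
  by (induction rule: full_poly_forms_induct)
    (auto simp: monomial_form_def intro: has_degree_scaleR has_degree_add)

lemma full_poly_forms_smooth: "\<omega> \<in> full_poly_forms r j \<Longrightarrow> smooth \<omega>"
proof (induction rule: full_poly_forms_induct)
  case (monomial a c)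
  show ?case
    unfolding monomial_form_def[abs_def]
    by (rule smooth_prod) (rule times_differentiable_power)
next
  case (add v w)
  then show ?case using smooth_add[of v w] by (simp add: plus_fun_def)
qed

lemma full_poly_forms_linear:
  assumes "\<omega> \<in> full_poly_forms r j" "linear T" "\<And>c. has_degree j c \<Longrightarrow> has_degree j' (T c)"
  shows "(\<lambda>x. T (\<omega> x)) \<in> full_poly_forms r j'"
  using assms(1)
proof (induction rule: full_poly_forms_induct)
  case (monomial a c)
  then have "monomial_form a (T c) \<in> full_poly_forms r j'"
    using assms by (intro monomial_form_in_full_poly_forms)
  then show ?case
    by (simp add: monomial_form_def[abs_def] linear_scale[OF assms(2)])
next
  case (add v w)
  from full_poly_forms_add[OF this] show ?case
    by (simp add: plus_fun_def linear_add[OF assms(2)])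
qed

lemma full_poly_forms_times_coord:
  assumes "\<omega> \<in> full_poly_forms r j"
  shows "(\<lambda>x. (x $ i) *\<^sub>R \<omega> x) \<in> full_poly_forms (Suc r) j"
  using assms
proof (induction rule: full_poly_forms_induct)
  case (monomial a c)
  let ?a = "a(i := Suc (a i))"
  have "(\<Prod>k\<in>UNIV. (x $ k) ^ ?a k) = x $ i * (\<Prod>k\<in>UNIV. (x $ k) ^ a k)" for x :: "'a pt"
  proof -
    have "(\<Prod>k\<in>UNIV. (x $ k) ^ ?a k) = (x $ i) ^ Suc (a i) * (\<Prod>k\<in>UNIV - {i}. (x $ k) ^ a k)"
      by (subst prod.remove[of UNIV i]) auto
    then show ?thesis
      using prod.remove[of UNIV i "\<lambda>k. (x $ k) ^ a k"] by simp
  qed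
  then have "monomial_form ?a c = (\<lambda>x. (x $ i) *\<^sub>R monomial_form a c x)"
    by (simp add: monomial_form_def fun_eq_iff)
  moreover have "(\<Sum>k\<in>UNIV. ?a k) = Suc (\<Sum>k\<in>UNIV. a k)"
  proof -
    have "(\<Sum>k\<in>UNIV. ?a k) = Suc (a i) + (\<Sum>k\<in>UNIV - {i}. a k)"
      by (subst sum.remove[of UNIV i]) auto
    then show ?thesis
      using sum.remove[of UNIV i a] by simp
  qed
  ultimately show ?case
    using monomial_form_in_full_poly_forms[of j c ?a "Suc r"] monomial by simp
next
  case (add v w)
  from full_poly_forms_add[OF this] show ?case
    by (simp add: plus_fun_def scaleR_add_right)
qed

lemma full_poly_forms_affine:
  fixes L :: "'n::{finite,linorder} pt \<Rightarrow> 'n pt"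
  assumes "\<omega> \<in> full_poly_forms r j" "linear L"
  shows "(\<lambda>x. \<omega> (L x + b)) \<in> full_poly_forms r j"
  using assms(1)
proof (induction rule: full_poly_forms_induct)
  case (monomial a c)
  then show ?case
  proof (induction r arbitrary: a)
    case 0
    then have "a = (\<lambda>i. 0)" by (auto simp: fun_eq_iff)
    then have "(\<lambda>x. monomial_form a c (L x + b)) = monomial_form (\<lambda>i. 0) c"
      by (simp add: monomial_form_def fun_eq_iff)
    then show ?case
      using monomial_form_in_full_poly_forms[OF 0(1)] by simp
  next
    case (Suc r)
    show ?case
    proof (cases "a = (\<lambda>i. 0)")
      case True
      then have "(\<lambda>x. monomial_form a c (L x + b)) = monomial_form (\<lambda>i. 0) c"
        by (simp add: monomial_form_def fun_eq_iff)
      then show ?thesis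
        using monomial_form_in_full_poly_forms[OF Suc.prems(1), of "\<lambda>i. 0"] by simp
    next
      case False
      then obtain i where i: "0 < a i" by (auto simp: fun_eq_iff)
      \<comment> \<open>One factor \<open>y $ i\<close> is split off. Under the affine substitution
        it becomes an affine function of x, while the remaining monomial has degree at most r and is
        covered by the induction.\<close>
      let ?a = "a(i := a i - 1)"
      have "(\<Sum>k\<in>UNIV. a k) = a i + (\<Sum>k\<in>UNIV - {i}. a k)"
        by (rule sum.remove) auto
      moreover have "(\<Sum>k\<in>UNIV. ?a k) = a i - 1 + (\<Sum>k\<in>UNIV - {i}. a k)"
        by (subst sum.remove[of UNIV i]) auto
      ultimately have le: "(\<Sum>k\<in>UNIV. ?a k) \<le> r"
        using Suc.prems(2) i by linarith
      let ?\<mu> = "\<lambda>x. monomial_form ?a c (L x + b)"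
      have IH: "?\<mu> \<in> full_poly_forms r j"
        by (rule Suc.IH[OF Suc.prems(1) le])
      have prod: "monomial_form a c y = (y $ i) *\<^sub>R monomial_form ?a c y" for y
      proof -
        have "(\<Prod>k\<in>UNIV. (y $ k) ^ a k) = (y $ i) ^ a i * (\<Prod>k\<in>UNIV - {i}. (y $ k) ^ a k)"
          by (rule prod.remove) auto
        also have "\<dots> = y $ i * ((y $ i) ^ (a i - 1) * (\<Prod>k\<in>UNIV - {i}. (y $ k) ^ a k))"
          using i by (simp add: power_eq_if)
        also have "(y $ i) ^ (a i - 1) * (\<Prod>k\<in>UNIV - {i}. (y $ k) ^ a k) = (\<Prod>k\<in>UNIV. (y $ k) ^ ?a k)"
          by (subst prod.remove[of UNIV i]) auto
        finally show ?thesis by (simp add: monomial_form_def)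
      qed
      have coord: "L x $ i = (\<Sum>k\<in>UNIV. L (axis k 1) $ i * x $ k)" for x
      proof -
        have "L x = L (\<Sum>k\<in>UNIV. x $ k *\<^sub>R axis k 1)"
          using basis_expansion[of x] by (simp add: scalar_mult_eq_scaleR)
        also have "\<dots> = (\<Sum>k\<in>UNIV. x $ k *\<^sub>R L (axis k 1))"
          by (simp add: linear_sum[OF assms(2)] linear_scale[OF assms(2)])
        finally show ?thesis by (simp add: mult.commute)
      qed
      have "(\<Sum>k\<in>UNIV. (L (axis k 1) $ i) *\<^sub>R (\<lambda>x. (x $ k) *\<^sub>R ?\<mu> x)) + (b $ i) *\<^sub>R ?\<mu> \<in> full_poly_forms (Suc r) j"
        by (intro full_poly_forms_add full_poly_forms_sum full_poly_forms_scale
            full_poly_forms_times_coord[OF IH] subsetD[OF full_poly_forms_mono IH] le_SucI order_refl)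
      moreover have "(\<Sum>k\<in>UNIV. (L (axis k 1) $ i) *\<^sub>R (\<lambda>x. (x $ k) *\<^sub>R ?\<mu> x)) + (b $ i) *\<^sub>R ?\<mu>
          = (\<lambda>x. monomial_form a c (L x + b))"
      proof (rule ext)
        fix x
        show "((\<Sum>k\<in>UNIV. (L (axis k 1) $ i) *\<^sub>R (\<lambda>x. (x $ k) *\<^sub>R ?\<mu> x)) + (b $ i) *\<^sub>R ?\<mu>) x
            = monomial_form a c (L x + b)"
          by (simp only: plus_fun_apply sum_fun_apply scaleR_fun_apply prod[of "L x + b"]
            vector_add_component coord[of x] scaleR_add_left scaleR_sum_left scaleR_scaleR)
      qed
      ultimately show ?thesis by simp
    qed
  qed
next
  case (add v w)
  from full_poly_forms_add[OF this] show ?case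
    by (simp add: plus_fun_def)
qed

lemma full_poly_forms_partial:
  assumes "\<omega> \<in> full_poly_forms r j"
  shows "partial i \<omega> \<in> full_poly_forms (r - 1) j"
proof -
  \<comment> \<open>Smoothness is carried through the induction because additivity of
    \<open>partial\<close> requires differentiable summands.\<close>
  have "smooth \<omega> \<and> partial i \<omega> \<in> full_poly_forms (r - 1) j"
    using assms
  proof (induction rule: full_poly_forms_induct)
    case (monomial a c)
    have sm: "smooth (monomial_form a c)"
      using monomial by (intro full_poly_forms_smooth[of _ r j] monomial_form_in_full_poly_forms)
    let ?F = "\<lambda>k t. t ^ a k :: real"
    let ?a = "a(i := a i - 1)"
    have der: "deriv (?F i) = (\<lambda>t. real (a i) * t ^ (a i - 1))"
      by (rule ext, rule DERIV_imp_deriv) (auto intro!: derivative_eq_intros)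
    have "partial i (monomial_form a c) x = real (a i) *\<^sub>R monomial_form ?a c x" for x
    proof -
      have "partial i (monomial_form a c) x = (\<Prod>k\<in>UNIV. (?F(i := deriv (?F i))) k (x $ k)) *\<^sub>R c"
        unfolding monomial_form_def[abs_def]
        by (rule partial_prod(2)) (rule times_differentiableD[OF times_differentiable_power])
      also have "(\<Prod>k\<in>UNIV. (?F(i := deriv (?F i))) k (x $ k))
          = real (a i) * ((x $ i) ^ (a i - 1) * (\<Prod>k\<in>UNIV - {i}. (x $ k) ^ a k))"
        by (subst prod.remove[of UNIV i]) (auto simp: der)
      also have "(x $ i) ^ (a i - 1) * (\<Prod>k\<in>UNIV - {i}. (x $ k) ^ a k) = (\<Prod>k\<in>UNIV. (x $ k) ^ ?a k)"
        by (subst prod.remove[of UNIV i]) auto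
      finally show ?thesis by (simp add: monomial_form_def[abs_def])
    qed
    then have eq: "partial i (monomial_form a c) = real (a i) *\<^sub>R monomial_form ?a c"
      by (simp add: fun_eq_iff)
    \<comment> \<open>For r = 0, where r - 1 is truncated, all exponents are 0 and the derivative
      vanishes.\<close>
    show ?case
    proof (cases "a i = 0")
      case True
      then have "partial i (monomial_form a c) = 0"
        unfolding eq by (simp only: of_nat_0 scaleR_zero_left)
      then show ?thesis using sm subspace_0[OF subspace_full_poly_forms] by metis
    next
      case False
      have "(\<Sum>k\<in>UNIV. a k) = a i + (\<Sum>k\<in>UNIV - {i}. a k)"
        by (rule sum.remove) auto
      moreover have "(\<Sum>k\<in>UNIV. ?a k) = a i - 1 + (\<Sum>k\<in>UNIV - {i}. a k)"
        by (subst sum.remove[of UNIV i]) auto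
      ultimately have "(\<Sum>k\<in>UNIV. ?a k) \<le> r - 1"
        using monomial(2) False by linarith
      then show ?thesis
        unfolding eq
        by (intro conjI sm full_poly_forms_scale monomial_form_in_full_poly_forms monomial(1))
    qed
  next
    case (add v w)
    have "partial i (v + w) = partial i v + partial i w"
      using partial_add[of v _ w i] smooth_differentiable[of v] smooth_differentiable[of w] add
      by (simp add: plus_fun_def fun_eq_iff)
    moreover have "smooth (v + w)"
      using smooth_add[of v w] add by (simp add: plus_fun_def)
    ultimately show ?case
      using add full_poly_forms_add[of "partial i v"] by metis
  qed
  then show ?thesis ..
qed

lemma full_poly_forms_ext_deriv:
  assumes "\<omega> \<in> full_poly_forms r j"
  shows "ext_deriv \<omega> \<in> full_poly_forms (r - 1) (j + 1)"
proof -
  have "(\<Sum>i\<in>UNIV. (\<lambda>x. wedge (axis {i} 1) (partial i \<omega> x))) \<in> full_poly_forms (r - 1) (j + 1)"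
    by (intro full_poly_forms_sum full_poly_forms_linear[OF full_poly_forms_partial[OF assms]]
        linear_wedge_right has_degree_wedge_axis)
  moreover have "(\<Sum>i\<in>UNIV. (\<lambda>x. wedge (axis {i} 1) (partial i \<omega> x))) = ext_deriv \<omega>"
    by (simp add: fun_eq_iff ext_deriv_def sum_fun_apply)
  ultimately show ?thesis by simp
qed

lemma full_poly_forms_contract:
  assumes "\<beta> \<in> full_poly_forms r (j + 1)"
  shows "(\<lambda>x. contract x (\<beta> x)) \<in> full_poly_forms (Suc r) j"
proof -
  have "(\<Sum>i\<in>UNIV. (\<lambda>x. (x $ i) *\<^sub>R contract (axis i 1) (\<beta> x))) \<in> full_poly_forms (Suc r) j"
    by (intro full_poly_forms_sum full_poly_forms_times_coord full_poly_forms_linear[OF assms]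
        linear_contract has_degree_contract)
  moreover have "contract x (\<beta> x) = (\<Sum>i\<in>UNIV. (x $ i) *\<^sub>R contract (axis i 1) (\<beta> x))" for x
  proof -
    have "contract x (\<beta> x) = contract (\<Sum>i\<in>UNIV. x $ i *\<^sub>R axis i 1) (\<beta> x)"
      using basis_expansion[of x] by (simp add: scalar_mult_eq_scaleR)
    then show ?thesis
      by (simp add: linear_sum[OF linear_contract_left] linear_scale[OF linear_contract_left])
  qed
  ultimately show ?thesis
    by (simp add: sum_fun_apply[abs_def])
qed

lemma full_subset_trimmed_Suc: "full_poly_forms r j \<subseteq> trimmed_poly_forms (Suc r) j"
proof
  fix \<alpha> :: "'a dform" assume "\<alpha> \<in> full_poly_forms r j"
  moreover have "\<alpha> = (\<lambda>x. \<alpha> x + contract x (0 x))"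
    by (simp add: linear_0[OF linear_contract])
  ultimately show "\<alpha> \<in> trimmed_poly_forms (Suc r) j"
    using subspace_0[OF subspace_full_poly_forms[of r "j + 1"]]
    unfolding trimmed_poly_forms_def by (simp del: zero_fun_apply) blast
qed

lemma trimmed_subset_full: "trimmed_poly_forms r j \<subseteq> full_poly_forms r j"
proof
  fix \<omega> :: "'a dform" assume \<omega>: "\<omega> \<in> trimmed_poly_forms r j"
  show "\<omega> \<in> full_poly_forms r j"
  proof (cases r)
    case 0
    then have "\<omega> = 0" using \<omega> by (simp add: trimmed_poly_forms_def zero_fun_def)
    then show ?thesis using subspace_0[OF subspace_full_poly_forms] by simp
  next
    case (Suc s)
    then obtain \<alpha> \<beta> where "\<omega> = \<alpha> + (\<lambda>x. contract x (\<beta> x))"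
      "\<alpha> \<in> full_poly_forms s j" "\<beta> \<in> full_poly_forms s (j + 1)"
      using \<omega> by (auto simp: trimmed_poly_forms_def plus_fun_def)
    then show ?thesis
      using full_poly_forms_contract[of \<beta> s j] full_poly_forms_mono[of s "Suc s" j] Suc
      by (auto intro: full_poly_forms_add)
  qed
qed

lemma subspace_trimmed_poly_forms: "subspace (trimmed_poly_forms r j)"
proof (cases r)
  case 0
  have "trimmed_poly_forms r j = {0 :: 'a dform}"
    using 0 by (simp add: trimmed_poly_forms_def zero_fun_def)
  then show ?thesis by (simp add: subspace_single_0)
next
  case (Suc s)
  have eq: "trimmed_poly_forms r j = {x + y | x y. x \<in> full_poly_forms s j \<and>
      y \<in> (\<lambda>\<beta> x. contract x (\<beta> x)) ` full_poly_forms s (j + 1)}"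
  proof (intro subset_antisym subsetI)
    fix \<omega> assume "\<omega> \<in> trimmed_poly_forms r j"
    then obtain \<alpha> \<beta> where "\<omega> = \<alpha> + (\<lambda>x. contract x (\<beta> x))"
      "\<alpha> \<in> full_poly_forms s j" "\<beta> \<in> full_poly_forms s (j + 1)"
      using Suc by (auto simp: trimmed_poly_forms_def plus_fun_def)
    then show "\<omega> \<in> {x + y | x y. x \<in> full_poly_forms s j \<and>
      y \<in> (\<lambda>\<beta> x. contract x (\<beta> x)) ` full_poly_forms s (j + 1)}"
      by blast
  qed (auto simp: Suc trimmed_poly_forms_def plus_fun_def)
  have "linear (\<lambda>\<beta> x. contract x (\<beta> x))"
    by (rule linearI) (auto simp: fun_eq_iff linear_add[OF linear_contract] linear_scale[OF linear_contract])
  then show ?thesis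
    unfolding eq by (intro subspace_sums subspace_full_poly_forms linear_subspace_image)
qed

lemma subspace_poly_forms: "subspace (poly_forms A j)"
  by (cases A) (simp_all add: subspace_full_poly_forms subspace_trimmed_poly_forms)

lemma poly_forms_subset_full: "\<exists>r. poly_forms A j \<subseteq> full_poly_forms r j"
  by (cases A) (use trimmed_subset_full in auto)

lemma poly_forms_finite_span:
  obtains B where "finite B" "poly_forms A j \<subseteq> span B"
proof -
  obtain r where r: "poly_forms A j \<subseteq> (full_poly_forms r j :: 'a dform set)"
    using poly_forms_subset_full by blast
  let ?B = "(\<lambda>(a, I). monomial_form a (axis I 1)) ` ({a. (\<Sum>i\<in>UNIV. a i) \<le> r} \<times> (UNIV :: 'a set set))"
  have "\<omega> \<in> span ?B" if "\<omega> \<in> full_poly_forms r j" for \<omega>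
    using that
  proof (induction rule: full_poly_forms_induct)
    case (monomial a c)
    have "c = (\<Sum>I\<in>UNIV. c $ I *\<^sub>R axis I 1)"
      using basis_expansion[of c] by (simp add: scalar_mult_eq_scaleR)
    then have "monomial_form a c x = (\<Sum>I\<in>UNIV. c $ I *\<^sub>R monomial_form a (axis I 1) x)" for x
      unfolding monomial_form_def by (metis (no_types, lifting) scaleR_left_commute scaleR_right.sum sum.cong)
    then have "monomial_form a c = (\<Sum>I\<in>UNIV. c $ I *\<^sub>R monomial_form a (axis I 1))"
      by (simp add: fun_eq_iff sum_fun_apply)
    also have "\<dots> \<in> span ?B"
      using monomial by (intro span_sum span_scale span_base) force
    finally show ?case .
  qed (rule span_add)
  with r that[of ?B] show ?thesis
    by (auto simp: finite_multi_indices)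
qed

lemma poly_forms_degree: "\<omega> \<in> poly_forms A j \<Longrightarrow> has_degree j (\<omega> x)"
  using poly_forms_subset_full[of A j] full_poly_forms_degree by blast

lemma poly_forms_smooth: "\<omega> \<in> poly_forms A j \<Longrightarrow> smooth \<omega>"
  using poly_forms_subset_full[of A j] full_poly_forms_smooth by blast

text \<open>The trimmed spaces contract with the position vector, which an affine map does not
  preserve. Writing the image point as M (h x + c) with M c = b, the pulled back contraction splits
  into one with the position vector x and one with the constant vector c; the latter does not raise
  the polynomial degree and is absorbed by the full summand.\<close>

lemma poly_forms_pullback:
  fixes M :: "'n::{finite,linorder} pt \<Rightarrow> 'n pt"
  assumes \<omega>: "\<omega> \<in> poly_forms A j" and M: "linear M" "bij M"
  shows "(\<lambda>x. form_pullback M (\<omega> (h *\<^sub>R M x + b))) \<in> poly_forms A j"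
proof -
  have full: "(\<lambda>x. form_pullback M (\<omega> (h *\<^sub>R M x + b))) \<in> full_poly_forms r j"
    if "\<omega> \<in> full_poly_forms r j" for \<omega> r j
  proof -
    have "linear (\<lambda>x. h *\<^sub>R M x)"
      using M(1) by (intro linear_compose_scale_right)
    then show ?thesis
      by (intro full_poly_forms_linear[OF full_poly_forms_affine[OF that]] linear_form_pullback has_degree_form_pullback)
  qed
  show ?thesis
  proof (cases A)
    case (Full r)
    then show ?thesis using \<omega> full by simp
  next
    case (Trimmed r)
    show ?thesis
    proof (cases r)
      case 0
      then show ?thesis
        using \<omega> Trimmed by (auto simp: trimmed_poly_forms_def linear_0[OF linear_form_pullback])
    next
      case (Suc s)
      then obtain \<alpha> \<beta> where \<omega>: "\<omega> = (\<lambda>x. \<alpha> x + contract x (\<beta> x))"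
        and \<alpha>: "\<alpha> \<in> full_poly_forms s j" and \<beta>: "\<beta> \<in> full_poly_forms s (j + 1)"
        using \<omega> Trimmed by (auto simp: trimmed_poly_forms_def)
      define \<alpha>' where "\<alpha>' x = form_pullback M (\<alpha> (h *\<^sub>R M x + b))" for x
      define \<beta>' where "\<beta>' x = form_pullback M (\<beta> (h *\<^sub>R M x + b))" for x
      define c where "c = inv M b"
      have c: "M c = b"
        using M(2) by (simp add: c_def bij_is_surj surj_f_inv_f)
      have "form_pullback M (contract (h *\<^sub>R M x + b) (\<beta> (h *\<^sub>R M x + b))) = contract x (h *\<^sub>R \<beta>' x) + contract c (\<beta>' x)" for x
      proof -
        have "h *\<^sub>R M x + b = M (h *\<^sub>R x + c)"
          by (simp add: linear_add[OF M(1)] linear_scale[OF M(1)] c)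
        then have "form_pullback M (contract (h *\<^sub>R M x + b) (\<beta> (h *\<^sub>R M x + b))) = contract (h *\<^sub>R x + c) (\<beta>' x)"
          unfolding \<beta>'_def using form_pullback_contract[OF M(1), of "h *\<^sub>R x + c"] by metis
        then show ?thesis
          by (simp add: linear_add[OF linear_contract_left] linear_scale[OF linear_contract_left]
              linear_scale[OF linear_contract])
      qed
      then have eq: "(\<lambda>x. form_pullback M (\<omega> (h *\<^sub>R M x + b)))
          = (\<lambda>x. (\<alpha>' + (\<lambda>x. contract c (\<beta>' x))) x + contract x ((h *\<^sub>R \<beta>') x))"
        by (simp add: \<omega> linear_add[OF linear_form_pullback] \<alpha>'_def fun_eq_iff)
      have "\<alpha>' \<in> full_poly_forms s j" "\<beta>' \<in> full_poly_forms s (j + 1)"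
        unfolding \<alpha>'_def[abs_def] \<beta>'_def[abs_def] by (rule full, rule \<alpha>, rule full, rule \<beta>)
      note ab = this
      have "(\<lambda>x. contract c (\<beta>' x)) \<in> full_poly_forms s j"
        by (rule full_poly_forms_linear[OF ab(2) linear_contract has_degree_contract])
      note full_poly_forms_add[OF ab(1) this] full_poly_forms_scale[OF ab(2), of h]
      then show ?thesis
        unfolding eq Trimmed Suc trimmed_poly_forms_def poly_forms.simps by (simp only: diff_Suc_1 nat.distinct if_False) blast
    qed
  qed
qed

text \<open>Either choice of A lies in the full space of degree r + 1, d lowers the polynomial
  degree, and either choice of B contains the full space of degree r. This is what lets u be
  replaced by its projection against d\<tau>.\<close>

lemma stable_pair_ext_deriv:
  assumes "stable_pair A B" "\<omega> \<in> poly_forms A j"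
  shows "ext_deriv \<omega> \<in> poly_forms B (j + 1)"
proof -
  obtain r where A: "A \<in> {Full (r + 1), Trimmed (r + 1)}" and B: "B = Full r \<or> B = Trimmed (r + 1)"
    using assms(1) unfolding stable_pair_def by blast
  have "\<omega> \<in> full_poly_forms (r + 1) j"
    using A assms(2) subsetD[OF trimmed_subset_full, of \<omega> "Suc r" j] by auto
  from full_poly_forms_ext_deriv[OF this] have "ext_deriv \<omega> \<in> full_poly_forms r (j + 1)"
    by simp
  with B full_subset_trimmed_Suc[of r "j + 1"] show ?thesis by auto
qed


section \<open>Lebesgue measure under linear maps\<close>

text \<open>The factor is the reciprocal of the absolute value of the determinant. It is obtained from
  translation invariance alone because the library's change of variables formula needs the index
  type to be of class \<open>wellorder\<close>.\<close>

definition preimage_factor :: "('a::euclidean_space \<Rightarrow> 'a) \<Rightarrow> real" where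
  "preimage_factor L = measure lborel (L -` cball 0 1) / measure lborel (cball 0 1 :: 'a set)"

lemma measure_cball_pos: "0 < r \<Longrightarrow> 0 < measure lborel (cball (a :: 'a::euclidean_space) r)"
  using content_cball_pos[of r a] by simp

lemma nn_integral_lborel_translation:
  fixes f :: "'a::euclidean_space \<Rightarrow> ennreal"
  assumes "f \<in> borel_measurable borel"
  shows "(\<integral>\<^sup>+x. f (x + c) \<partial>lborel) = (\<integral>\<^sup>+x. f x \<partial>lborel)"
  using nn_integral_distr[of "(+) c" lborel borel f] assms
  by (simp add: lborel_distr_plus add.commute)

lemma preimage_factor_nonneg: "0 \<le> preimage_factor L"
  by (simp add: preimage_factor_def)

locale linear_bij =
  fixes L :: "'a::euclidean_space \<Rightarrow> 'a"
  assumes linear: "linear L" and bij: "bij L"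
begin

lemma linear_inv: "linear (inv L)"
  using linear bij by (simp add: inj_linear_imp_inv_linear bij_is_inj)

lemma inv_apply [simp]: "inv L (L x) = x" "L (inv L x) = x"
  using bij by (auto simp: bij_is_inj bij_is_surj surj_f_inv_f)

lemma continuous: "continuous_on S L"
  using linear by (simp add: linear_continuous_on linear_conv_bounded_linear)

lemma borel_measurable [measurable]: "L \<in> borel_measurable borel"
  by (intro borel_measurable_continuous_onI continuous)

lemma bounded_preimage: "bounded S \<Longrightarrow> bounded (L -` S)"
proof -
  assume "bounded S"
  then have "bounded (inv L ` S)"
    using linear_inv by (simp add: bounded_linear_image linear_conv_bounded_linear)
  moreover have "L -` S = inv L ` S"
    using bij_vimage_eq_inv_image[OF bij] by simp
  ultimately show ?thesis by simp
qed

lemma emeasure_preimage_cball: "emeasure lborel (L -` cball 0 1) = ennreal (measure lborel (L -` cball 0 1))"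
  using emeasure_bounded_finite[OF bounded_preimage[OF bounded_cball[of 0 1]]]
  by (simp add: emeasure_eq_ennreal_measure less_top)

text \<open>Uniqueness of Haar measure: evaluate the integral of \<open>1\<^sub>A(L x) 1\<^sub>B(y - L x)\<close>, with \<open>B\<close> the
  unit ball, in both orders.\<close>

lemma emeasure_preimage:
  assumes A: "A \<in> sets borel"
  shows "emeasure lborel (L -` A) = ennreal (preimage_factor L) * emeasure lborel A"
proof -
  define B :: "'a set" where "B = cball 0 1"
  have [measurable]: "B \<in> sets borel" by (simp add: B_def)
  define F :: "'a \<Rightarrow> 'a \<Rightarrow> ennreal" where "F x y = indicator A (L x) * indicator B (y - L x)" for x y
  have [measurable]: "A \<in> sets borel" by (rule A)
  have "case_prod F \<in> borel_measurable (lborel \<Otimes>\<^sub>M lborel)"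
    unfolding F_def by measurable
  from lborel_pair.Fubini'[OF this]
  have "(\<integral>\<^sup>+y. \<integral>\<^sup>+x. F x y \<partial>lborel \<partial>lborel) = (\<integral>\<^sup>+x. \<integral>\<^sup>+y. F x y \<partial>lborel \<partial>lborel)" .
  also have "\<dots> = (\<integral>\<^sup>+x. indicator A (L x) * emeasure lborel B \<partial>lborel)"
  proof (rule nn_integral_cong)
    fix x
    have "(\<integral>\<^sup>+y. F x y \<partial>lborel) = indicator A (L x) * (\<integral>\<^sup>+y. indicator B (y + - L x) \<partial>lborel)"
      unfolding F_def by (subst nn_integral_cmult) auto
    also have "(\<integral>\<^sup>+y. indicator B (y + - L x) \<partial>lborel) = (\<integral>\<^sup>+y. indicator B y \<partial>lborel)"
      by (rule nn_integral_lborel_translation) simp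
    finally show "(\<integral>\<^sup>+y. F x y \<partial>lborel) = indicator A (L x) * emeasure lborel B"
      by simp
  qed
  also have "\<dots> = (\<integral>\<^sup>+x. indicator (L -` A) x \<partial>lborel) * emeasure lborel B"
    by (subst nn_integral_multc[symmetric]) (auto simp: indicator_def intro!: nn_integral_cong)
  also have "(\<integral>\<^sup>+x. indicator (L -` A) x \<partial>lborel) = emeasure lborel (L -` A)"
    using measurable_sets[OF borel_measurable A] by (intro nn_integral_indicator) simp
  finally have 1: "(\<integral>\<^sup>+y. \<integral>\<^sup>+x. F x y \<partial>lborel \<partial>lborel) = emeasure lborel (L -` A) * emeasure lborel B" .
  have "(\<integral>\<^sup>+y. \<integral>\<^sup>+x. F x y \<partial>lborel \<partial>lborel)
      = (\<integral>\<^sup>+y. \<integral>\<^sup>+x. indicator A (L x + y) * indicator B (L x) \<partial>lborel \<partial>lborel)"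
  proof (rule nn_integral_cong)
    fix y
    have "(\<lambda>x. F x y) \<in> borel_measurable borel"
      unfolding F_def by measurable
    \<comment> \<open>Translating x by \<open>inv L y\<close> turns L x into L x + y; the second
      indicator is then evaluated at - L x, which by symmetry of the ball is the same as at L
      x.\<close>
    from nn_integral_lborel_translation[OF this, of "inv L y"]
    have "(\<integral>\<^sup>+x. F x y \<partial>lborel) = (\<integral>\<^sup>+x. F (x + inv L y) y \<partial>lborel)" ..
    also have "\<dots> = (\<integral>\<^sup>+x. indicator A (L x + y) * indicator B (L x) \<partial>lborel)"
      by (simp add: F_def linear_add[OF linear] indicator_def B_def)
    finally show "(\<integral>\<^sup>+x. F x y \<partial>lborel) = (\<integral>\<^sup>+x. indicator A (L x + y) * indicator B (L x) \<partial>lborel)" .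
  qed
  also have "\<dots> = (\<integral>\<^sup>+x. \<integral>\<^sup>+y. indicator A (L x + y) * indicator B (L x) \<partial>lborel \<partial>lborel)"
    by (rule lborel_pair.Fubini') measurable
  also have "\<dots> = (\<integral>\<^sup>+x. emeasure lborel A * indicator (L -` B) x \<partial>lborel)"
  proof (rule nn_integral_cong)
    fix x
    have "(\<integral>\<^sup>+y. indicator A (L x + y) * indicator B (L x) \<partial>lborel)
        = (\<integral>\<^sup>+y. indicator A (y + L x) \<partial>lborel) * indicator B (L x)"
      by (subst nn_integral_multc) (auto simp: add.commute)
    also have "(\<integral>\<^sup>+y. indicator A (y + L x) \<partial>lborel) = (\<integral>\<^sup>+y. indicator A y \<partial>lborel)"
      by (rule nn_integral_lborel_translation) simp
    also have "\<dots> = emeasure lborel A"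
      by (rule nn_integral_indicator) simp
    finally show "(\<integral>\<^sup>+y. indicator A (L x + y) * indicator B (L x) \<partial>lborel)
        = emeasure lborel A * indicator (L -` B) x"
      by (simp add: indicator_def)
  qed
  also have "\<dots> = emeasure lborel A * emeasure lborel (L -` B)"
    using measurable_sets[OF borel_measurable, of B] by (intro nn_integral_cmult_indicator) simp
  finally have 2: "emeasure lborel (L -` A) * emeasure lborel B = emeasure lborel A * emeasure lborel (L -` B)"
    unfolding 1 .
  have B: "emeasure lborel B = ennreal (measure lborel B)"
    using emeasure_bounded_finite[OF bounded_cball, of "0 :: 'a" 1] by (simp add: B_def emeasure_eq_ennreal_measure less_top)
  have pos: "0 < measure lborel B" unfolding B_def by (rule measure_cball_pos) simp
  have "emeasure lborel (L -` A) = emeasure lborel (L -` A) * emeasure lborel B * ennreal (1 / measure lborel B)"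
    using pos by (simp add: B mult.assoc flip: ennreal_mult)
  also have "\<dots> = emeasure lborel A * (ennreal (measure lborel (L -` B)) * ennreal (1 / measure lborel B))"
    unfolding 2 emeasure_preimage_cball[folded B_def] by (simp add: mult.assoc)
  also have "\<dots> = ennreal (preimage_factor L) * emeasure lborel A"
    using pos by (simp add: preimage_factor_def mult.commute flip: ennreal_mult B_def)
  finally show ?thesis .
qed

lemma measure_preimage:
  "A \<in> sets borel \<Longrightarrow> measure lborel (L -` A) = preimage_factor L * measure lborel A"
  unfolding measure_def[of lborel "L -` A"] measure_def[of lborel A] emeasure_preimage enn2real_mult
  by (simp add: preimage_factor_nonneg)

lemma distr_eq: "distr lborel borel L = density lborel (\<lambda>_. ennreal (preimage_factor L))"
  by (rule measure_eqI) (simp_all add: emeasure_distr emeasure_preimage emeasure_density_const)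

lemma nn_integral_compose:
  "f \<in> borel_measurable borel \<Longrightarrow>
    (\<integral>\<^sup>+x. f (L x) \<partial>lborel) = ennreal (preimage_factor L) * (\<integral>\<^sup>+x. f x \<partial>lborel)"
  using nn_integral_distr[of L lborel borel f] by (simp add: distr_eq nn_integral_density nn_integral_cmult)

lemma nn_integral_affine:
  assumes "f \<in> borel_measurable borel"
  shows "(\<integral>\<^sup>+x. f (L x + b) \<partial>lborel) = ennreal (preimage_factor L) * (\<integral>\<^sup>+x. f x \<partial>lborel)"
  using nn_integral_compose[of "\<lambda>x. f (x + b)"] nn_integral_lborel_translation[OF assms, of b] assms
  by simp

end

section \<open>Values and bounds of the transformation factor\<close>

lemma linear_bij_scale: "h \<noteq> 0 \<Longrightarrow> linear_bij (\<lambda>x. h *\<^sub>R x)"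
  by unfold_locales (auto simp: bij_def inj_on_def surj_def intro!: linearI scaleR_add_right exI[of _ "_ /\<^sub>R h"])

lemma linear_bij_compose: "linear_bij L \<Longrightarrow> linear_bij M \<Longrightarrow> linear_bij (\<lambda>x. L (M x))"
  unfolding linear_bij_def using linear_compose[of M L] bij_comp[of M L] by (auto simp: comp_def)

lemma linear_bij_inv: "linear_bij L \<Longrightarrow> linear_bij (inv L)"
  using linear_bij.linear_inv linear_bij.bij bij_imp_bij_inv by (auto simp: linear_bij_def)

lemma preimage_factor_compose:
  assumes "linear_bij L" "linear_bij M"
  shows "preimage_factor (\<lambda>x. L (M x)) = preimage_factor L * preimage_factor M"
proof -
  interpret L: linear_bij L by fact
  interpret M: linear_bij M by fact
  have "(\<lambda>x. L (M x)) -` cball 0 1 = M -` (L -` cball 0 1)"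
    by auto
  moreover have "L -` cball 0 1 \<in> sets borel"
    using measurable_sets[OF L.borel_measurable, of "cball 0 1"] by simp
  ultimately show ?thesis
    by (simp add: preimage_factor_def[of "\<lambda>x. L (M x)"] M.measure_preimage preimage_factor_def[of L])
qed

lemma preimage_factor_diagonal:
  fixes c :: "'a::euclidean_space \<Rightarrow> real"
  assumes c: "\<And>j. j \<in> Basis \<Longrightarrow> c j \<noteq> 0"
    and T: "\<And>x. T x = (\<Sum>j\<in>Basis. (c j * (x \<bullet> j)) *\<^sub>R j)" and lb: "linear_bij T"
  shows "preimage_factor T = 1 / (\<Prod>j\<in>Basis. \<bar>c j\<bar>)"
proof -
  interpret linear_bij T by fact
  let ?B = "cball 0 1 :: 'a set" and ?p = "\<Prod>j\<in>Basis. \<bar>c j\<bar>"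
  have p: "0 < ?p" using c by (intro prod_pos) auto
  have "lborel = density (distr lborel borel T) (\<lambda>_. ennreal ?p)"
    using lborel_affine_euclidean[where c = c and t = 0] c by (simp add: T[abs_def])
  then have "emeasure lborel ?B = emeasure (density (distr lborel borel T) (\<lambda>_. ennreal ?p)) ?B"
    by simp
  also have "\<dots> = ennreal ?p * emeasure lborel (T -` ?B)"
    by (simp add: emeasure_density_const emeasure_distr)
  finally have eq: "measure lborel ?B = ?p * measure lborel (T -` ?B)"
    using p by (simp add: measure_def enn2real_mult)
  then have "measure lborel (T -` ?B) \<noteq> 0"
    using measure_cball_pos[of 1 "0 :: 'a"] by auto
  then show ?thesis
    unfolding preimage_factor_def eq by simp
qed

lemma preimage_factor_scale:
  assumes "0 < h"
  shows "preimage_factor (\<lambda>x :: 'a::euclidean_space. h *\<^sub>R x) = 1 / h ^ DIM('a)"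
proof -
  have "h *\<^sub>R x = (\<Sum>j\<in>Basis. (h * (x \<bullet> j)) *\<^sub>R j)" for x :: 'a
    by (subst euclidean_representation[of x, symmetric]) (simp add: scaleR_sum_right)
  from preimage_factor_diagonal[OF _ this linear_bij_scale] show ?thesis
    using assms by simp
qed

lemma measure_cball_0:
  assumes "0 < r"
  shows "measure lborel (cball 0 r :: 'a::euclidean_space set) = r ^ DIM('a) * measure lborel (cball 0 1 :: 'a set)"
proof -
  have "(\<lambda>x. (1 / r) *\<^sub>R x) -` cball 0 1 = (cball 0 r :: 'a set)"
    using assms by (auto simp: field_simps)
  then show ?thesis
    using assms linear_bij.measure_preimage[OF linear_bij_scale[of "1 / r"], of "cball 0 1 :: 'a set"]
    by (simp add: preimage_factor_scale power_one_over)
qed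

lemma preimage_factor_le:
  fixes L :: "'a::euclidean_space \<Rightarrow> 'a"
  assumes "0 < c" "\<And>x. norm x \<le> c * norm (L x)"
  shows "preimage_factor L \<le> c ^ DIM('a)"
proof -
  have sub: "L -` cball 0 1 \<subseteq> cball 0 c"
  proof
    fix x assume "x \<in> L -` cball 0 1"
    then have "c * norm (L x) \<le> c * 1" using assms(1) by (intro mult_left_mono) auto
    with assms(2)[of x] show "x \<in> cball 0 c" by simp
  qed
  \<comment> \<open>Should the preimage fail to be measurable, its \<open>measure\<close> is 0 by
    convention.\<close>
  have "measure lborel (L -` cball 0 1) \<le> measure lborel (cball 0 c :: 'a set)"
  proof (cases "L -` cball 0 1 \<in> sets lborel")
    case True
    with sub show ?thesis
      using emeasure_bounded_finite[OF bounded_cball, of "0 :: 'a" c]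
      by (intro measure_mono_fmeasurable) (auto simp: fmeasurable_def)
  qed (simp add: measure_notin_sets)
  then show ?thesis
    using measure_cball_pos[of 1 "0 :: 'a"]
    by (simp add: preimage_factor_def measure_cball_0[OF assms(1)] pos_divide_le_eq)
qed

lemma preimage_factor_ge:
  fixes L :: "'a::euclidean_space \<Rightarrow> 'a"
  assumes "linear_bij L" "0 < c" "\<And>x. norm (L x) \<le> c * norm x"
  shows "1 / c ^ DIM('a) \<le> preimage_factor L"
proof -
  interpret linear_bij L by fact
  have sub: "cball 0 (1 / c) \<subseteq> L -` cball 0 1"
  proof
    fix x :: 'a assume "x \<in> cball 0 (1 / c)"
    then have "c * norm x \<le> 1" using assms(2) by (simp add: field_simps)
    with assms(3)[of x] show "x \<in> L -` cball 0 1" by simp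
  qed
  have "measure lborel (cball 0 (1 / c) :: 'a set) \<le> measure lborel (L -` cball 0 1)"
    using sub measurable_sets[OF borel_measurable, of "cball 0 1"] emeasure_preimage_cball
    by (intro measure_mono_fmeasurable) (auto simp: fmeasurable_def)
  then show ?thesis
    using measure_cball_pos[of 1 "0 :: 'a"] assms(2)
    by (simp add: preimage_factor_def measure_cball_0[of "1 / c"] pos_le_divide_eq power_one_over)
qed

lemma preimage_factor_pos:
  assumes "linear_bij L"
  shows "0 < preimage_factor L"
proof -
  interpret linear_bij L by fact
  obtain c where "0 < c" "\<And>x. norm (L x) \<le> c * norm x"
    using linear_bounded_pos[OF linear] by (auto simp: mult.commute)
  from preimage_factor_ge[OF assms this] show ?thesis
    using \<open>0 < c\<close> by (metis divide_pos_pos less_le_trans zero_less_one zero_less_power)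
qed

text \<open>A rotation reduces this to a coordinate direction.\<close>

lemma preimage_factor_stretch:
  fixes \<nu> :: "real ^ 'n"
  assumes h: "0 < h" and \<nu>: "norm \<nu> = 1"
  shows "linear_bij (\<lambda>x. x + ((h - 1) * (\<nu> \<bullet> x)) *\<^sub>R \<nu>)"
    and "preimage_factor (\<lambda>x. x + ((h - 1) * (\<nu> \<bullet> x)) *\<^sub>R \<nu>) = 1 / h"
proof -
  have lb: "linear_bij (\<lambda>x. x + ((h - 1) * (\<mu> \<bullet> x)) *\<^sub>R \<mu>)" (is "linear_bij ?D") if "norm \<mu> = 1" for \<mu> :: "real ^ 'n"
    unfolding linear_bij_def
  proof (intro conjI)
    show lin: "linear ?D"
      by (rule linearI) (simp_all add: inner_add_right algebra_simps)
    have "\<mu> \<bullet> \<mu> = 1" using that by (simp add: dot_square_norm)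
    then have "\<mu> \<bullet> ?D x = h * (\<mu> \<bullet> x)" for x
      by (simp add: inner_add_right algebra_simps)
    then have "inj ?D"
      unfolding linear_injective_0[OF lin] using h
      by (metis add_cancel_left_right inner_zero_right less_irrefl mult_eq_0_iff mult_zero_right pth_4(1))
    then show "bij ?D"
      using linear_injective_imp_surjective[OF lin] by (simp add: bij_def)
  qed
  show "linear_bij (\<lambda>x. x + ((h - 1) * (\<nu> \<bullet> x)) *\<^sub>R \<nu>)"
    by (rule lb[OF \<nu>])
  define b :: "real ^ 'n" where "b = axis undefined 1"
  have b: "b \<in> Basis" "norm b = 1"
    by (auto simp: b_def norm_axis_1 axis_in_Basis_iff)
  obtain R :: "real ^ 'n \<Rightarrow> real ^ 'n" where R: "orthogonal_transformation R" "R b = \<nu>"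
    using orthogonal_transformation_exists_1[OF b(2) \<nu>] by blast
  have Rlb: "linear_bij R"
    using R(1) by (simp add: linear_bij_def orthogonal_transformation_linear orthogonal_transformation_bij)
  \<comment> \<open>An isometry satisfies both two-sided bounds with c = 1.\<close>
  have R1: "preimage_factor R = 1"
  proof (rule antisym)
    show "preimage_factor R \<le> 1"
      using preimage_factor_le[of 1 R] R(1) by (simp add: orthogonal_transformation_norm)
    show "1 \<le> preimage_factor R"
      using preimage_factor_ge[OF Rlb, of 1] R(1) by (simp add: orthogonal_transformation_norm)
  qed
  let ?D = "\<lambda>x. x + ((h - 1) * (\<nu> \<bullet> x)) *\<^sub>R \<nu>" and ?Db = "\<lambda>x. x + ((h - 1) * (b \<bullet> x)) *\<^sub>R b"
  have "?D (R x) = R (?Db x)" for x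
  proof -
    have "\<nu> \<bullet> R x = b \<bullet> x"
      unfolding R(2)[symmetric] using R(1) by (simp add: orthogonal_transformation_def)
    then show ?thesis
      using orthogonal_transformation_linear[OF R(1)] by (simp add: linear_add linear_scale R(2))
  qed
  then have "preimage_factor (\<lambda>x. ?D (R x)) = preimage_factor (\<lambda>x. R (?Db x))"
    by simp
  then have "preimage_factor ?D = preimage_factor ?Db"
    using preimage_factor_compose[OF lb[OF \<nu>] Rlb] preimage_factor_compose[OF Rlb lb[OF b(2)]] R1 by simp
  also have "\<dots> = 1 / (\<Prod>j\<in>Basis. \<bar>if j = b then h else 1\<bar>)"
  proof (rule preimage_factor_diagonal[OF _ _ lb[OF b(2)]])
    fix x :: "real ^ 'n"
    have "(\<Sum>j\<in>Basis. ((if j = b then h else 1) * (x \<bullet> j)) *\<^sub>R j)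
        = (\<Sum>j\<in>Basis. (x \<bullet> j) *\<^sub>R j + (if j = b then ((h - 1) * (b \<bullet> x)) *\<^sub>R b else 0))"
      by (intro sum.cong) (auto simp: algebra_simps inner_commute)
    also have "\<dots> = ?Db x"
      using b(1) by (simp add: sum.distrib euclidean_representation)
    finally show "?Db x = (\<Sum>j\<in>Basis. ((if j = b then h else 1) * (x \<bullet> j)) *\<^sub>R j)" ..
  qed (use h in auto)
  also have "(\<Prod>j\<in>Basis. \<bar>if j = b then h else 1\<bar>) = (\<Prod>j\<in>Basis. if j = b then h else 1)"
    using h by (intro prod.cong) auto
  also have "\<dots> = h"
    using b(1) by simp
  finally show "preimage_factor ?D = 1 / h" .
qed


section \<open>The space of square integrable forms\<close>

definition square_integrable :: "'n::{finite,linorder} pt set \<Rightarrow> 'n dform set" where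
  "square_integrable S = {v. v \<in> borel_measurable (lebesgue_on S) \<and> integrable (lebesgue_on S) (\<lambda>x. (norm (v x))\<^sup>2)}"

lemma square_integrable_inner:
  assumes "v \<in> square_integrable S" "w \<in> square_integrable S"
  shows "integrable (lebesgue_on S) (\<lambda>x. v x \<bullet> w x)"
proof (rule Bochner_Integration.integrable_bound)
  show "integrable (lebesgue_on S) (\<lambda>x. (norm (v x))\<^sup>2 + (norm (w x))\<^sup>2)"
    using assms by (simp add: square_integrable_def)
  show "(\<lambda>x. v x \<bullet> w x) \<in> borel_measurable (lebesgue_on S)"
    using assms by (intro borel_measurable_inner) (auto simp: square_integrable_def)
  have "\<bar>v x \<bullet> w x\<bar> \<le> (norm (v x))\<^sup>2 + (norm (w x))\<^sup>2" for x
  proof -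
    have "0 \<le> (norm (v x) - norm (w x))\<^sup>2 + ((norm (v x))\<^sup>2 + (norm (w x))\<^sup>2)" by simp
    then have "norm (v x) * norm (w x) \<le> (norm (v x))\<^sup>2 + (norm (w x))\<^sup>2"
      by (simp add: power2_eq_square algebra_simps)
    with Cauchy_Schwarz_ineq2[of "v x" "w x"] show ?thesis by simp
  qed
  then show "AE x in lebesgue_on S. norm (v x \<bullet> w x) \<le> norm ((norm (v x))\<^sup>2 + (norm (w x))\<^sup>2)"
    by simp
qed

lemma subspace_square_integrable: "subspace (square_integrable S)"
proof (rule subspaceI)
  fix v w :: "'a dform" assume vw: "v \<in> square_integrable S" "w \<in> square_integrable S"
  have "integrable (lebesgue_on S) (\<lambda>x. (norm (v x))\<^sup>2 + 2 * (v x \<bullet> w x) + (norm (w x))\<^sup>2)"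
    using vw square_integrable_inner[OF vw] by (auto simp: square_integrable_def)
  then have "integrable (lebesgue_on S) (\<lambda>x. (norm (v x + w x))\<^sup>2)"
    by (simp add: power2_norm_eq_inner inner_add_left inner_add_right inner_commute algebra_simps)
  then show "v + w \<in> square_integrable S"
    using vw by (auto simp: square_integrable_def plus_fun_def intro: borel_measurable_add)
qed (auto simp: square_integrable_def power_mult_distrib zero_fun_def scaleR_fun_def)

lemma semi_inner_L2: "semi_inner (square_integrable S) (L2_inner S)"
  by unfold_locales
    (auto simp: L2_inner_eq subspace_square_integrable inner_add_left square_integrable_inner
      intro!: Bochner_Integration.integral_nonneg Bochner_Integration.integral_cong inner_commute)

context semi_inner
begin

lemma norm_scale: "x \<in> W \<Longrightarrow> sqrt (s (c *\<^sub>R x) (c *\<^sub>R x)) = \<bar>c\<bar> * sqrt (s x x)"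
proof -
  assume x: "x \<in> W"
  have "s (c *\<^sub>R x) (c *\<^sub>R x) = c\<^sup>2 * s x x"
    using x mem(2)[OF x, of c] by (simp add: scale_left commute[of x "c *\<^sub>R x"] power2_eq_square)
  then show ?thesis by (simp add: real_sqrt_mult)
qed

lemma norm_triangle:
  assumes "x \<in> W" "y \<in> W"
  shows "sqrt (s (x + y) (x + y)) \<le> sqrt (s x x) + sqrt (s y y)"
proof (rule real_le_lsqrt)
  have xy: "x + y \<in> W" by (rule mem(1)[OF assms])
  have "s (x + y) (x + y) = s x x + 2 * s x y + s y y"
    using assms xy by (simp add: add_left commute[of x "x + y"] commute[of y "x + y"] commute[of y x])
  also have "\<dots> \<le> s x x + 2 * (sqrt (s x x) * sqrt (s y y)) + s y y"
    using Cauchy_Schwarz[OF assms] by simp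
  also have "\<dots> = (sqrt (s x x) + sqrt (s y y))\<^sup>2"
    using nonneg assms by (simp add: power2_sum)
  finally show "s (x + y) (x + y) \<le> (sqrt (s x x) + sqrt (s y y))\<^sup>2" .
qed (use nonneg assms in simp)

lemma subset: "W' \<subseteq> W \<Longrightarrow> Real_Vector_Spaces.subspace W' \<Longrightarrow> semi_inner W' s"
  by unfold_locales (auto simp: add_left scale_left commute nonneg subset_iff)

end


section \<open>Integration over facets\<close>

text \<open>\<open>facet_normal\<close> is a choice, so a unit normal has to be exhibited first: a
  set of dimension n - 1 lies in some hyperplane. Comparing dimensions then identifies the affine
  hull with the hyperplane of the chosen normal.\<close>

lemma facet_hyperplane:
  fixes K :: "'n::finite pt set"
  assumes "F facet_of K" "aff_dim K = int CARD('n)"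
  obtains \<beta> where "norm (facet_normal F) = 1" "affine hull F = {x. facet_normal F \<bullet> x = \<beta>}"
proof -
  have F: "F \<noteq> {}" "aff_dim F = int CARD('n) - 1"
    using assms by (auto simp: facet_of_def)
  then obtain a b where ab: "a \<noteq> 0" "F \<subseteq> {x. a \<bullet> x = b}"
    using aff_lowdim_subset_hyperplane[of F] by auto
  let ?P = "\<lambda>\<nu> :: 'n pt. norm \<nu> = 1 \<and> (\<forall>x\<in>F. \<forall>y\<in>F. (x - y) \<bullet> \<nu> = 0)"
  have "?P (a /\<^sub>R norm a)"
    using ab by (auto simp: inner_diff_right inner_commute[of _ a] subset_iff)
  then have \<nu>: "?P (facet_normal F)"
    unfolding facet_normal_def by (rule someI)
  obtain x0 where x0: "x0 \<in> F" using F(1) by blast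
  define \<beta> where "\<beta> = facet_normal F \<bullet> x0"
  have sub: "F \<subseteq> {x. facet_normal F \<bullet> x = \<beta>}"
  proof
    fix x assume "x \<in> F"
    then have "(x - x0) \<bullet> facet_normal F = 0" using \<nu> x0 by blast
    then show "x \<in> {x. facet_normal F \<bullet> x = \<beta>}"
      by (simp add: \<beta>_def inner_diff_left inner_commute[of "facet_normal F"])
  qed
  have "affine hull F = {x. facet_normal F \<bullet> x = \<beta>}"
  proof (rule affine_dim_equal)
    show "affine hull F \<subseteq> {x. facet_normal F \<bullet> x = \<beta>}"
      using sub by (intro hull_minimal affine_hyperplane)
    have "facet_normal F \<noteq> 0" using \<nu> by force
    then show "aff_dim (affine hull F) = aff_dim {x. facet_normal F \<bullet> x = \<beta>}"
      using F(2) by (simp add: aff_dim_hyperplane)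
  qed (use F(1) in \<open>auto intro: affine_hyperplane\<close>)
  with \<nu> that show ?thesis by blast
qed

lemma closest_point_hyperplane:
  fixes \<nu> :: "'a::euclidean_space"
  assumes "norm \<nu> = 1"
  shows "closest_point {x. \<nu> \<bullet> x = \<beta>} x = x - (\<nu> \<bullet> x - \<beta>) *\<^sub>R \<nu>"
proof (rule closest_point_unique[symmetric])
  have 1: "\<nu> \<bullet> \<nu> = 1" using assms by (simp add: dot_square_norm)
  then show "x - (\<nu> \<bullet> x - \<beta>) *\<^sub>R \<nu> \<in> {x. \<nu> \<bullet> x = \<beta>}"
    by (simp add: inner_diff_right)
  show "\<forall>z\<in>{x. \<nu> \<bullet> x = \<beta>}. dist x (x - (\<nu> \<bullet> x - \<beta>) *\<^sub>R \<nu>) \<le> dist x z"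
  proof
    fix z assume "z \<in> {x. \<nu> \<bullet> x = \<beta>}"
    then have "\<bar>\<nu> \<bullet> x - \<beta>\<bar> = \<bar>\<nu> \<bullet> (x - z)\<bar>" by (simp add: inner_diff_right)
    also have "\<dots> \<le> norm \<nu> * norm (x - z)" by (rule Cauchy_Schwarz_ineq2)
    finally show "dist x (x - (\<nu> \<bullet> x - \<beta>) *\<^sub>R \<nu>) \<le> dist x z"
      using assms by (simp add: dist_norm)
  qed
qed (auto intro: convex_hyperplane closed_hyperplane)

definition prism :: "'n::finite pt set \<Rightarrow> 'n pt set" where
  "prism F = {x + t *\<^sub>R facet_normal F |x t. x \<in> F \<and> 0 \<le> t \<and> t \<le> 1}"

lemma compact_prism:
  assumes "compact F"
  shows "compact (prism F)"
proof -
  have "prism F = (\<lambda>(x, t). x + t *\<^sub>R facet_normal F) ` (F \<times> {0..1})"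
    by (force simp: prism_def)
  moreover have "continuous_on (F \<times> {0..1}) (\<lambda>(x, t). x + t *\<^sub>R facet_normal F)"
    by (auto simp: case_prod_unfold intro!: continuous_intros)
  ultimately show ?thesis
    using assms by (simp add: compact_Times compact_continuous_image)
qed

lemma continuous_on_closest_point_hull:
  fixes F :: "'n::finite pt set"
  assumes "F \<noteq> {}"
  shows "continuous_on UNIV (closest_point (affine hull F))"
  using assms by (intro continuous_on_closest_point) (auto simp: affine_imp_convex closed_affine_hull)

lemma measurable_closest_point:
  fixes F :: "'n::finite pt set"
  assumes "F \<noteq> {}"
  shows "closest_point (affine hull F) \<in> measurable (lebesgue_on S) borel"
  by (intro measurable_restrict_space1 measurable_completion borel_measurable_continuous_onI[OF continuous_on_closest_point_hull[OF assms]])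
    (simp add: borel_measurable_continuous_onI[OF continuous_on_closest_point_hull[OF assms]])

text \<open>Expresses a surface integral as a volume integral over the prism, to which the linear
  change of variables applies.\<close>

lemma nn_integral_facet_measure:
  fixes F :: "'n::finite pt set"
  assumes F: "compact F" "F \<noteq> {}" and g: "g \<in> borel_measurable borel"
  shows "(\<integral>\<^sup>+x. g x \<partial>facet_measure F)
    = (\<integral>\<^sup>+x. indicator (prism F) x * g (closest_point (affine hull F) x) \<partial>lborel)"
proof -
  have P: "prism F \<in> sets borel"
    using compact_prism[OF F(1)] by (rule borel_compact)
  have meas: "(\<lambda>x. g (closest_point (affine hull F) x)) \<in> borel_measurable borel"
    by (rule measurable_compose[OF _ g])
      (rule borel_measurable_continuous_onI[OF continuous_on_closest_point_hull[OF F(2)]])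
  have "(\<integral>\<^sup>+x. g x \<partial>facet_measure F) = (\<integral>\<^sup>+x. g (closest_point (affine hull F) x) \<partial>lebesgue_on (prism F))"
    unfolding facet_measure_def prism_def[symmetric]
    using measurable_closest_point[OF F(2)] g by (simp add: nn_integral_distr)
  also have "\<dots> = (\<integral>\<^sup>+x. g (closest_point (affine hull F) x) * indicator (prism F) x \<partial>lebesgue)"
    using P by (intro nn_integral_restrict_space) auto
  also have "\<dots> = (\<integral>\<^sup>+x. g (closest_point (affine hull F) x) * indicator (prism F) x \<partial>lborel)"
    by (rule nn_integral_completion)
  finally show ?thesis by (simp add: mult.commute)
qed

lemma integrable_facet_measure:
  fixes F :: "'n::finite pt set" and g :: "'n pt \<Rightarrow> real"
  assumes F: "compact F" "F \<noteq> {}" and g: "continuous_on UNIV g"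
  shows "integrable (facet_measure F) g"
proof -
  have P: "prism F \<in> sets borel"
    using compact_prism[OF F(1)] by (rule borel_compact)
  have "continuous_on UNIV (\<lambda>x. g (closest_point (affine hull F) x))"
    using continuous_on_compose2[OF g continuous_on_closest_point_hull[OF F(2)]] by simp
  then have i: "integrable lborel (\<lambda>x. indicator (prism F) x *\<^sub>R g (closest_point (affine hull F) x))"
    by (intro borel_integrable_compact compact_prism F) (auto intro: continuous_on_subset)
  then have "integrable lebesgue (\<lambda>x. indicator (prism F) x *\<^sub>R g (closest_point (affine hull F) x))"
    by (rule integrable_completion[OF borel_measurable_integrable[OF i], THEN iffD2])
  then have "integrable (lebesgue_on (prism F)) (\<lambda>x. g (closest_point (affine hull F) x))"
    using P by (subst integrable_restrict_space) auto
  then show ?thesis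
    unfolding facet_measure_def prism_def[symmetric]
    by (subst integrable_distr_eq[OF measurable_closest_point[OF F(2)]])
      (auto intro: borel_measurable_continuous_onI g)
qed

text \<open>The map acts like M on the hyperplane orthogonal to \<mu> and sends \<mu> to \<nu>. It
  is injective because the \<nu>-component of the image recovers that of x along \<mu>, and M is
  injective on the rest.\<close>

lemma linear_bij_frame:
  fixes M :: "'n::finite pt \<Rightarrow> 'n pt"
  assumes M: "linear_bij M" and \<nu>: "norm \<nu> = 1" "norm \<mu> = 1"
    and tangent: "\<And>v. \<mu> \<bullet> v = 0 \<Longrightarrow> \<nu> \<bullet> M v = 0"
  shows "linear_bij (\<lambda>x. M (x - (\<mu> \<bullet> x) *\<^sub>R \<mu>) + (\<mu> \<bullet> x) *\<^sub>R \<nu>)" (is "linear_bij ?G")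
    and "\<And>x. \<nu> \<bullet> (M (x - (\<mu> \<bullet> x) *\<^sub>R \<mu>) + (\<mu> \<bullet> x) *\<^sub>R \<nu>) = \<mu> \<bullet> x"
proof -
  interpret linear_bij M by fact
  have 1: "\<nu> \<bullet> \<nu> = 1" "\<mu> \<bullet> \<mu> = 1" using \<nu> by (simp_all add: dot_square_norm)
  show \<nu>G: "\<nu> \<bullet> ?G x = \<mu> \<bullet> x" for x
    using tangent[of "x - (\<mu> \<bullet> x) *\<^sub>R \<mu>"] by (simp add: 1 inner_add_right inner_diff_right)
  have lin: "linear ?G"
  proof (rule linearI)
    fix x y
    have "x + y - (\<mu> \<bullet> (x + y)) *\<^sub>R \<mu> = (x - (\<mu> \<bullet> x) *\<^sub>R \<mu>) + (y - (\<mu> \<bullet> y) *\<^sub>R \<mu>)"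
      by (simp add: inner_add_right algebra_simps)
    then show "?G (x + y) = ?G x + ?G y"
      by (simp only: linear_add[OF linear] inner_add_right scaleR_add_left) (simp add: algebra_simps)
  next
    fix c x
    have "c *\<^sub>R x - (\<mu> \<bullet> (c *\<^sub>R x)) *\<^sub>R \<mu> = c *\<^sub>R (x - (\<mu> \<bullet> x) *\<^sub>R \<mu>)"
      by (simp add: algebra_simps)
    then show "?G (c *\<^sub>R x) = c *\<^sub>R ?G x"
      by (simp only: linear_scale[OF linear] inner_scaleR_right) (simp add: algebra_simps)
  qed
  have "x = 0" if "?G x = 0" for x
  proof -
    have "\<mu> \<bullet> x = 0" using \<nu>G[of x] that by simp
    with that have "M x = 0" by simp
    then have "M x = M 0" by (simp add: linear_0[OF linear])
    then show ?thesis using bij by (metis bij_is_inj injD)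
  qed
  then have "inj ?G"
    using linear_injective_0[OF lin] by blast
  then show "linear_bij ?G"
    using lin linear_injective_imp_surjective[OF lin] by (simp add: linear_bij_def bij_def)
qed

locale facet_map = linear_bij L for L :: "'n::finite pt \<Rightarrow> 'n pt" +
  fixes b :: "'n pt" and E :: "'n pt set" and \<alpha> \<beta> :: real
  assumes E: "compact E" "E \<noteq> {}"
    and normal: "norm (facet_normal E) = 1" "norm (facet_normal ((\<lambda>x. L x + b) ` E)) = 1"
    and hull: "affine hull E = {x. facet_normal E \<bullet> x = \<alpha>}"
      "affine hull ((\<lambda>x. L x + b) ` E) = {x. facet_normal ((\<lambda>x. L x + b) ` E) \<bullet> x = \<beta>}"
begin

abbreviation "F \<equiv> (\<lambda>x. L x + b) ` E"
abbreviation "\<mu> \<equiv> facet_normal E"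
abbreviation "\<nu> \<equiv> facet_normal F"

lemma F: "compact F" "F \<noteq> {}"
  using E by (auto intro!: compact_continuous_image continuous_intros continuous)

lemma normal_sq: "\<mu> \<bullet> \<mu> = 1" "\<nu> \<bullet> \<nu> = 1"
  using normal by (simp_all add: dot_square_norm)

lemma hull_image: "affine hull F = (\<lambda>x. L x + b) ` (affine hull E)"
proof -
  have "affine hull F = affine hull ((\<lambda>x. b + x) ` L ` E)"
    by (simp add: image_image add.commute)
  also have "\<dots> = (\<lambda>x. b + x) ` L ` (affine hull E)"
    using linear by (simp add: affine_hull_translation affine_hull_linear_image linear_conv_bounded_linear)
  finally show ?thesis by (simp add: image_image add.commute)
qed

text \<open>Under L the hyperplanes correspond, but in general not their normals; membership of a
  and a + v in the affine hulls relates the tangent directions.\<close>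

lemma tangent_iff: "\<nu> \<bullet> L v = 0 \<longleftrightarrow> \<mu> \<bullet> v = 0"
proof -
  obtain a where a: "a \<in> E" using E(2) by blast
  have aE: "a \<in> affine hull E" by (rule hull_inc[OF a])
  then have Ta: "L a + b \<in> affine hull F" by (auto simp: hull_image)
  have "L (a + v) + b \<in> affine hull F \<longleftrightarrow> a + v \<in> affine hull E"
    unfolding hull_image using bij_is_inj[OF bij] by (auto simp: inj_eq)
  moreover have "L (a + v) + b \<in> affine hull F \<longleftrightarrow> \<nu> \<bullet> L v = 0"
    using Ta unfolding hull(2) by (auto simp: linear_add[OF linear] inner_add_right)
  moreover have "a + v \<in> affine hull E \<longleftrightarrow> \<mu> \<bullet> v = 0"
    using aE unfolding hull(1) by (simp add: inner_add_right)
  ultimately show ?thesis by blast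
qed

text \<open>Agrees with L along the facet but sends unit normal to unit normal, so that prisms of
  height one correspond; L itself may tilt and stretch them.\<close>

definition "frame x = L (x - (\<mu> \<bullet> x) *\<^sub>R \<mu>) + (\<mu> \<bullet> x) *\<^sub>R \<nu>"

lemma frame: "linear_bij frame" "\<nu> \<bullet> frame x = \<mu> \<bullet> x"
proof -
  have t: "\<And>v. \<mu> \<bullet> v = 0 \<Longrightarrow> \<nu> \<bullet> L v = 0" by (simp add: tangent_iff)
  show "linear_bij frame" "\<nu> \<bullet> frame x = \<mu> \<bullet> x"
    using linear_bij_frame[OF linear_bij_axioms normal(2,1) t] by (auto simp: frame_def[abs_def])
qed

text \<open>The constant for which \<open>frame x + shift\<close> and \<open>L x + b\<close>
  coincide on the hyperplane of E.\<close>

definition "shift = b + \<alpha> *\<^sub>R L \<mu> - \<alpha> *\<^sub>R \<nu>"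

lemma frame_add_normal:
  assumes "\<mu> \<bullet> x = \<alpha>"
  shows "frame (x + t *\<^sub>R \<mu>) + shift = L x + b + t *\<^sub>R \<nu>"
proof -
  have "x + t *\<^sub>R \<mu> - (\<mu> \<bullet> (x + t *\<^sub>R \<mu>)) *\<^sub>R \<mu> = x - \<alpha> *\<^sub>R \<mu>"
    using assms by (simp add: inner_add_right normal_sq algebra_simps)
  then show ?thesis
    using assms by (simp add: frame_def shift_def linear_diff[OF linear] linear_scale[OF linear]
        inner_add_right normal_sq algebra_simps)
qed

lemma closest_point_E: "closest_point (affine hull E) x = x - (\<mu> \<bullet> x - \<alpha>) *\<^sub>R \<mu>"
  unfolding hull(1) by (rule closest_point_hyperplane[OF normal(1)])

lemma closest_point_F: "closest_point (affine hull F) x = x - (\<nu> \<bullet> x - \<beta>) *\<^sub>R \<nu>"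
  unfolding hull(2) by (rule closest_point_hyperplane[OF normal(2)])

text \<open>Since normals are carried to normals, the orthogonal projections onto the two
  hyperplanes correspond under the frame map, which they need not do under L.\<close>

lemma closest_point_frame:
  "closest_point (affine hull F) (frame x + shift) = L (closest_point (affine hull E) x) + b"
proof -
  let ?y = "closest_point (affine hull E) x"
  have y: "\<mu> \<bullet> ?y = \<alpha>"
    unfolding closest_point_E by (simp add: inner_diff_right normal_sq)
  then have "?y \<in> affine hull E" by (simp add: hull(1))
  then have Ty: "\<nu> \<bullet> (L ?y + b) = \<beta>"
    using hull_image hull(2) by blast
  have x: "x = ?y + (\<mu> \<bullet> x - \<alpha>) *\<^sub>R \<mu>"
    unfolding closest_point_E by simp
  have eq: "frame x + shift = L ?y + b + (\<mu> \<bullet> x - \<alpha>) *\<^sub>R \<nu>"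
    using frame_add_normal[OF y, of "\<mu> \<bullet> x - \<alpha>"] x by simp
  show ?thesis
    unfolding closest_point_F eq using Ty by (simp add: inner_add_right normal_sq)
qed

lemma prism_frame: "frame x + shift \<in> prism F \<longleftrightarrow> x \<in> prism E"
proof
  assume "x \<in> prism E"
  then obtain y t where y: "x = y + t *\<^sub>R \<mu>" "y \<in> E" "0 \<le> t" "t \<le> 1"
    by (auto simp: prism_def)
  then have "\<mu> \<bullet> y = \<alpha>" using hull(1) hull_inc[of y E] by blast
  from frame_add_normal[OF this, of t] y show "frame x + shift \<in> prism F"
    unfolding prism_def by blast
next
  assume "frame x + shift \<in> prism F"
  then obtain y t where y: "frame x + shift = L y + b + t *\<^sub>R \<nu>" "y \<in> E" "0 \<le> t" "t \<le> 1"
    by (auto simp: prism_def)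
  then have "\<mu> \<bullet> y = \<alpha>" using hull(1) hull_inc[of y E] by blast
  from frame_add_normal[OF this, of t] y(1) have "frame x = frame (y + t *\<^sub>R \<mu>)"
    by (metis add_right_cancel)
  then have "x = y + t *\<^sub>R \<mu>"
    using frame(1) unfolding linear_bij_def by (metis bij_is_inj injD)
  with y show "x \<in> prism E"
    unfolding prism_def by blast
qed

lemma nn_integral_facet:
  assumes g: "g \<in> borel_measurable borel"
  shows "(\<integral>\<^sup>+x. g (L x + b) \<partial>facet_measure E)
    = ennreal (preimage_factor frame) * (\<integral>\<^sup>+x. g x \<partial>facet_measure F)"
proof -
  interpret fr: linear_bij frame by (rule frame)
  have PF: "prism F \<in> sets borel"
    using compact_prism[OF F(1)] by (rule borel_compact)
  have gT: "(\<lambda>x. g (L x + b)) \<in> borel_measurable borel"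
    using g by measurable
  have cp: "closest_point (affine hull F) \<in> borel_measurable borel"
    by (rule borel_measurable_continuous_onI[OF continuous_on_closest_point_hull[OF F(2)]])
  have meas: "(\<lambda>x. indicator (prism F) x * g (closest_point (affine hull F) x)) \<in> borel_measurable borel"
    using PF measurable_compose[OF cp g] by (intro borel_measurable_times_ennreal) auto
  have "(\<integral>\<^sup>+x. g (L x + b) \<partial>facet_measure E)
      = (\<integral>\<^sup>+x. indicator (prism E) x * g (L (closest_point (affine hull E) x) + b) \<partial>lborel)"
    by (rule nn_integral_facet_measure[OF E gT])
  also have "\<dots> = (\<integral>\<^sup>+x. indicator (prism F) (frame x + shift)
      * g (closest_point (affine hull F) (frame x + shift)) \<partial>lborel)"
    by (simp add: closest_point_frame prism_frame indicator_def)
  also have "\<dots> = ennreal (preimage_factor frame)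
      * (\<integral>\<^sup>+x. indicator (prism F) x * g (closest_point (affine hull F) x) \<partial>lborel)"
    by (rule fr.nn_integral_affine[OF meas])
  also have "(\<integral>\<^sup>+x. indicator (prism F) x * g (closest_point (affine hull F) x) \<partial>lborel)
      = (\<integral>\<^sup>+x. g x \<partial>facet_measure F)"
    by (rule nn_integral_facet_measure[OF F g, symmetric])
  finally show ?thesis .
qed

lemma integral_facet:
  assumes g: "g \<in> borel_measurable borel" "\<And>x. 0 \<le> g x"
  shows "(LINT x|facet_measure E. g (L x + b)) = preimage_factor frame * (LINT x|facet_measure F. g x)"
proof -
  have sets: "sets (facet_measure S) = sets borel" for S :: "'n pt set"
    by (simp add: facet_measure_def)
  have m: "f \<in> borel_measurable (facet_measure S)" if "f \<in> borel_measurable borel" for f :: "'n pt \<Rightarrow> real" and S :: "'n pt set"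
    using that measurable_cong_sets[OF sets refl] by blast
  have "(LINT x|facet_measure E. g (L x + b)) = enn2real (\<integral>\<^sup>+x. ennreal (g (L x + b)) \<partial>facet_measure E)"
    using g by (intro integral_eq_nn_integral m) auto
  also have "(\<integral>\<^sup>+x. ennreal (g (L x + b)) \<partial>facet_measure E)
      = ennreal (preimage_factor frame) * (\<integral>\<^sup>+x. ennreal (g x) \<partial>facet_measure F)"
    using g by (intro nn_integral_facet) auto
  also have "enn2real \<dots> = preimage_factor frame * enn2real (\<integral>\<^sup>+x. ennreal (g x) \<partial>facet_measure F)"
    by (simp add: enn2real_mult preimage_factor_nonneg)
  also have "enn2real (\<integral>\<^sup>+x. ennreal (g x) \<partial>facet_measure F) = (LINT x|facet_measure F. g x)"
    using g by (intro integral_eq_nn_integral[symmetric] m) auto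
  finally show ?thesis .
qed

text \<open>The frame map scales the tangential directions like \<open>L\<close> but preserves the length of the normal,
  so its factor differs from the one of \<open>L\<close> by one power of \<open>h\<close>.\<close>

lemma preimage_factor_frame_le:
  assumes L: "L = (\<lambda>x. h *\<^sub>R M x)" and h: "0 < h" and M: "linear_bij M"
    and B: "0 < B" "\<And>x. norm (M x) \<le> B * norm x" "\<And>x. norm x \<le> B * norm (M x)"
  shows "preimage_factor frame \<le> (B + 1) ^ CARD('n) * B ^ CARD('n) * h * preimage_factor L"
proof -
  interpret M: linear_bij M by fact
  let ?n = "CARD('n)"
  \<comment> \<open>D stretches the normal direction by h. Composed with it, the frame map of L
    becomes h times the frame map G of M, and G is bounded from below in terms of B alone.\<close>
  define D where "D x = x + ((h - 1) * (\<mu> \<bullet> x)) *\<^sub>R \<mu>" for x :: "'n pt"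
  define G where "G x = M (x - (\<mu> \<bullet> x) *\<^sub>R \<mu>) + (\<mu> \<bullet> x) *\<^sub>R \<nu>" for x
  have D: "linear_bij D" "preimage_factor D = 1 / h"
    using preimage_factor_stretch[OF h normal(1)] by (auto simp: D_def[abs_def])
  have tangent: "\<mu> \<bullet> v = 0 \<Longrightarrow> \<nu> \<bullet> M v = 0" for v
    using tangent_iff[of v] h by (simp add: L)
  have G: "linear_bij G" "\<nu> \<bullet> G x = \<mu> \<bullet> x" for x
    using linear_bij_frame[OF M normal(2,1) tangent] by (auto simp: G_def[abs_def])
  have "frame (D x) = h *\<^sub>R G x" for x
  proof -
    have \<mu>D: "\<mu> \<bullet> D x = h * (\<mu> \<bullet> x)"
      by (simp add: D_def inner_add_right normal_sq algebra_simps)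
    then have D_tan: "D x - (\<mu> \<bullet> D x) *\<^sub>R \<mu> = x - (\<mu> \<bullet> x) *\<^sub>R \<mu>"
      by (simp add: D_def algebra_simps)
    then show ?thesis
      unfolding frame_def D_tan unfolding G_def \<mu>D by (simp add: L algebra_simps)
  qed
  then have "preimage_factor (\<lambda>x. frame (D x)) = preimage_factor (\<lambda>x. h *\<^sub>R G x)"
    by simp
  then have 1: "preimage_factor frame * (1 / h) = 1 / h ^ ?n * preimage_factor G"
    using preimage_factor_compose[OF frame(1) D(1)] preimage_factor_compose[OF linear_bij_scale G(1), of h]
      D(2) preimage_factor_scale[OF h, where 'a = "'n pt"] h by simp
  have "preimage_factor (\<lambda>x. h *\<^sub>R M x) = 1 / h ^ ?n * preimage_factor M"
    using preimage_factor_compose[OF linear_bij_scale M, of h] preimage_factor_scale[OF h, where 'a = "'n pt"] h by simp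
  then have 2: "preimage_factor L = 1 / h ^ ?n * preimage_factor M"
    by (simp add: L)
  have "norm x \<le> (B + 1) * norm (G x)" for x
  proof -
    let ?t = "x - (\<mu> \<bullet> x) *\<^sub>R \<mu>"
    have s: "\<bar>\<mu> \<bullet> x\<bar> \<le> norm (G x)"
      using Cauchy_Schwarz_ineq2[of \<nu> "G x"] normal(2) G(2)[of x] by simp
    \<comment> \<open>The tangential image is orthogonal to \<nu>, so by Pythagoras both components
      of G x are at most as long as G x.\<close>
    have "orthogonal (M ?t) ((\<mu> \<bullet> x) *\<^sub>R \<nu>)"
      using tangent[of ?t] by (simp add: orthogonal_def inner_commute inner_diff_right normal_sq)
    then have "(norm (G x))\<^sup>2 = (norm (M ?t))\<^sup>2 + (norm ((\<mu> \<bullet> x) *\<^sub>R \<nu>))\<^sup>2"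
      unfolding G_def by (rule norm_add_Pythagorean)
    then have "(norm (M ?t))\<^sup>2 \<le> (norm (G x))\<^sup>2" by simp
    then have Mt: "norm (M ?t) \<le> norm (G x)" by (simp add: power2_le_iff_abs_le)
    have "norm x = norm (?t + (\<mu> \<bullet> x) *\<^sub>R \<mu>)" by simp
    also have "\<dots> \<le> norm ?t + \<bar>\<mu> \<bullet> x\<bar>"
      using norm_triangle_ineq[of ?t "(\<mu> \<bullet> x) *\<^sub>R \<mu>"] normal(1) by simp
    also have "\<dots> \<le> B * norm (M ?t) + norm (G x)"
      using B(3)[of ?t] s by (rule add_mono)
    also have "\<dots> \<le> B * norm (G x) + norm (G x)"
      using Mt B(1) by simp
    finally show ?thesis by (simp add: algebra_simps)
  qed
  then have G_le: "preimage_factor G \<le> (B + 1) ^ ?n"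
    using preimage_factor_le[of "B + 1" G] B(1) by simp
  have "1 / B ^ ?n \<le> preimage_factor M"
    using preimage_factor_ge[OF M B(1,2)] by simp
  then have M_ge: "1 \<le> B ^ ?n * preimage_factor M"
    using B(1) by (simp add: field_simps)
  have "preimage_factor frame = h * (1 / h ^ ?n) * preimage_factor G"
    using 1 h by (simp add: field_simps)
  also have "\<dots> \<le> h * (1 / h ^ ?n) * (B + 1) ^ ?n"
    using G_le h by (intro mult_left_mono) auto
  \<comment> \<open>Multiplying by a quantity that is at least 1 brings back the factor of M, and
    with it the volume factor of L.\<close>
  also have "\<dots> \<le> h * (1 / h ^ ?n) * (B + 1) ^ ?n * (B ^ ?n * preimage_factor M)"
    using mult_left_mono[OF M_ge, of "h * (1 / h ^ ?n) * (B + 1) ^ ?n"] h B(1) by simp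
  also have "\<dots> = (B + 1) ^ ?n * B ^ ?n * h * preimage_factor L"
    by (simp add: 2)
  finally show ?thesis .
qed

end

text \<open>M maps tangent vectors of E to tangent vectors of F, so the projection onto the latter
  may be inserted after M without effect. Hence only the tangential part of \<theta> enters.\<close>

lemma norm_tan_part_pullback_bound:
  assumes "0 \<le> B"
  obtains C where "0 \<le> C"
    "\<And>(M :: 'n::{finite,linorder} pt \<Rightarrow> 'n pt) E F \<theta>. linear M \<Longrightarrow> (\<And>x. norm (M x) \<le> B * norm x) \<Longrightarrow>
      norm (facet_normal E) = 1 \<Longrightarrow> (\<And>v. facet_normal E \<bullet> v = 0 \<Longrightarrow> facet_normal F \<bullet> M v = 0) \<Longrightarrow>
      norm (tan_part E (form_pullback M \<theta>)) \<le> C * norm (tan_part F \<theta>)"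
proof -
  \<comment> \<open>The factor 2 is a crude bound for the norm of the tangential projection that
    precedes M.\<close>
  obtain C where C: "0 \<le> C" "\<And>(M :: 'n pt \<Rightarrow> 'n pt) \<omega>. (\<And>x. norm (M x) \<le> 2 * B * norm x) \<Longrightarrow>
      norm (form_pullback M \<omega>) \<le> C * norm \<omega>"
    using norm_form_pullback_bound[of "2 * B"] assms by auto
  show ?thesis
  proof (rule that[OF C(1)])
    fix M :: "'n pt \<Rightarrow> 'n pt" and E F :: "'n pt set" and \<theta> :: "'n form"
    assume M: "linear M" "\<And>x. norm (M x) \<le> B * norm x"
      and E: "norm (facet_normal E) = 1" and tangent: "\<And>v. facet_normal E \<bullet> v = 0 \<Longrightarrow> facet_normal F \<bullet> M v = 0"
    define \<pi>E where "\<pi>E v = v - (v \<bullet> facet_normal E) *\<^sub>R facet_normal E" for v :: "'n pt"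
    define \<pi>F where "\<pi>F v = v - (v \<bullet> facet_normal F) *\<^sub>R facet_normal F" for v :: "'n pt"
    have lin: "linear \<pi>F"
      by (rule linearI) (simp_all add: \<pi>F_def inner_add_left algebra_simps)
    have "facet_normal E \<bullet> \<pi>E v = 0" for v
      using E by (simp add: \<pi>E_def inner_diff_right dot_square_norm inner_commute)
    then have "\<pi>F (M (\<pi>E v)) = M (\<pi>E v)" for v
      using tangent[of "\<pi>E v"] by (simp add: \<pi>F_def inner_commute)
    then have comp: "M \<circ> \<pi>E = \<pi>F \<circ> (M \<circ> \<pi>E)"
      by (simp add: fun_eq_iff)
    have "tan_part E (form_pullback M \<theta>) = form_pullback (M \<circ> \<pi>E) \<theta>"
      unfolding tan_part_def \<pi>E_def[abs_def, symmetric] by (rule form_pullback_compose[OF M(1)])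
    also have "\<dots> = form_pullback (M \<circ> \<pi>E) (form_pullback \<pi>F \<theta>)"
      by (subst comp) (rule form_pullback_compose[OF lin, symmetric])
    also have "form_pullback \<pi>F \<theta> = tan_part F \<theta>"
      by (simp add: tan_part_def \<pi>F_def[abs_def])
    finally have eq: "tan_part E (form_pullback M \<theta>) = form_pullback (M \<circ> \<pi>E) (tan_part F \<theta>)" .
    have "norm ((M \<circ> \<pi>E) x) \<le> 2 * B * norm x" for x
    proof -
      have "norm (\<pi>E x) \<le> norm x + norm ((x \<bullet> facet_normal E) *\<^sub>R facet_normal E)"
        unfolding \<pi>E_def by (rule norm_triangle_ineq4)
      also have "\<dots> \<le> 2 * norm x"
        using Cauchy_Schwarz_ineq2[of x "facet_normal E"] E by simp
      finally have "B * norm (\<pi>E x) \<le> B * (2 * norm x)"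
        using assms by (rule mult_left_mono)
      with M(2)[of "\<pi>E x"] show ?thesis by simp
    qed
    then show "norm (tan_part E (form_pullback M \<theta>)) \<le> C * norm (tan_part F \<theta>)"
      unfolding eq by (rule C(2))
  qed
qed


section \<open>Lifting tangential traces\<close>

text \<open>The boundary product regarded as a form on polynomial forms themselves: two forms with
  the same trace have distance 0, which replaces passing to a quotient by the kernel of the
  trace.\<close>

definition bd_form :: "'n pt set \<Rightarrow> 'n::{finite,linorder} dform \<Rightarrow> 'n dform \<Rightarrow> real" where
  "bd_form K v w = (\<Sum>F | F facet_of K. LINT x|facet_measure F. tan_part F (v x) \<bullet> tan_part F (w x))"

lemma bd_inner_tan_trace: "bd_inner K (tan_trace a) (tan_trace b) = bd_form K (a K) (b K)"
  by (simp add: bd_inner_def tan_trace_def bd_form_def)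

lemma linear_tan_part: "linear (tan_part F)"
  unfolding tan_part_def by (rule linear_form_pullback)

lemma facet_compact:
  assumes "polytope K" "F facet_of K"
  shows "compact F" "F \<noteq> {}"
  using assms face_of_polytope_polytope polytope_imp_compact by (auto simp: facet_of_def)

lemma continuous_on_linear_compose:
  assumes "continuous_on S f" "linear (T :: 'a::euclidean_space \<Rightarrow> 'b::real_normed_vector)"
  shows "continuous_on S (\<lambda>x. T (f x))"
  by (rule continuous_on_compose2[OF linear_continuous_on assms(1)])
    (use assms(2) in \<open>auto simp: linear_conv_bounded_linear\<close>)

lemma integrable_tan_part:
  assumes "polytope K" "F facet_of K" "continuous_on UNIV v" "continuous_on UNIV w"
  shows "integrable (facet_measure F) (\<lambda>x. tan_part F (v x) \<bullet> tan_part F (w x))"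
  by (rule integrable_facet_measure[OF facet_compact[OF assms(1,2)]
        continuous_on_inner[OF continuous_on_linear_compose[OF assms(3) linear_tan_part]
          continuous_on_linear_compose[OF assms(4) linear_tan_part]]])

lemma semi_inner_bd_form:
  assumes "polytope K"
  shows "semi_inner {v. continuous_on UNIV v} (bd_form K)"
proof
  show "subspace {v :: 'a dform. continuous_on UNIV v}"
    by (rule subspaceI) (auto simp: zero_fun_def plus_fun_def scaleR_fun_def intro!: continuous_intros)
next
  fix x y z :: "'a dform"
  assume "x \<in> {v. continuous_on UNIV v}" "y \<in> {v. continuous_on UNIV v}" "z \<in> {v. continuous_on UNIV v}"
  then show "bd_form K (x + y) z = bd_form K x z + bd_form K y z"
    unfolding bd_form_def sum.distrib[symmetric]
    by (intro sum.cong refl)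
      (simp add: linear_add[OF linear_tan_part] inner_add_left integrable_tan_part[OF assms])
next
  fix x z :: "'a dform" and c
  show "bd_form K (c *\<^sub>R x) z = c * bd_form K x z"
    unfolding bd_form_def sum_distrib_left
    by (intro sum.cong refl) (simp add: linear_scale[OF linear_tan_part])
next
  fix x y :: "'a dform"
  show "bd_form K x y = bd_form K y x"
    unfolding bd_form_def by (simp add: inner_commute)
  show "0 \<le> bd_form K x x"
    unfolding bd_form_def by (intro sum_nonneg Bochner_Integration.integral_nonneg) simp
qed

lemma poly_forms_continuous: "\<omega> \<in> poly_forms A j \<Longrightarrow> continuous_on S \<omega>"
  by (intro smooth_continuous_on poly_forms_smooth)

lemma semi_inner_bd_form_poly:
  "polytope K \<Longrightarrow> semi_inner (poly_forms A j) (bd_form K)"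
  by (rule semi_inner.subset[OF semi_inner_bd_form])
    (auto intro: poly_forms_continuous subspace_poly_forms)

section \<open>Continuous forms on compact sets and affine change of variables\<close>

lemma integrable_lebesgue_on_compact:
  fixes g :: "'a::euclidean_space \<Rightarrow> real"
  assumes "compact S" "continuous_on UNIV g"
  shows "integrable (lebesgue_on S) g"
proof -
  have S: "S \<in> sets borel" using assms(1) by (rule borel_compact)
  have i: "integrable lborel (\<lambda>x. indicator S x *\<^sub>R g x)"
    using assms by (intro borel_integrable_compact) (auto intro: continuous_on_subset)
  have "integrable lebesgue (\<lambda>x. indicator S x *\<^sub>R g x)"
    by (rule integrable_completion[OF borel_measurable_integrable[OF i], THEN iffD2]) (rule i)
  then show ?thesis
    using S by (subst integrable_restrict_space) auto
qed

lemma square_integrable_continuous: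
  assumes "compact S" "continuous_on UNIV v"
  shows "v \<in> square_integrable S"
  unfolding square_integrable_def
proof (intro CollectI conjI)
  show "v \<in> borel_measurable (lebesgue_on S)"
    using borel_measurable_continuous_onI[OF assms(2)]
    by (intro measurable_restrict_space1 measurable_completion) simp
  show "integrable (lebesgue_on S) (\<lambda>x. (norm (v x))\<^sup>2)"
    using assms by (intro integrable_lebesgue_on_compact continuous_intros)
qed

lemma (in linear_bij) integral_affine_image:
  fixes g :: "'a \<Rightarrow> real"
  assumes "compact S" and g: "continuous_on UNIV g" "\<And>x. 0 \<le> g x"
  shows "(LINT x|lebesgue_on S. g (L x + b)) = preimage_factor L * (LINT x|lebesgue_on ((\<lambda>x. L x + b) ` S). g x)"
proof -
  have nn: "(LINT x|lebesgue_on S. f x) = enn2real (\<integral>\<^sup>+x. indicator S x * ennreal (f x) \<partial>lborel)"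
    if S: "compact S" and f: "continuous_on UNIV f" "\<And>x. 0 \<le> f x" for S and f :: "'a \<Rightarrow> real"
  proof -
    have Sb: "S \<in> sets borel" using S by (rule borel_compact)
    have "(LINT x|lebesgue_on S. f x) = enn2real (\<integral>\<^sup>+x. ennreal (f x) \<partial>lebesgue_on S)"
      using f integrable_lebesgue_on_compact[OF S f(1)]
      by (intro integral_eq_nn_integral) auto
    also have "(\<integral>\<^sup>+x. ennreal (f x) \<partial>lebesgue_on S) = (\<integral>\<^sup>+x. ennreal (f x) * indicator S x \<partial>lebesgue)"
      using Sb by (intro nn_integral_restrict_space) auto
    also have "\<dots> = (\<integral>\<^sup>+x. ennreal (f x) * indicator S x \<partial>lborel)"
      by (rule nn_integral_completion)
    finally show ?thesis by (simp add: mult.commute)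
  qed
  let ?T = "\<lambda>x. L x + b"
  have cT: "continuous_on UNIV ?T"
    by (intro continuous_intros continuous)
  have TS: "compact (?T ` S)"
    using assms(1) continuous_on_subset[OF cT] by (intro compact_continuous_image) auto
  have "(\<lambda>x. indicator (?T ` S) x * ennreal (g x)) \<in> borel_measurable borel"
    using borel_compact[OF TS] borel_measurable_continuous_onI[OF g(1)]
    by (intro borel_measurable_times_ennreal) auto
  from nn_integral_affine[OF this, of b]
  have "(\<integral>\<^sup>+x. indicator (?T ` S) (?T x) * ennreal (g (?T x)) \<partial>lborel)
      = ennreal (preimage_factor L) * (\<integral>\<^sup>+x. indicator (?T ` S) x * ennreal (g x) \<partial>lborel)" .
  moreover have "?T x \<in> ?T ` S \<longleftrightarrow> x \<in> S" for x
    using bij_is_inj[OF bij] by (auto simp: inj_eq)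
  ultimately have "(\<integral>\<^sup>+x. indicator S x * ennreal (g (?T x)) \<partial>lborel)
      = ennreal (preimage_factor L) * (\<integral>\<^sup>+x. indicator (?T ` S) x * ennreal (g x) \<partial>lborel)"
    by (simp add: indicator_def)
  then show ?thesis
    using nn[OF assms(1), of "\<lambda>x. g (?T x)"] nn[OF TS g] g continuous_on_compose2[OF g(1) cT]
    by (simp add: enn2real_mult preimage_factor_nonneg)
qed

section \<open>Affine images of the reference simplex\<close>

definition reference_simplex :: "'n::finite pt set" where
  "reference_simplex = convex hull (insert 0 (range (\<lambda>i. axis i 1)))"

lemma polytope_reference_simplex: "polytope reference_simplex"
  unfolding polytope_def reference_simplex_def
  by (intro exI[of _ "insert 0 (range (\<lambda>i. axis i 1))"]) simp

lemma reference_simplex_subset: "reference_simplex \<subseteq> cball 0 1"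
  unfolding reference_simplex_def by (rule hull_minimal) (auto simp: norm_axis_1)

text \<open>The columns of M are edges of K divided by its diameter, hence of length at most 1,
  which gives the upper bound \<open>CARD('n)\<close>. The inverse is bounded because K contains a
  ball of radius more than h / (4 \<gamma>), while points of the reference simplex are at distance
  at most 2; the product of 4 \<gamma> and 2 is the constant 8 \<gamma>.\<close>

lemma simplex_affine_image:
  fixes K :: "'n::finite pt set" and \<gamma> :: real
  assumes K: "int CARD('n) simplex K" and \<gamma>: "0 < \<gamma>" "diameter K \<le> \<gamma> * inball_diameter K"
  obtains M b where "linear_bij M" "0 < diameter K"
    "K = (\<lambda>x. diameter K *\<^sub>R M x + b) ` reference_simplex"
    "\<And>x. norm (M x) \<le> (CARD('n) + 8 * \<gamma>) * norm x" "\<And>x. norm x \<le> (CARD('n) + 8 * \<gamma>) * norm (M x)"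
proof -
  let ?n = "CARD('n)" and ?h = "diameter K"
  obtain V where V: "\<not> affine_dependent V" "card V = ?n + 1" "K = convex hull V"
    using K by (auto simp: simplex_def)
  have fin: "finite V" using V(2) by (metis Suc_eq_plus1 card.infinite nat.distinct(1))
  have bdd: "bounded K"
    using K simplex_imp_polytope polytope_imp_bounded by blast
  obtain v0 where v0: "v0 \<in> V" using V(2) by fastforce
  have VK: "V \<subseteq> K" unfolding V(3) by (rule hull_subset)
  have "card (V - {v0}) = ?n" using V(2) v0 fin by simp
  then obtain \<phi> where \<phi>: "bij_betw \<phi> (UNIV :: 'n set) (V - {v0})"
    using finite_same_card_bij[of "UNIV :: 'n set" "V - {v0}"] fin by auto
  have h: "0 < ?h"
  proof -
    have "\<phi> undefined \<in> V" "\<phi> undefined \<noteq> v0"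
      using \<phi> bij_betwE by fastforce+
    then show ?thesis
      using diameter_bounded_bound[OF bdd, of "\<phi> undefined" v0] VK v0
      by (metis dist_pos_lt less_le_trans subsetD)
  qed
  define M where "M x = (\<Sum>i\<in>UNIV. x $ i *\<^sub>R ((\<phi> i - v0) /\<^sub>R ?h))" for x :: "'n pt"
  define T where "T x = ?h *\<^sub>R M x + v0" for x
  have linM: "linear M"
    unfolding M_def[abs_def]
    by (intro linear_compose_sum ballI linearI) (simp_all add: scaleR_add_left distrib_right)
  have M_axis: "?h *\<^sub>R M (axis i 1) = \<phi> i - v0" for i
  proof -
    have "M (axis i 1) = (\<Sum>k\<in>UNIV. if k = i then (\<phi> i - v0) /\<^sub>R ?h else 0)"
      unfolding M_def by (intro sum.cong) (auto simp: axis_def)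
    then show ?thesis using h by simp
  qed
  have KT: "K = T ` reference_simplex"
  proof -
    have lin: "linear (\<lambda>x. ?h *\<^sub>R M x)" using linM by (intro linear_compose_scale_right)
    have "T ` reference_simplex = (+) v0 ` (\<lambda>x. ?h *\<^sub>R M x) ` reference_simplex"
      by (simp add: T_def image_image add.commute)
    also have "\<dots> = convex hull ((+) v0 ` (\<lambda>x. ?h *\<^sub>R M x) ` (insert 0 (range (\<lambda>i. axis i 1))))"
      unfolding reference_simplex_def
      using convex_hull_linear_image[OF lin] convex_hull_translation by metis
    also have "(+) v0 ` (\<lambda>x. ?h *\<^sub>R M x) ` (insert 0 (range (\<lambda>i. axis i 1))) = insert v0 (range \<phi>)"
      by (simp add: image_image M_axis linear_0[OF linM])
    also have "insert v0 (range \<phi>) = V"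
      using \<phi> v0 by (auto simp: bij_betw_def)
    finally show ?thesis by (simp add: V(3))
  qed
  have upper: "norm (M x) \<le> ?n * norm x" for x
  proof -
    have "norm (M x) \<le> (\<Sum>i\<in>UNIV. norm (x $ i *\<^sub>R ((\<phi> i - v0) /\<^sub>R ?h)))"
      unfolding M_def by (rule norm_sum)
    also have "\<dots> \<le> (\<Sum>i\<in>(UNIV :: 'n set). norm x)"
    proof (rule sum_mono)
      fix i
      have "\<phi> i \<in> V" using \<phi> bij_betwE by fastforce
      then have "dist (\<phi> i) v0 \<le> ?h"
        using diameter_bounded_bound[OF bdd] VK v0 by blast
      then have "norm ((\<phi> i - v0) /\<^sub>R ?h) \<le> 1"
        using h by (simp only: norm_scaleR dist_norm) (simp add: field_simps)
      then have "\<bar>x $ i\<bar> * norm ((\<phi> i - v0) /\<^sub>R ?h) \<le> norm x * 1"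
        using component_le_norm_cart[of x i] by (intro mult_mono) auto
      then show "norm (x $ i *\<^sub>R ((\<phi> i - v0) /\<^sub>R ?h)) \<le> norm x"
        by (simp only: norm_scaleR mult_1_right)
    qed
    finally show ?thesis by simp
  qed
  let ?S = "{2 * r |r x. 0 \<le> r \<and> cball x r \<subseteq> K}"
  \<comment> \<open>Half the guaranteed inball diameter is requested, so that a strict inequality
    holds below the supremum and an actual ball is obtained.\<close>
  have "\<exists>s\<in>?S. ?h / (2 * \<gamma>) < s"
  proof (rule less_cSupD)
    have "2 * 0 \<in> ?S" using v0 VK by (auto intro!: exI[of _ 0] exI[of _ v0])
    then show "?S \<noteq> {}" by blast
    have "?h / (2 * \<gamma>) < ?h / \<gamma>" using h \<gamma>(1) by (simp add: field_simps)
    also have "\<dots> \<le> Sup ?S"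
      using \<gamma> by (simp add: inball_diameter_def pos_divide_le_eq mult.commute)
    finally show "?h / (2 * \<gamma>) < Sup ?S" .
  qed
  then obtain r x0 where r: "?h / (4 * \<gamma>) < r" "cball x0 r \<subseteq> K"
    using \<gamma>(1) by (auto simp: field_simps)
  have r0: "0 < r" using r(1) h \<gamma>(1) by (meson divide_pos_pos less_trans mult_pos_pos zero_less_numeral)
  \<comment> \<open>Every direction occurs as the difference of two points of the ball, hence as the
    image under M of a vector.\<close>
  have surj: "surj M"
  proof -
    have "y \<in> range M" for y
    proof (cases "y = 0")
      case True
      then show ?thesis using linear_0[OF linM] by (metis rangeI)
    next
      case False
      have "x0 \<in> K" "x0 + (r / norm y) *\<^sub>R y \<in> K"
        using r(2) r0 False by (auto intro!: subsetD[OF r(2)] simp: dist_norm)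
      then obtain p q where "x0 = T p" "x0 + (r / norm y) *\<^sub>R y = T q"
        unfolding KT by blast
      then have eq: "(r / norm y) *\<^sub>R y = ?h *\<^sub>R M (q - p)"
        by (simp add: T_def linear_diff[OF linM] algebra_simps)
      have "y = (norm y / r) *\<^sub>R ((r / norm y) *\<^sub>R y)"
        using False r0 by simp
      also have "\<dots> = M ((norm y / r * ?h) *\<^sub>R (q - p))"
        unfolding eq by (simp add: linear_scale[OF linM])
      finally have "y = M ((norm y / r * ?h) *\<^sub>R (q - p))" .
      then show ?thesis by (metis rangeI)
    qed
    then show ?thesis by blast
  qed
  then have lb: "linear_bij M"
    using linM linear_surjective_imp_injective[OF linM] by (auto simp: linear_bij_def bij_def)
  have lower: "norm x \<le> 8 * \<gamma> * norm (M x)" for x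
  proof (cases "x = 0")
    case False
    have Mx: "M x \<noteq> 0"
      using False lb linear_0[OF linM] unfolding linear_bij_def by (metis bij_is_inj injD)
    \<comment> \<open>The radius of the ball in the direction of M x joins two points of K. Their
      preimages differ by a multiple of x whose length is at most 2.\<close>
    have "x0 \<in> K" "x0 + (r / norm (M x)) *\<^sub>R M x \<in> K"
      using r(2) r0 Mx by (auto intro!: subsetD[OF r(2)] simp: dist_norm)
    then obtain p q where pq: "x0 = T p" "x0 + (r / norm (M x)) *\<^sub>R M x = T q"
      "p \<in> reference_simplex" "q \<in> reference_simplex"
      unfolding KT by blast
    then have eq: "(r / norm (M x)) *\<^sub>R M x = ?h *\<^sub>R M (q - p)"
      by (simp add: T_def linear_diff[OF linM] algebra_simps)
    have "M ((r / (norm (M x) * ?h)) *\<^sub>R x) = (1 / ?h) *\<^sub>R ((r / norm (M x)) *\<^sub>R M x)"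
      by (simp add: linear_scale[OF linM] mult.commute)
    also have "\<dots> = M (q - p)"
      unfolding eq using h by simp
    finally have "(r / (norm (M x) * ?h)) *\<^sub>R x = q - p"
      using lb unfolding linear_bij_def by (metis bij_is_inj injD)
    then have "norm ((r / (norm (M x) * ?h)) *\<^sub>R x) = norm (q - p)" by simp
    also have "\<dots> \<le> norm q + norm p" by (rule norm_triangle_ineq4)
    also have "\<dots> \<le> 2"
      using subsetD[OF reference_simplex_subset pq(3)] subsetD[OF reference_simplex_subset pq(4)] by simp
    finally have "r * norm x \<le> 2 * (norm (M x) * ?h)"
      using Mx h r0 by (simp add: field_simps)
    moreover have "?h \<le> 4 * \<gamma> * r" using r(1) \<gamma>(1) by (simp add: field_simps)
    then have "2 * (norm (M x) * ?h) \<le> 2 * (norm (M x) * (4 * \<gamma> * r))"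
      by (intro mult_left_mono) auto
    ultimately have "r * norm x \<le> r * (8 * \<gamma> * norm (M x))" by (simp add: algebra_simps)
    then show ?thesis using r0 by simp
  qed (simp add: linear_0[OF linM])
  show ?thesis
  proof (rule that[OF lb h KT[unfolded T_def]])
    show "norm (M x) \<le> (?n + 8 * \<gamma>) * norm x" for x
      using upper[of x] \<gamma>(1) by (simp add: distrib_right add_increasing2)
    show "norm x \<le> (?n + 8 * \<gamma>) * norm (M x)" for x
      using lower[of x] by (simp add: distrib_right add_increasing)
  qed
qed

lemma facets_affine_image:
  assumes "linear_bij L"
  shows "{F. F facet_of (\<lambda>x. L x + b) ` K} = (\<lambda>E. (\<lambda>x. L x + b) ` E) ` {E. E facet_of K}"
proof -
  interpret linear_bij L by fact
  have inj: "inj L" by (rule bij_is_inj[OF bij])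
  have img: "(\<lambda>x. L x + b) ` S = (+) b ` L ` S" for S
    by (simp add: image_image add.commute)
  have iff: "(\<lambda>x. L x + b) ` E facet_of (\<lambda>x. L x + b) ` K \<longleftrightarrow> E facet_of K" for E
    unfolding img facet_of_def
    by (simp add: face_of_linear_image[OF linear inj] aff_dim_translation_eq aff_dim_injective_linear_image[OF linear inj])
  have "F \<in> (\<lambda>E. (\<lambda>x. L x + b) ` E) ` {E. E facet_of K}" if F: "F facet_of (\<lambda>x. L x + b) ` K" for F
  proof -
    have "(\<lambda>x. L x + b) ` ((\<lambda>y. inv L (y - b)) ` F) = F"
      by (simp add: image_image)
    with F iff show ?thesis by (metis (no_types, lifting) image_eqI mem_Collect_eq)
  qed
  with iff show ?thesis by auto
qed


lemma L2_norm_mono: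
  assumes "compact S" "continuous_on UNIV g" "continuous_on UNIV v" "0 \<le> c"
    and "\<And>x. norm (v x) \<le> c * g x" "\<And>x. 0 \<le> g x"
  shows "(L2_norm S v)\<^sup>2 \<le> c\<^sup>2 * (LINT x|lebesgue_on S. (g x)\<^sup>2)"
proof -
  have "(L2_norm S v)\<^sup>2 = (LINT x|lebesgue_on S. (norm (v x))\<^sup>2)"
    by (simp add: L2_norm_def L2_inner_eq power2_norm_eq_inner Bochner_Integration.integral_nonneg)
  also have "\<dots> \<le> (LINT x|lebesgue_on S. c\<^sup>2 * (g x)\<^sup>2)"
  proof (rule integral_mono)
    show "integrable (lebesgue_on S) (\<lambda>x. (norm (v x))\<^sup>2)" "integrable (lebesgue_on S) (\<lambda>x. c\<^sup>2 * (g x)\<^sup>2)"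
      using assms(1-3) by (intro integrable_lebesgue_on_compact continuous_intros; simp)+
    show "(norm (v x))\<^sup>2 \<le> c\<^sup>2 * (g x)\<^sup>2" for x
      using power_mono[OF assms(5) norm_ge_zero, of x 2] by (simp add: power_mult_distrib)
  qed
  finally show ?thesis by simp
qed

lemma wedge_norm_bound:
  obtains C where "0 < C" "\<And>i \<theta>. norm (wedge (axis {i} 1) (\<theta> :: 'n::{finite,linorder} form)) \<le> C * norm \<theta>"
proof -
  have "bilinear (wedge :: 'n form \<Rightarrow> 'n form \<Rightarrow> 'n form)"
    by (simp add: bilinear_def linear_wedge_left linear_wedge_right)
  then obtain C where C: "0 < C" "\<And>\<alpha> (\<beta> :: 'n form). norm (wedge \<alpha> \<beta>) \<le> C * norm \<alpha> * norm \<beta>"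
    using bilinear_bounded_pos by blast
  show ?thesis
    by (rule that[OF C(1)]) (use C(2)[of "axis {_} 1"] in \<open>simp add: norm_axis_1\<close>)
qed

lemma has_derivative_eq_partials:
  assumes "(f has_derivative D) (at x)"
  shows "D v = (\<Sum>k\<in>UNIV. v $ k *\<^sub>R partial k f x)"
proof -
  have lin: "linear D" by (rule has_derivative_linear[OF assms])
  have "D v = D (\<Sum>k\<in>UNIV. v $ k *\<^sub>R axis k 1)"
    using basis_expansion[of v] by (simp add: scalar_mult_eq_scaleR)
  then show ?thesis
    by (simp add: linear_sum[OF lin] linear_scale[OF lin] partial_eq[OF assms])
qed

text \<open>A form w that represents a trace may be large inside K while the trace is small; w'
  represents the same trace and is controlled by it. The right-hand sides contain the scaled
  boundary norm of w.\<close>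

definition trace_lifting_bound :: "real \<Rightarrow> 'n pt set \<Rightarrow> 'n::{finite,linorder} dform set \<Rightarrow> bool" where
  "trace_lifting_bound C K W \<longleftrightarrow> (\<forall>w\<in>W. \<exists>w'\<in>W. bd_form K (w - w') (w - w') = 0 \<and>
     L2_norm K w' \<le> C * sqrt (diameter K) * sqrt (bd_form K w w) \<and>
     diameter K * L2_norm K (ext_deriv w') \<le> C * sqrt (diameter K) * sqrt (bd_form K w w))"

text \<open>A polynomial form with prescribed tangential trace on the reference simplex is chosen of minimal
  size; forms on an arbitrary cell are transported there by pullback along the linear part divided
  by the cell diameter, which is uniformly bounded together with its inverse.\<close>

lemma trace_lifting:
  fixes A :: poly_family and \<gamma> :: real
  assumes \<gamma>: "0 < \<gamma>"
  obtains C where "0 \<le> C"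
    "\<And>K :: 'n::{finite,linorder} pt set. int CARD('n) simplex K \<Longrightarrow>
      diameter K \<le> \<gamma> * inball_diameter K \<Longrightarrow> trace_lifting_bound C K (poly_forms A j)"
proof -
  let ?n = "CARD('n)"
  let ?R = "reference_simplex :: 'n pt set"
  let ?W = "poly_forms A j :: 'n dform set"
  define B where "B = ?n + 8 * \<gamma>"
  have B: "0 < B" "0 \<le> B" using \<gamma> by (auto simp: B_def add_pos_pos)
  obtain C1 where C1: "0 \<le> C1" "\<And>(M :: 'n pt \<Rightarrow> 'n pt) \<omega>. (\<And>x. norm (M x) \<le> B * norm x) \<Longrightarrow>
      norm (form_pullback M \<omega>) \<le> C1 * norm \<omega>"
    using norm_form_pullback_bound[OF B(2)] by metis
  obtain C2 where C2: "0 \<le> C2" "\<And>(M :: 'n pt \<Rightarrow> 'n pt) E F \<theta>. linear M \<Longrightarrow> (\<And>x. norm (M x) \<le> B * norm x) \<Longrightarrow>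
      norm (facet_normal E) = 1 \<Longrightarrow> (\<And>v. facet_normal E \<bullet> v = 0 \<Longrightarrow> facet_normal F \<bullet> M v = 0) \<Longrightarrow>
      norm (tan_part E (form_pullback M \<theta>)) \<le> C2 * norm (tan_part F \<theta>)"
    using norm_tan_part_pullback_bound[OF B(2)] by blast
  obtain Cw where Cw: "0 < Cw" "\<And>i \<theta>. norm (wedge (axis {i} 1) (\<theta> :: 'n form)) \<le> Cw * norm \<theta>"
    using wedge_norm_bound by blast
  obtain S where S: "finite S" "?W \<subseteq> span S"
    using poly_forms_finite_span by blast
  have R: "polytope ?R" "compact ?R"
    using polytope_reference_simplex polytope_imp_compact by blast+
  interpret bd: semi_inner ?W "bd_form ?R"
    by (rule semi_inner_bd_form_poly[OF R(1)])
  interpret L2: semi_inner "square_integrable ?R" "L2_inner ?R"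
    by (rule semi_inner_L2)
  \<comment> \<open>All first partial derivatives are included because the chain rule for the
    transported form is applied to them; the exterior derivative is estimated from them
    afterwards.\<close>
  define N where "N v = L2_norm ?R v + (\<Sum>k\<in>UNIV. L2_norm ?R (partial k v))" for v :: "'n dform"
  have sq: "v \<in> square_integrable ?R" "partial k v \<in> square_integrable ?R" if "v \<in> ?W" for v k
    using poly_forms_smooth[OF that]
    by (auto intro!: square_integrable_continuous R smooth_continuous_on smooth_partial)
  have L2_add: "L2_norm ?R (v + w) \<le> L2_norm ?R v + L2_norm ?R w"
    if "v \<in> square_integrable ?R" "w \<in> square_integrable ?R" for v w
    unfolding L2_norm_def by (rule L2.norm_triangle[OF that])
  have L2_scale: "L2_norm ?R (c *\<^sub>R v) = \<bar>c\<bar> * L2_norm ?R v" if "v \<in> square_integrable ?R" for v c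
    unfolding L2_norm_def by (rule L2.norm_scale[OF that])
  have partial_lin: "partial k (v + w) = partial k v + partial k w" "partial k (c *\<^sub>R v) = c *\<^sub>R partial k v"
    if "v \<in> ?W" "w \<in> ?W" for v w k c
  proof -
    note d = smooth_differentiable[OF poly_forms_smooth[OF that(1)]] smooth_differentiable[OF poly_forms_smooth[OF that(2)]]
    show "partial k (v + w) = partial k v + partial k w"
      by (rule ext) (simp add: plus_fun_def partial_add d)
    show "partial k (c *\<^sub>R v) = c *\<^sub>R partial k v"
    proof (rule ext)
      fix x
      obtain D where D: "(v has_derivative D) (at x)" using d(1)[of x] by (auto simp: differentiable_def)
      have "((\<lambda>x. c *\<^sub>R v x) has_derivative (\<lambda>h. c *\<^sub>R D h)) (at x)"
        by (intro has_derivative_scaleR_right D)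
      then show "partial k (c *\<^sub>R v) x = (c *\<^sub>R partial k v) x"
        by (simp add: scaleR_fun_def partial_eq D partial_eq[OF D])
    qed
  qed
  have N_add: "N (v + w) \<le> N v + N w" if "v \<in> ?W" "w \<in> ?W" for v w
  proof -
    have "(\<Sum>k\<in>UNIV. L2_norm ?R (partial k (v + w)))
        \<le> (\<Sum>k\<in>UNIV. L2_norm ?R (partial k v) + L2_norm ?R (partial k w))"
      by (rule sum_mono) (simp add: partial_lin[OF that] L2_add sq that)
    then show ?thesis
      using L2_add[OF sq(1)[OF that(1)] sq(1)[OF that(2)]] by (simp add: N_def sum.distrib)
  qed
  have N_scale: "N (c *\<^sub>R v) = \<bar>c\<bar> * N v" if "v \<in> ?W" for v c
    by (simp add: N_def partial_lin(2)[OF that that] L2_scale sq that distrib_left sum_distrib_left)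
  obtain C3 where C3: "0 \<le> C3"
    "\<And>w. w \<in> ?W \<Longrightarrow> \<exists>w'\<in>?W. bd_form ?R (w - w') (w - w') = 0 \<and> N w' \<le> C3 * sqrt (bd_form ?R w w)"
    using bd.bounded_representative[of S N] S N_add N_scale by metis
  have L2_nonneg: "0 \<le> L2_norm K v" for K and v :: "'n dform"
    by (simp add: L2_norm_def L2_inner_eq Bochner_Integration.integral_nonneg)
  \<comment> \<open>c4 is the constant of \<open>preimage_factor_frame_le\<close>. In c5 one finds
    the number of summands of d, the norms of the wedge product, of the pullback and of the inverse
    map, and a factor from comparing a sum with the root of a sum of squares.\<close>
  define c4 where "c4 = (B + 1) ^ ?n * B ^ ?n"
  define c5 where "c5 = ?n * Cw * C1 * B * sqrt ?n"
  have c: "0 \<le> c4" "0 \<le> c5" using B Cw(1) C1(1) by (auto simp: c4_def c5_def)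
  show ?thesis
  proof (rule that[of "(C1 + c5) * C3 * C2 * sqrt c4"])
    show "0 \<le> (C1 + c5) * C3 * C2 * sqrt c4" using C1 C2 C3 c by simp
    fix K :: "'n pt set"
    assume K: "int ?n simplex K" "diameter K \<le> \<gamma> * inball_diameter K"
    show "trace_lifting_bound ((C1 + c5) * C3 * C2 * sqrt c4) K ?W"
      unfolding trace_lifting_bound_def
    proof (rule ballI)
      fix w assume w: "w \<in> ?W"
      define h where "h = diameter K"
      obtain M b where M: "linear_bij M" and h: "0 < h" and KT: "K = (\<lambda>x. h *\<^sub>R M x + b) ` ?R"
        and MB: "\<And>x. norm (M x) \<le> B * norm x" "\<And>x. norm x \<le> B * norm (M x)"
        using simplex_affine_image[OF K(1) \<gamma> K(2)] unfolding h_def B_def by metis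
      interpret M: linear_bij M by fact
      define L where "L x = h *\<^sub>R M x" for x
      have L_eq: "L = (\<lambda>x. h *\<^sub>R M x)" by (simp add: L_def fun_eq_iff)
      have L: "linear_bij L"
        unfolding L_def[abs_def] using h by (intro linear_bij_compose[OF linear_bij_scale M]) simp
      interpret L: linear_bij L by fact
      define T where "T x = L x + b" for x
      have KT': "K = T ` ?R" by (simp add: KT T_def[abs_def] L_def)
      define Mi where "Mi = inv M"
      have Mi: "linear_bij Mi" unfolding Mi_def by (rule linear_bij_inv[OF M])
      have MiB: "norm (Mi x) \<le> B * norm x" for x
        using MB(2)[of "Mi x"] by (simp add: Mi_def)
      have MMi: "M (Mi x) = x" "Mi (M x) = x" for x by (simp_all add: Mi_def)
      \<comment> \<open>Brought into the shape of \<open>poly_forms_pullback\<close>, with 1 / h and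
        Mi in place of h and M.\<close>
      define Ti where "Ti y = (1 / h) *\<^sub>R Mi y + - ((1 / h) *\<^sub>R Mi b)" for y
      have Ti: "Ti (T x) = x" for x
        using h linear_bij.linear[OF Mi] by (simp add: Ti_def T_def L_def linear_add linear_scale MMi algebra_simps)
      have TTi: "T (Ti y) = y" for y
      proof -
        have "Ti y = (1 / h) *\<^sub>R Mi (y - b)"
          by (simp add: Ti_def linear_diff[OF linear_bij.linear[OF Mi]] scaleR_diff_right)
        then show ?thesis
          using h by (simp add: T_def L_def linear_scale[OF M.linear] MMi)
      qed
      \<comment> \<open>The point is moved by T, but the form is pulled back by M alone, so no power
        of h depending on the degree appears.\<close>
      define pb where "pb v x = form_pullback M (v (T x))" for v x
      define pf where "pf v y = form_pullback Mi (v (Ti y))" for v y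
      have pull: "form_pullback Mi (form_pullback M \<theta>) = \<theta>" "form_pullback M (form_pullback Mi \<theta>) = \<theta>" for \<theta>
      proof -
        have "M \<circ> Mi = (\<lambda>x. x)" "Mi \<circ> M = (\<lambda>x. x)" by (auto simp: MMi)
        then show "form_pullback Mi (form_pullback M \<theta>) = \<theta>" "form_pullback M (form_pullback Mi \<theta>) = \<theta>"
          using form_pullback_compose[OF M.linear] form_pullback_compose[OF linear_bij.linear[OF Mi]] by simp_all
      qed
      have pb_pf: "pb (pf v) = v" and pf_T: "pf v (T x) = form_pullback Mi (v x)" for v x
        by (simp_all add: pb_def pf_def Ti pull fun_eq_iff)
      have pb_W: "pb v \<in> ?W" if "v \<in> ?W" for v
        unfolding pb_def[abs_def] T_def L_def by (rule poly_forms_pullback[OF that M.linear M.bij])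
      have pf_W: "pf v \<in> ?W" if "v \<in> ?W" for v
        unfolding pf_def[abs_def] Ti_def
        by (rule poly_forms_pullback[OF that linear_bij.linear[OF Mi] linear_bij.bij[OF Mi]])
      have contT: "continuous_on UNIV T"
        unfolding T_def[abs_def] by (intro continuous_intros L.continuous)
      have contT_compose: "continuous_on UNIV (\<lambda>x. f (T x))" if "continuous_on UNIV f" for f :: "'n pt \<Rightarrow> 'n form"
        using continuous_on_compose2[OF that contT] by simp
      have facets: "{F. F facet_of K} = (\<lambda>E. T ` E) ` {E. E facet_of ?R}"
        using facets_affine_image[OF L, of b ?R] by (simp add: KT' T_def[abs_def])
      have inj_T: "inj T" using Ti by (metis injI)
      have inj_facets: "inj_on (\<lambda>E. T ` E) X" for X
        using inj_T by (simp add: inj_on_def inj_image_eq_iff)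
      have polyK: "polytope K" using K(1) by (rule simplex_imp_polytope)
      have aff: "aff_dim K = int ?n" "aff_dim ?R = int ?n"
      proof -
        show "aff_dim K = int ?n" by (rule aff_dim_simplex[OF K(1)])
        have "K = (+) b ` L ` ?R" by (simp add: KT' T_def[abs_def] image_image add.commute)
        then have "aff_dim K = aff_dim ?R"
          using aff_dim_injective_linear_image[OF L.linear bij_is_inj[OF L.bij]] by (simp add: aff_dim_translation_eq)
        with \<open>aff_dim K = int ?n\<close> show "aff_dim ?R = int ?n" by simp
      qed
      have facet_map: "\<exists>\<alpha> \<beta>. facet_map L b E \<alpha> \<beta>" if E: "E facet_of ?R" for E
      proof -
        have F: "T ` E facet_of K" using facets E by blast
        obtain \<alpha> where "norm (facet_normal E) = 1" "affine hull E = {x. facet_normal E \<bullet> x = \<alpha>}"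
          using facet_hyperplane[OF E aff(2)] .
        moreover obtain \<beta> where "norm (facet_normal (T ` E)) = 1"
          "affine hull (T ` E) = {x. facet_normal (T ` E) \<bullet> x = \<beta>}"
          using facet_hyperplane[OF F aff(1)] .
        ultimately have "facet_map L b E \<alpha> \<beta>"
          using facet_compact[OF R(1) E] L unfolding facet_map_def facet_map_axioms_def T_def[abs_def] by simp
        then show ?thesis by blast
      qed
      define f where "f = preimage_factor L"
      have f: "0 < f" unfolding f_def by (rule preimage_factor_pos[OF L])
      let ?I = "\<lambda>F v. LINT x|facet_measure F. tan_part F (v x) \<bullet> tan_part F (v x)"
      have bdK: "bd_form K v v = (\<Sum>E | E facet_of ?R. ?I (T ` E) v)" for v
        unfolding bd_form_def facets by (subst sum.reindex[OF inj_facets]) (simp add: comp_def)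
      have I_nonneg: "0 \<le> ?I F v" for F v
        by (intro Bochner_Integration.integral_nonneg) simp
      have per_facet: "?I E (pb v) \<le> C2\<^sup>2 * c4 * h * f * ?I (T ` E) v"
        "?I E (pb v) = 0 \<Longrightarrow> ?I (T ` E) v = 0"
        if ER: "E facet_of ?R" and v: "v \<in> ?W" for E v
      proof -
        obtain \<alpha> \<beta> where "facet_map L b E \<alpha> \<beta>" using facet_map[OF ER] by blast
        then interpret facet_map L b E \<alpha> \<beta> .
        have TE: "T ` E = F" by (simp add: T_def[abs_def])
        let ?g = "\<lambda>x. tan_part F (v x) \<bullet> tan_part F (v x)"
        have ct: "continuous_on UNIV (\<lambda>x. tan_part F (v x))"
          by (rule continuous_on_linear_compose[OF poly_forms_continuous[OF v] linear_tan_part])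
        have ctT: "continuous_on UNIV (\<lambda>x. ?g (T x))"
          by (rule continuous_on_compose2[OF continuous_on_inner[OF ct ct] contT]) simp
        have ctE: "continuous_on UNIV (\<lambda>x. tan_part E (pb v x))"
          by (rule continuous_on_linear_compose[OF poly_forms_continuous[OF pb_W[OF v]] linear_tan_part])
        have int: "integrable (facet_measure E) (\<lambda>x. ?g (T x))"
          by (rule integrable_facet_measure[OF facet_compact[OF R(1) ER] ctT])
        have intE: "integrable (facet_measure E) (\<lambda>x. tan_part E (pb v x) \<bullet> tan_part E (pb v x))"
          by (rule integrable_facet_measure[OF facet_compact[OF R(1) ER] continuous_on_inner[OF ctE ctE]])
        have gm: "?g \<in> borel_measurable borel"
          by (rule borel_measurable_continuous_onI[OF continuous_on_inner[OF ct ct]])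
        have change: "(LINT x|facet_measure E. ?g (T x)) = preimage_factor frame * ?I F v"
          using integral_facet[OF gm] by (simp add: T_def)
        have tan: "\<mu> \<bullet> x = 0 \<Longrightarrow> \<nu> \<bullet> M x = 0" for x
          using tangent_iff[of x] h by (simp add: L_def)
        have tan': "\<nu> \<bullet> y = 0 \<Longrightarrow> \<mu> \<bullet> Mi y = 0" for y
          using tangent_iff[of "Mi y"] h by (simp add: L_def MMi)
        have le1: "norm (tan_part E (pb v x)) \<le> C2 * norm (tan_part F (v (T x)))" for x
          unfolding pb_def by (rule C2(2)[OF M.linear MB(1) normal(1) tan])
        have le2: "norm (tan_part F (v (T x))) \<le> C2 * norm (tan_part E (pb v x))" for x
          using C2(2)[OF linear_bij.linear[OF Mi] MiB normal(2) tan', of "pb v x"] by (simp add: pb_def pull)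
        have sq_le: "a \<bullet> a \<le> C2\<^sup>2 * (b \<bullet> b)" if "norm a \<le> C2 * norm b" for a b :: "'n form"
          using power_mono[OF that norm_ge_zero, of 2] by (simp add: power_mult_distrib power2_norm_eq_inner)
        have "?I E (pb v) \<le> (LINT x|facet_measure E. C2\<^sup>2 * ?g (T x))"
          by (rule integral_mono) (use intE int sq_le[OF le1] in auto)
        then have "?I E (pb v) \<le> C2\<^sup>2 * (preimage_factor frame * ?I F v)"
          by (simp add: change)
        also have "\<dots> \<le> C2\<^sup>2 * (c4 * h * f * ?I F v)"
          using preimage_factor_frame_le[OF L_eq h M B(1) MB] I_nonneg[of F v]
          by (intro mult_left_mono mult_right_mono) (auto simp: c4_def f_def)
        finally show "?I E (pb v) \<le> C2\<^sup>2 * c4 * h * f * ?I (T ` E) v"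
          by (simp add: TE mult.assoc)
        assume 0: "?I E (pb v) = 0"
        \<comment> \<open>The reverse comparison serves only qualitatively: a trace that is null on
          the reference simplex is null on K.\<close>
        have "(LINT x|facet_measure E. ?g (T x)) \<le> (LINT x|facet_measure E. C2\<^sup>2 * (tan_part E (pb v x) \<bullet> tan_part E (pb v x)))"
          by (rule integral_mono) (use intE int sq_le[OF le2] in auto)
        then have "preimage_factor frame * ?I F v \<le> 0"
          by (simp add: change 0)
        moreover have "0 < preimage_factor frame" by (rule preimage_factor_pos[OF frame(1)])
        ultimately show "?I (T ` E) v = 0"
          using I_nonneg[of F v] by (simp add: TE mult_le_0_iff)
      qed
      have finR: "finite {E. E facet_of ?R}" by (rule finite_polytope_facets[OF R(1)])
      have bd_le: "bd_form ?R (pb v) (pb v) \<le> C2\<^sup>2 * c4 * h * f * bd_form K v v" if "v \<in> ?W" for v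
        unfolding bdK unfolding bd_form_def sum_distrib_left by (rule sum_mono) (use per_facet(1) that in auto)
      have bd_0: "bd_form K v v = 0" if "v \<in> ?W" "bd_form ?R (pb v) (pb v) = 0" for v
      proof -
        have "\<forall>E\<in>{E. E facet_of ?R}. ?I E (pb v) = 0"
          using that(2) finR I_nonneg unfolding bd_form_def by (subst (asm) sum_nonneg_eq_0_iff) auto
        then show ?thesis unfolding bdK using per_facet(2) that(1) by (intro sum.neutral) auto
      qed
      obtain v where v: "v \<in> ?W" "bd_form ?R (pb w - v) (pb w - v) = 0" "N v \<le> C3 * sqrt (bd_form ?R (pb w) (pb w))"
        using C3(2)[OF pb_W[OF w]] by blast
      have Nv: "N v \<le> C3 * (C2 * sqrt c4 * sqrt h * sqrt f * sqrt (bd_form K w w))"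
      proof -
        have "sqrt (bd_form ?R (pb w) (pb w)) \<le> sqrt (C2\<^sup>2 * c4 * h * f * bd_form K w w)"
          using bd_le[OF w] by simp
        also have "\<dots> = C2 * sqrt c4 * sqrt h * sqrt f * sqrt (bd_form K w w)"
          using C2(1) by (simp add: real_sqrt_mult)
        finally show ?thesis using v(3) C3(1) by (meson mult_left_mono order_trans)
      qed
      define w' where "w' = pf v"
      have w': "w' \<in> ?W" unfolding w'_def by (rule pf_W[OF v(1)])
      have "pb (w - w') = pb w - v"
        by (simp add: fun_eq_iff pb_def w'_def pf_T pull linear_diff[OF linear_form_pullback])
      then have null: "bd_form K (w - w') (w - w') = 0"
        using v(2) w w' by (intro bd_0) (auto intro: bd.mem)
      have change: "f * (L2_norm K u)\<^sup>2 = (L2_norm ?R (\<lambda>x. u (T x)))\<^sup>2" if u: "continuous_on UNIV u" for u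
      proof -
        have "(LINT x|lebesgue_on ?R. u (T x) \<bullet> u (T x)) = f * (LINT x|lebesgue_on K. u x \<bullet> u x)"
          using L.integral_affine_image[OF R(2), of "\<lambda>x. u x \<bullet> u x" b] continuous_on_inner[OF u u]
          by (simp add: f_def KT' T_def[abs_def])
        moreover have "0 \<le> f * (LINT x|lebesgue_on K. u x \<bullet> u x)"
          using f by (simp add: Bochner_Integration.integral_nonneg)
        ultimately show ?thesis
          by (simp add: L2_norm_def L2_inner_eq Bochner_Integration.integral_nonneg)
      qed
      have L2_sq: "(LINT x|lebesgue_on ?R. (norm (u x))\<^sup>2) = (L2_norm ?R u)\<^sup>2" for u :: "'n dform"
        by (simp add: L2_norm_def L2_inner_eq power2_norm_eq_inner Bochner_Integration.integral_nonneg)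
      \<comment> \<open>The volume factor f occurs under the root on both sides, from the change of
        variables in K and from that on the facets, and cancels; the surplus h of the facets gives
        the weight \<open>sqrt h\<close>.\<close>
      have finish: "c * L2_norm K u \<le> d * C3 * C2 * sqrt c4 * sqrt h * sqrt (bd_form K w w)"
        if u: "continuous_on UNIV u" and cd: "0 \<le> c" "0 \<le> d"
          and le: "c\<^sup>2 * (L2_norm ?R (\<lambda>x. u (T x)))\<^sup>2 \<le> d\<^sup>2 * (N v)\<^sup>2" for u c d
      proof -
        have N0: "0 \<le> N v" by (simp add: N_def L2_nonneg sum_nonneg)
        have "(sqrt f * (c * L2_norm K u))\<^sup>2 = c\<^sup>2 * (f * (L2_norm K u)\<^sup>2)"
          using f by (simp only: power_mult_distrib real_sqrt_pow2 less_imp_le mult.left_commute)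
        also have "\<dots> \<le> (d * N v)\<^sup>2"
          unfolding change[OF u] power_mult_distrib by (rule le)
        finally have "(sqrt f * (c * L2_norm K u))\<^sup>2 \<le> (d * N v)\<^sup>2" .
        then have "sqrt f * (c * L2_norm K u) \<le> d * N v"
          by (rule power2_le_imp_le) (rule mult_nonneg_nonneg[OF cd(2) N0])
        also have "\<dots> \<le> d * (C3 * (C2 * sqrt c4 * sqrt h * sqrt f * sqrt (bd_form K w w)))"
          using Nv cd by (intro mult_left_mono)
        finally have "sqrt f * (c * L2_norm K u) \<le> sqrt f * (d * C3 * C2 * sqrt c4 * sqrt h * sqrt (bd_form K w w))"
          by (simp add: mult_ac)
        then show ?thesis using f by simp
      qed
      have cv: "continuous_on UNIV v" by (rule poly_forms_continuous[OF v(1)])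
      have vs: "smooth v" by (rule poly_forms_smooth[OF v(1)])
      have bound1: "(L2_norm ?R (\<lambda>x. w' (T x)))\<^sup>2 \<le> C1\<^sup>2 * (N v)\<^sup>2"
      proof -
        have "(L2_norm ?R (\<lambda>x. w' (T x)))\<^sup>2 \<le> C1\<^sup>2 * (LINT x|lebesgue_on ?R. (norm (v x))\<^sup>2)"
        proof (rule L2_norm_mono[OF R(2) _ _ C1(1)])
          show "continuous_on UNIV (\<lambda>x. norm (v x))" using cv by (intro continuous_intros)
          show "continuous_on UNIV (\<lambda>x. w' (T x))" by (rule contT_compose[OF poly_forms_continuous[OF w']])
          show "norm (w' (T x)) \<le> C1 * norm (v x)" for x
            unfolding w'_def pf_T by (rule C1(2)[OF MiB])
        qed simp
        also have "(LINT x|lebesgue_on ?R. (norm (v x))\<^sup>2) \<le> (N v)\<^sup>2"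
          unfolding L2_sq by (rule power_mono) (auto simp: N_def L2_nonneg sum_nonneg)
        finally show ?thesis by (simp add: mult_left_mono)
      qed
      define G where "G x = (\<Sum>k\<in>UNIV. norm (partial k v x))" for x
      have G_cont: "continuous_on UNIV G"
        unfolding G_def by (intro continuous_intros smooth_continuous_on smooth_partial vs)
      have ext_le: "norm (ext_deriv w' (T x)) \<le> ?n * Cw * C1 * B / h * G x" for x
      proof -
        obtain D where D: "(v has_derivative D) (at x)"
          using smooth_differentiable[OF vs, of x] by (auto simp: differentiable_def)
        have dT: "(Ti has_derivative (\<lambda>z. (1 / h) *\<^sub>R Mi z)) (at (T x))"
        proof -
          have "bounded_linear (\<lambda>z. (1 / h) *\<^sub>R Mi z)"
            using linear_bij.linear[OF Mi] by (simp add: linear_conv_bounded_linear[symmetric] linear_compose_scale_right)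
          then show ?thesis
            unfolding Ti_def[abs_def] by (rule has_derivative_add_const[OF bounded_linear_imp_has_derivative])
        qed
        have "(v has_derivative D) (at (Ti (T x)))" using D by (simp add: Ti)
        from has_derivative_compose[OF dT this]
        have "((\<lambda>y. v (Ti y)) has_derivative (\<lambda>z. D ((1 / h) *\<^sub>R Mi z))) (at (T x))" .
        then have dw: "(w' has_derivative (\<lambda>z. form_pullback Mi (D ((1 / h) *\<^sub>R Mi z)))) (at (T x))"
          unfolding w'_def pf_def[abs_def]
          by (rule bounded_linear.has_derivative[rotated]) (simp add: linear_conv_bounded_linear[symmetric] linear_form_pullback)
        have part: "norm (partial i w' (T x)) \<le> C1 * (B / h * G x)" for i
        proof -
          let ?z = "(1 / h) *\<^sub>R Mi (axis i 1)"
          have z: "norm ?z \<le> B / h"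
            using MiB[of "axis i 1"] h by (simp add: norm_axis_1 field_simps)
          have "partial i w' (T x) = form_pullback Mi (D ?z)"
            by (rule partial_eq[OF dw])
          then have "norm (partial i w' (T x)) \<le> C1 * norm (D ?z)"
            using C1(2)[OF MiB] by simp
          also have "norm (D ?z) \<le> (\<Sum>k\<in>UNIV. norm (?z $ k *\<^sub>R partial k v x))"
            unfolding has_derivative_eq_partials[OF D, of ?z] by (rule norm_sum)
          also have "\<dots> \<le> (\<Sum>k\<in>UNIV. B / h * norm (partial k v x))"
          proof (rule sum_mono)
            fix k
            have "\<bar>?z $ k\<bar> \<le> B / h" using component_le_norm_cart[of ?z k] z by linarith
            then show "norm (?z $ k *\<^sub>R partial k v x) \<le> B / h * norm (partial k v x)"
              by (simp only: norm_scaleR) (rule mult_right_mono, auto)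
          qed
          finally show ?thesis
            using C1(1) by (simp add: G_def sum_distrib_left mult_left_mono)
        qed
        have "norm (ext_deriv w' (T x)) \<le> (\<Sum>i\<in>UNIV. norm (wedge (axis {i} 1) (partial i w' (T x))))"
          unfolding ext_deriv_def by (rule norm_sum)
        also have "\<dots> \<le> (\<Sum>i\<in>(UNIV :: 'n set). Cw * (C1 * (B / h * G x)))"
          by (rule sum_mono) (meson Cw part less_imp_le mult_left_mono order_trans)
        finally show ?thesis by (simp add: mult_ac)
      qed
      have cext: "continuous_on UNIV (ext_deriv w')"
        by (rule continuous_on_ext_deriv[OF poly_forms_smooth[OF w']])
      have bound2: "h\<^sup>2 * (L2_norm ?R (\<lambda>x. ext_deriv w' (T x)))\<^sup>2 \<le> c5\<^sup>2 * (N v)\<^sup>2"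
      proof -
        let ?c = "?n * Cw * C1 * B / h"
        have c0: "0 \<le> ?c" using Cw(1) C1(1) B h by simp
        have "(L2_norm ?R (\<lambda>x. ext_deriv w' (T x)))\<^sup>2 \<le> ?c\<^sup>2 * (LINT x|lebesgue_on ?R. (G x)\<^sup>2)"
          by (rule L2_norm_mono[OF R(2) G_cont contT_compose[OF cext] c0 ext_le])
            (simp add: G_def sum_nonneg)
        \<comment> \<open>Cauchy-Schwarz for the sum over k; hence the factor \<open>sqrt ?n\<close>
          in c5.\<close>
        also have "(LINT x|lebesgue_on ?R. (G x)\<^sup>2) \<le> (LINT x|lebesgue_on ?R. (\<Sum>k\<in>UNIV. (norm (partial k v x))\<^sup>2) * ?n)"
        proof (rule integral_mono)
          show "integrable (lebesgue_on ?R) (\<lambda>x. (G x)\<^sup>2)"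
            by (intro integrable_lebesgue_on_compact R continuous_intros G_cont)
          show "integrable (lebesgue_on ?R) (\<lambda>x. (\<Sum>k\<in>UNIV. (norm (partial k v x))\<^sup>2) * ?n)"
            by (intro integrable_lebesgue_on_compact R continuous_intros smooth_continuous_on smooth_partial vs)
          show "(G x)\<^sup>2 \<le> (\<Sum>k\<in>UNIV. (norm (partial k v x))\<^sup>2) * ?n" for x
            unfolding G_def using sum_squared_le_sum_of_squares[of "\<lambda>k. norm (partial k v x)" "UNIV :: 'n set"]
            by simp
        qed
        also have "\<dots> = (\<Sum>k\<in>UNIV. (L2_norm ?R (partial k v))\<^sup>2) * ?n"
        proof -
          have "integrable (lebesgue_on ?R) (\<lambda>x. (norm (partial k v x))\<^sup>2)" for k
            by (intro integrable_lebesgue_on_compact R continuous_intros smooth_continuous_on smooth_partial vs)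
          then show ?thesis by (simp add: L2_sq)
        qed
        also have "(\<Sum>k\<in>UNIV. (L2_norm ?R (partial k v))\<^sup>2) \<le> (N v)\<^sup>2"
        proof -
          have "(\<Sum>k\<in>UNIV. (L2_norm ?R (partial k v))\<^sup>2) = (L2_set (\<lambda>k. L2_norm ?R (partial k v)) UNIV)\<^sup>2"
            by (simp add: L2_set_def sum_nonneg)
          also have "\<dots> \<le> (\<Sum>k\<in>UNIV. L2_norm ?R (partial k v))\<^sup>2"
            by (intro power_mono L2_set_le_sum) (auto simp: L2_nonneg L2_set_nonneg)
          also have "\<dots> \<le> (N v)\<^sup>2"
            by (intro power_mono) (auto simp: N_def L2_nonneg sum_nonneg)
          finally show ?thesis .
        qed
        finally have "(L2_norm ?R (\<lambda>x. ext_deriv w' (T x)))\<^sup>2 \<le> ?c\<^sup>2 * ((N v)\<^sup>2 * ?n)"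
          by (simp add: mult_left_mono mult_right_mono)
        then have "h\<^sup>2 * (L2_norm ?R (\<lambda>x. ext_deriv w' (T x)))\<^sup>2 \<le> h\<^sup>2 * (?c\<^sup>2 * ((N v)\<^sup>2 * ?n))"
          by (rule mult_left_mono) simp
        also have "\<dots> = c5\<^sup>2 * (N v)\<^sup>2"
          using h by (simp add: c5_def power_mult_distrib power_divide)
        finally show ?thesis .
      qed
      let ?Q = "C3 * C2 * sqrt c4 * sqrt h * sqrt (bd_form K w w)"
      have Q: "0 \<le> ?Q"
        using C2 C3 c h semi_inner.nonneg[OF semi_inner_bd_form_poly[OF polyK] w] by simp
      have "L2_norm K w' \<le> C1 * C3 * C2 * sqrt c4 * sqrt h * sqrt (bd_form K w w)"
        using finish[OF poly_forms_continuous[OF w'], of 1 C1] bound1 C1(1) by simp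
      also have "\<dots> = C1 * ?Q" by (simp add: mult_ac)
      also have "\<dots> \<le> (C1 + c5) * ?Q" using Q c by (intro mult_right_mono) auto
      finally have 1: "L2_norm K w' \<le> (C1 + c5) * ?Q" .
      have "h * L2_norm K (ext_deriv w') \<le> c5 * C3 * C2 * sqrt c4 * sqrt h * sqrt (bd_form K w w)"
        using finish[OF cext, of h c5] bound2 c h by simp
      also have "\<dots> = c5 * ?Q" by (simp add: mult_ac)
      also have "\<dots> \<le> (C1 + c5) * ?Q" using Q C1 by (intro mult_right_mono) auto
      finally have 2: "h * L2_norm K (ext_deriv w') \<le> (C1 + c5) * ?Q" .
      show "\<exists>w'\<in>?W. bd_form K (w - w') (w - w') = 0 \<and>
          L2_norm K w' \<le> (C1 + c5) * C3 * C2 * sqrt c4 * sqrt (diameter K) * sqrt (bd_form K w w) \<and>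
          diameter K * L2_norm K (ext_deriv w') \<le> (C1 + c5) * C3 * C2 * sqrt c4 * sqrt (diameter K) * sqrt (bd_form K w w)"
        using w' null 1 2 by (intro bexI[of _ w']) (auto simp: h_def mult.assoc)
    qed
  qed
qed

lemma trace_lifting_bound_mono:
  assumes "trace_lifting_bound C K (poly_forms A j)" "C \<le> C'" "polytope K"
  shows "trace_lifting_bound C' K (poly_forms A j)"
  unfolding trace_lifting_bound_def
proof (rule ballI)
  fix w :: "'a dform" assume w: "w \<in> poly_forms A j"
  have "0 \<le> sqrt (diameter K) * sqrt (bd_form K w w)"
    using semi_inner.nonneg[OF semi_inner_bd_form_poly[OF assms(3)] w] assms(3)
    by (simp add: diameter_ge_0 polytope_imp_bounded)
  from mult_right_mono[OF assms(2) this]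
  have "C * sqrt (diameter K) * sqrt (bd_form K w w) \<le> C' * sqrt (diameter K) * sqrt (bd_form K w w)"
    by (simp add: mult.assoc)
  then show "\<exists>w'\<in>poly_forms A j. bd_form K (w - w') (w - w') = 0 \<and>
     L2_norm K w' \<le> C' * sqrt (diameter K) * sqrt (bd_form K w w) \<and>
     diameter K * L2_norm K (ext_deriv w') \<le> C' * sqrt (diameter K) * sqrt (bd_form K w w)"
    using assms(1) w unfolding trace_lifting_bound_def by (meson order_trans)
qed


section \<open>Codifferentials and traces on the cells of a mesh\<close>

lemma inner_hodge: "hodge \<alpha> \<bullet> hodge \<beta> = \<alpha> \<bullet> \<beta>"
proof -
  have "hodge \<alpha> \<bullet> hodge \<beta> = (\<Sum>J\<in>UNIV. \<alpha> $ (- J) * \<beta> $ (- J))"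
    unfolding inner_vec_def hodge_def
  proof (rule sum.cong[OF refl])
    fix J :: "'a set"
    have "shuffle_sign (- J) J * \<alpha> $ (- J) * (shuffle_sign (- J) J * \<beta> $ (- J))
        = (shuffle_sign (- J) J * shuffle_sign (- J) J) * (\<alpha> $ (- J) * \<beta> $ (- J))"
      by (simp only: mult_ac)
    then show "(\<chi> J. shuffle_sign (- J) J * \<alpha> $ (- J)) $ J \<bullet> (\<chi> J. shuffle_sign (- J) J * \<beta> $ (- J)) $ J
        = \<alpha> $ (- J) * \<beta> $ (- J)"
      by simp
  qed
  also have "\<dots> = (\<Sum>I\<in>UNIV. \<alpha> $ I * \<beta> $ I)"
    by (rule sum.reindex_bij_witness[where i = uminus and j = uminus]) auto
  finally show ?thesis by (simp add: inner_vec_def)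
qed

lemma norm_hodge [simp]: "norm (hodge \<alpha>) = norm \<alpha>"
  by (simp add: norm_eq_sqrt_inner inner_hodge)

lemma inv_hodge [simp]: "inv hodge (hodge \<alpha>) = \<alpha>"
  by (simp add: bij_hodge bij_is_inj)

lemma linear_inv_hodge: "linear (inv (hodge :: 'n::{finite,linorder} form \<Rightarrow> _))"
  by (rule inj_linear_imp_inv_linear[OF linear_hodge bij_is_inj[OF bij_hodge]])

lemma has_degree_out_of_range:
  fixes \<omega> :: "'n::{finite,linorder} form"
  assumes "has_degree j \<omega>" "j < 0 \<or> int CARD('n) < j"
  shows "\<omega> = 0"
proof (rule vec_eq_iff[THEN iffD2], rule allI)
  fix I :: "'n set"
  have "card I \<le> CARD('n)" by (rule card_mono) auto
  with assms show "\<omega> $ I = 0 $ I" by (auto simp: has_degree_def)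
qed

lemma L2_forms_square_integrable: "v \<in> L2_forms S j \<Longrightarrow> v \<in> square_integrable S"
  by (simp add: L2_forms_def square_integrable_def)

lemma borel_measurable_linear_compose:
  assumes "v \<in> borel_measurable M" "linear (T :: 'a::euclidean_space \<Rightarrow> 'b::euclidean_space)"
  shows "(\<lambda>x. T (v x)) \<in> borel_measurable M"
  by (rule measurable_compose[OF assms(1)])
    (use assms(2) in \<open>auto intro!: borel_measurable_continuous_onI simp: linear_continuous_on linear_conv_bounded_linear\<close>)

lemma L2_inner_cong_AE:
  assumes "a \<in> borel_measurable (lebesgue_on S)" "a' \<in> borel_measurable (lebesgue_on S)"
    "b \<in> borel_measurable (lebesgue_on S)" "AE x in lebesgue_on S. a x = a' x"
  shows "L2_inner S a b = L2_inner S a' b" "L2_inner S b a = L2_inner S b a'"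
proof -
  show "L2_inner S a b = L2_inner S a' b"
    unfolding L2_inner_eq using assms(4)
    by (intro integral_cong_AE borel_measurable_inner assms) (auto elim: eventually_mono)
  show "L2_inner S b a = L2_inner S b a'"
    unfolding L2_inner_eq using assms(4)
    by (intro integral_cong_AE borel_measurable_inner assms) (auto elim: eventually_mono)
qed

lemma wedge_hodge_left:
  fixes \<alpha> \<beta> :: "'n::{finite,linorder} form"
  assumes "has_degree j \<alpha>" "0 \<le> j"
  shows "wedge (hodge \<beta>) \<alpha> $ UNIV = (-1) ^ (nat j * (CARD('n) - nat j)) * (\<alpha> \<bullet> \<beta>)"
  using wedge_UNIV_commute[OF assms, of "hodge \<beta>"] by (simp add: wedge_hodge)

text \<open>The signs in the definitions of \<open>weak_codiff\<close> and \<open>has_weak_d\<close> cancel against those from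
  commuting a form with a Hodge dual.\<close>

lemma has_weak_d_hodge:
  fixes v g :: "'n::{finite,linorder} dform"
  assumes g: "g \<in> L2_forms S j"
    and adj: "\<And>\<eta>. \<eta> \<in> test_forms S j \<Longrightarrow> L2_inner S (ext_deriv \<eta>) v = L2_inner S \<eta> g"
  shows "has_weak_d S (int CARD('n) - (j + 1)) (\<lambda>y. hodge (v y)) (\<lambda>x. (-1) powi (j + 1) *\<^sub>R hodge (g x))"
  unfolding has_weak_d_def
proof (intro conjI ballI)
  let ?c = "(-1 :: real) powi (j + 1)" and ?n = "CARD('n)"
  have "(\<lambda>x. ?c *\<^sub>R hodge (g x)) \<in> borel_measurable (lebesgue_on S)"
    using g borel_measurable_linear_compose[OF _ linear_hodge, of g "lebesgue_on S"]
    by (auto simp: L2_forms_def)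
  moreover have "has_degree (int ?n - j) (?c *\<^sub>R hodge (g x))" if "x \<in> S" for x
    using g that by (intro has_degree_scaleR has_degree_hodge) (auto simp: L2_forms_def)
  moreover have "\<bar>?c\<bar> = 1" by (simp add: power_int_abs)
  ultimately show "(\<lambda>x. ?c *\<^sub>R hodge (g x)) \<in> L2_forms S (int ?n - (j + 1) + 1)"
    using g by (simp add: L2_forms_def)
  fix \<eta> :: "'n dform" assume "\<eta> \<in> test_forms S (int ?n - (int ?n - (j + 1)) - 1)"
  then have \<eta>: "\<eta> \<in> test_forms S j" by simp
  then have deg: "has_degree j (\<eta> x)" and diff: "\<eta> differentiable at x" for x
    by (auto simp: test_forms_def smooth_differentiable)
  have deg': "has_degree (j + 1) (ext_deriv \<eta> x)" for x
    by (rule has_degree_ext_deriv[OF diff deg])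
  \<comment> \<open>Outside the degrees 0 to n - 1 either \<eta> or its derivative is zero and both
    sides vanish. Inside, all exponents can be written with natural numbers m and l, where n = m + 1
    + l.\<close>
  show "form_integral S (\<lambda>x. wedge (?c *\<^sub>R hodge (g x)) (\<eta> x))
      = (-1) powi (int ?n - (j + 1) + 1) * form_integral S (\<lambda>x. wedge (hodge (v x)) (ext_deriv \<eta> x))"
  proof (cases "0 \<le> j \<and> j < int ?n")
    case False
    then have "L2_inner S \<eta> g = 0 \<and> (\<forall>x. ext_deriv \<eta> x = 0)"
    proof (cases "j < 0")
      case True
      then have "\<eta> = (\<lambda>x. 0)" using has_degree_out_of_range[OF deg] by auto
      then show ?thesis by (simp add: L2_inner_eq ext_deriv_def linear_0[OF linear_wedge_right])
    next
      case j: False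
      with False have "\<forall>x. ext_deriv \<eta> x = 0" using has_degree_out_of_range[OF deg'] by auto
      then show ?thesis using adj[OF \<eta>] by (simp add: L2_inner_eq)
    qed
    moreover have "form_integral S (\<lambda>x. wedge (?c *\<^sub>R hodge (g x)) (\<eta> x)) = 0" if "L2_inner S \<eta> g = 0"
    proof (cases "j < 0")
      case True
      then have "\<eta> = (\<lambda>x. 0)" using has_degree_out_of_range[OF deg] by auto
      then show ?thesis by (simp add: form_integral_def linear_0[OF linear_wedge_right])
    next
      case False
      then show ?thesis
        using that by (simp add: form_integral_def linear_scale[OF linear_wedge_left] wedge_hodge_left[OF deg] L2_inner_eq)
    qed
    ultimately show ?thesis
      by (simp add: form_integral_def linear_0[OF linear_wedge_right])
  next
    case True
    then have j: "0 \<le> j" "0 \<le> j + 1" by auto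
    define m where "m = nat j"
    obtain l where l: "?n = m + 1 + l"
      using True by (metis add.commute less_imp_Suc_add m_def nat_less_iff plus_1_eq_Suc add.assoc)
    have jm: "j = int m" using True by (simp add: m_def)
    have nat: "nat j = m" "nat (j + 1) = m + 1" "?n - m = l + 1" "?n - (m + 1) = l"
      using l by (auto simp: jm nat_add_distrib)
    have pw: "(-1) powi (int ?n - (j + 1) + 1) = (-1 :: real) ^ (l + 1)" "?c = (-1) ^ (m + 1)"
      using l by (auto simp: jm power_int_add power_int_def nat_add_distrib)
    have "form_integral S (\<lambda>x. wedge (c *\<^sub>R hodge (g x)) (\<eta> x)) = c * ((-1) ^ (m * (l + 1)) * L2_inner S \<eta> g)" for c
      by (simp add: form_integral_def linear_scale[OF linear_wedge_left] wedge_hodge_left[OF deg j(1)] L2_inner_eq nat)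
    then have "form_integral S (\<lambda>x. wedge (?c *\<^sub>R hodge (g x)) (\<eta> x)) = (-1) ^ (m + 1) * (-1) ^ (m * (l + 1)) * L2_inner S \<eta> g"
      unfolding pw by (simp only: mult.assoc)
    \<comment> \<open>Both total exponents are congruent to m l + 1 modulo 2.\<close>
    also have "(-1) ^ (m + 1) * (-1) ^ (m * (l + 1)) = (-1) ^ (l + 1) * (-1 :: real) ^ ((m + 1) * l)"
      by (simp add: algebra_simps flip: power_add) (metis (no_types) even_add minus_one_power_iff)
    also have "\<dots> * L2_inner S \<eta> g = (-1) ^ (l + 1) * ((-1) ^ ((m + 1) * l) * L2_inner S (ext_deriv \<eta>) v)"
      by (simp add: adj[OF \<eta>])
    also have "(-1) ^ ((m + 1) * l) * L2_inner S (ext_deriv \<eta>) v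
        = form_integral S (\<lambda>x. wedge (hodge (v x)) (ext_deriv \<eta> x))"
      by (simp only: form_integral_def wedge_hodge_left[OF deg' j(2)] nat L2_inner_eq integral_mult_right_zero)
    finally have "form_integral S (\<lambda>x. wedge (?c *\<^sub>R hodge (g x)) (\<eta> x))
        = (-1) ^ (l + 1) * form_integral S (\<lambda>x. wedge (hodge (v x)) (ext_deriv \<eta> x))" .
    then show ?thesis unfolding pw(1) .
  qed
qed

text \<open>The codifferential is built on a choice and can be identified only through uniqueness of
  weak derivatives. Its measurability is recorded as well, since the almost everywhere identity is
  to be used under integrals.\<close>

lemma weak_codiff_AE_eq:
  fixes v g :: "'n::{finite,linorder} dform"
  assumes g: "g \<in> L2_forms S j"
    and adj: "\<And>\<eta>. \<eta> \<in> test_forms S j \<Longrightarrow> L2_inner S (ext_deriv \<eta>) v = L2_inner S \<eta> g"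
    and S: "bounded S" "S \<in> sets lebesgue" "negligible (S - interior S)"
  shows "AE x in lebesgue_on S. weak_codiff S (j + 1) v x = g x"
    and "weak_codiff S (j + 1) v \<in> borel_measurable (lebesgue_on S)"
proof -
  let ?w = "weak_d S (int CARD('n) - (j + 1)) (\<lambda>y. hodge (v y))"
  note weak = has_weak_d_hodge[OF g adj]
  have sq: "(-1) powi (j + 1) * (-1 :: real) powi (j + 1) = 1"
    by (simp flip: power_int_mult_distrib)
  have "AE x in lebesgue_on S. ?w x = (-1) powi (j + 1) *\<^sub>R hodge (g x)"
    by (rule weak_d_AE_eq[OF weak S])
  then show "AE x in lebesgue_on S. weak_codiff S (j + 1) v x = g x"
  proof eventually_elim
    case (elim x)
    have "(-1) powi (j + 1) *\<^sub>R inv hodge (hodge ((-1) powi (j + 1) *\<^sub>R g x)) = g x"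
      by (simp add: sq)
    with elim show ?case
      by (simp add: weak_codiff_def linear_scale[OF linear_hodge])
  qed
  have "has_weak_d S (int CARD('n) - (j + 1)) (\<lambda>y. hodge (v y)) ?w"
    using someI[of "has_weak_d S (int CARD('n) - (j + 1)) (\<lambda>y. hodge (v y))", OF weak] by (simp add: weak_d_def)
  then have "?w \<in> borel_measurable (lebesgue_on S)"
    by (simp add: has_weak_d_def L2_forms_def)
  from borel_measurable_linear_compose[OF this linear_inv_hodge]
  show "weak_codiff S (j + 1) v \<in> borel_measurable (lebesgue_on S)"
    unfolding weak_codiff_def by (intro borel_measurable_scaleR) auto
qed

text \<open>The domain lies locally on one side of a graph, which excludes slits: a boundary point
  interior to the closure could be pushed along e strictly above the graph, where an open set avoids
  \<Omega>, yet it would still lie in the closure.\<close>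

lemma interior_closure_lipschitz:
  assumes "lipschitz_polyhedral_domain \<Omega>"
  shows "interior (closure \<Omega>) = \<Omega>"
proof
  have op: "open \<Omega>" using assms by (simp add: lipschitz_polyhedral_domain_def)
  then show "\<Omega> \<subseteq> interior (closure \<Omega>)"
    by (simp add: closure_subset interior_maximal)
  show "interior (closure \<Omega>) \<subseteq> \<Omega>"
  proof (rule ccontr)
    assume "\<not> interior (closure \<Omega>) \<subseteq> \<Omega>"
    then obtain x where x: "x \<in> interior (closure \<Omega>)" "x \<notin> \<Omega>" by blast
    then have "x \<in> frontier \<Omega>"
      using interior_subset op by (auto simp: frontier_def interior_open)
    then obtain U e L and g :: "'a pt \<Rightarrow> real" where U: "open U" "x \<in> U" "norm e = 1"
      "L-lipschitz_on {y. y \<bullet> e = 0} g"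
      "\<Omega> \<inter> U = {y \<in> U. y \<bullet> e < g (y - (y \<bullet> e) *\<^sub>R e)}"
      using assms unfolding lipschitz_polyhedral_domain_def by blast
    have ee: "e \<bullet> e = 1" using U(3) by (simp add: dot_square_norm)
    let ?G = "\<lambda>y. g (y - (y \<bullet> e) *\<^sub>R e)"
    have contG: "continuous_on UNIV ?G"
      by (rule continuous_on_compose2[OF lipschitz_on_continuous_on[OF U(4)]])
        (auto intro!: continuous_intros simp: inner_diff_left ee)
    define V where "V = U \<inter> interior (closure \<Omega>)"
    have V: "open V" "x \<in> V" using U x by (auto simp: V_def)
    then obtain r where r: "0 < r" "ball x r \<subseteq> V" using open_contains_ball by blast
    define y where "y = x + (r / 2) *\<^sub>R e"
    have "y \<in> ball x r" using r(1) U(3) by (simp add: y_def dist_norm)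
    then have yV: "y \<in> V" using r(2) by blast
    have "?G y = ?G x"
      by (simp add: y_def inner_add_left ee algebra_simps)
    moreover have "?G x \<le> x \<bullet> e"
      using U(2,5) x(2) by (auto simp: not_less[symmetric])
    ultimately have above: "?G y < y \<bullet> e"
      using r(1) by (simp add: y_def inner_add_left ee)
    define Z where "Z = U \<inter> {z. ?G z < z \<bullet> e}"
    have "open Z"
      unfolding Z_def by (intro open_Int U(1) open_Collect_less contG continuous_intros)
    moreover have "y \<in> Z" using yV above by (simp add: Z_def V_def)
    moreover have "Z \<inter> \<Omega> = {}"
    proof -
      have "z \<bullet> e < ?G z" if "z \<in> \<Omega>" "z \<in> U" for z
        using that U(5) by blast
      then show ?thesis by (force simp: Z_def)
    qed
    ultimately have "y \<notin> closure \<Omega>"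
      using open_Int_closure_eq_empty by blast
    then show False
      using yV interior_subset by (auto simp: V_def)
  qed
qed

section \<open>Cells of a mesh and restriction of forms to them\<close>

locale mesh =
  fixes \<Omega> :: "'n::{finite,linorder} pt set" and \<T> :: "'n pt set set"
  assumes domain: "lipschitz_polyhedral_domain \<Omega>" and mesh: "simplicial_mesh \<Omega> \<T>"
begin

lemma \<Omega>: "open \<Omega>" "bounded \<Omega>" "\<Omega> \<in> sets lebesgue" "interior \<Omega> = \<Omega>" "\<Omega> \<noteq> {}"
  using domain by (auto simp: lipschitz_polyhedral_domain_def interior_open)

lemma finite_mesh: "finite \<T>"
  using mesh by (simp add: simplicial_mesh_def triangulation_def)

lemma mesh_nonempty: "\<T> \<noteq> {}"
  using mesh \<Omega>(5) closure_subset[of \<Omega>] by (auto simp: simplicial_mesh_def)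

text \<open>The mesh covers the closure of \<Omega>, so a cell may reach outside the open set
  \<Omega>. Since its interior lies in \<Omega> and its frontier is null, data on \<Omega> determine
  almost everything on the cell.\<close>

lemma cell:
  assumes "K \<in> \<T>"
  shows "int CARD('n) simplex K" "polytope K" "compact K" "bounded K" "K \<in> sets lebesgue"
    "negligible (K - interior K)" "interior K \<subseteq> \<Omega>" "negligible (K - \<Omega>)"
proof -
  show simp: "int CARD('n) simplex K" using mesh assms by (simp add: simplicial_mesh_def)
  show poly: "polytope K" by (rule simplex_imp_polytope[OF simp])
  show comp: "compact K" by (rule polytope_imp_compact[OF poly])
  then show "bounded K" "K \<in> sets lebesgue"
    by (auto simp: compact_imp_bounded borel_compact)
  have "negligible (frontier K)"
    by (rule negligible_convex_frontier[OF polytope_imp_convex[OF poly]])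
  then show neg: "negligible (K - interior K)"
    by (rule negligible_subset) (use closure_subset in \<open>auto simp: frontier_def\<close>)
  have "K \<subseteq> closure \<Omega>" using mesh assms by (auto simp: simplicial_mesh_def)
  then show sub: "interior K \<subseteq> \<Omega>"
    using interior_mono interior_closure_lipschitz[OF domain] by blast
  show "negligible (K - \<Omega>)"
    by (rule negligible_subset[OF neg]) (use sub in auto)
qed

text \<open>The intersection of two distinct cells is a proper face of at least one of them and so
  misses the interior of that cell, although it contains the intersection of the interiors.\<close>

lemma disjoint_interiors:
  assumes "K \<in> \<T>" "K' \<in> \<T>" "K \<noteq> K'"
  shows "interior K \<inter> interior K' = {}"
proof -
  have "(A \<inter> B) face_of A" if "A \<in> \<T>" "B \<in> \<T>" for A B
    using mesh that by (simp add: simplicial_mesh_def triangulation_def)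
  from this[OF assms(1,2)] this[OF assms(2,1)]
  have f: "(K \<inter> K') face_of K" "(K \<inter> K') face_of K'"
    by (simp_all add: Int_commute)
  have "K \<inter> K' \<noteq> K \<or> K \<inter> K' \<noteq> K'" using assms(3) by blast
  then have "(K \<inter> K') \<inter> interior K = {} \<or> (K \<inter> K') \<inter> interior K' = {}"
    using f face_of_disjoint_interior by blast
  then show ?thesis using interior_subset by blast
qed

text \<open>The form is controlled only on \<Omega>, and its values on the null part of K outside
  \<Omega> are arbitrary; completeness of Lebesgue measure absorbs them.\<close>

lemma square_integrable_cell:
  assumes K: "K \<in> \<T>" and v: "v \<in> square_integrable \<Omega>"
  shows "v \<in> square_integrable K"
proof -
  have "K \<inter> \<Omega> \<in> sets lebesgue" using cell(5)[OF K] \<Omega>(3) by blast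
  have neg: "negligible (((K \<inter> \<Omega>) - K) \<union> (K - (K \<inter> \<Omega>)))"
    by (rule negligible_subset[OF cell(8)[OF K]]) auto
  have vm: "v \<in> borel_measurable (lebesgue_on \<Omega>)"
    using v by (simp add: square_integrable_def)
  then have "v \<in> borel_measurable (lebesgue_on (K \<inter> \<Omega>))"
    by (rule measurable_restrict_mono) auto
  then have "v measurable_on (K \<inter> \<Omega>)"
    using \<open>K \<inter> \<Omega> \<in> sets lebesgue\<close> by (simp add: measurable_on_iff_borel_measurable)
  then have "v measurable_on K"
    by (rule measurable_on_spike_set[OF _ neg])
  then have m: "v \<in> borel_measurable (lebesgue_on K)"
    using cell(5)[OF K] by (simp add: measurable_on_iff_borel_measurable)
  have "set_integrable lebesgue \<Omega> (\<lambda>x. (norm (v x))\<^sup>2)"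
    using v \<Omega>(3) by (simp add: square_integrable_def set_integrable_def integrable_restrict_space)
  then have "set_integrable lebesgue (K \<inter> \<Omega>) (\<lambda>x. (norm (v x))\<^sup>2)"
    by (rule set_integrable_subset) (use \<open>K \<inter> \<Omega> \<in> sets lebesgue\<close> in auto)
  then have "set_integrable lebesgue K (\<lambda>x. (norm (v x))\<^sup>2)"
    by (rule absolutely_integrable_spike_set_eq[THEN iffD1, rotated 2])
      (rule negligible_subset[OF neg], auto)+
  then have "integrable (lebesgue_on K) (\<lambda>x. (norm (v x))\<^sup>2)"
    using cell(5)[OF K] by (simp add: set_integrable_def integrable_restrict_space)
  with m show ?thesis by (simp add: square_integrable_def)
qed

lemma AE_cell:
  assumes K: "K \<in> \<T>" and "AE x in lebesgue. x \<in> \<Omega> \<longrightarrow> P x"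
  shows "AE x in lebesgue_on K. P x"
proof -
  have "AE x in lebesgue. x \<notin> K - \<Omega>"
    using cell(8)[OF K] by (intro AE_not_in) (simp add: negligible_iff_null_sets)
  with assms(2) have "AE x in lebesgue. x \<in> K \<longrightarrow> P x"
    by eventually_elim auto
  then show ?thesis using cell(5)[OF K] by (simp add: AE_restrict_space_iff)
qed

lemma weak_d_poly:
  fixes \<omega> :: "'n dform"
  assumes K: "K \<in> \<T>" and \<omega>: "\<omega> \<in> poly_forms A j"
  shows "AE x in lebesgue_on K. weak_d K j \<omega> x = ext_deriv \<omega> x"
    and "weak_d K j \<omega> \<in> borel_measurable (lebesgue_on K)"
proof -
  have weak: "has_weak_d K j \<omega> (ext_deriv \<omega>)"
    by (rule has_weak_d_smooth[OF poly_forms_smooth[OF \<omega>] poly_forms_degree[OF \<omega>] cell(4,5)[OF K]])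
  then show "AE x in lebesgue_on K. weak_d K j \<omega> x = ext_deriv \<omega> x"
    by (rule weak_d_AE_eq[OF _ cell(4,5,6)[OF K]])
  have "has_weak_d K j \<omega> (weak_d K j \<omega>)"
    using someI[of "has_weak_d K j \<omega>", OF weak] by (simp add: weak_d_def)
  then show "weak_d K j \<omega> \<in> borel_measurable (lebesgue_on K)"
    by (simp add: has_weak_d_def L2_forms_def)
qed

lemma poly_square_integrable:
  fixes \<omega> :: "'n dform"
  assumes "K \<in> \<T>" "\<omega> \<in> poly_forms A j"
  shows "\<omega> \<in> square_integrable K" "ext_deriv \<omega> \<in> square_integrable K"
  using assms
  by (auto intro!: square_integrable_continuous cell(3) poly_forms_continuous continuous_on_ext_deriv poly_forms_smooth)

lemma L2_inner_weak_d_poly: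
  fixes \<omega> :: "'n dform"
  assumes K: "K \<in> \<T>" and \<omega>: "\<omega> \<in> poly_forms A j" and v: "v \<in> square_integrable K"
  shows "L2_inner K (weak_d K j \<omega>) v = L2_inner K (ext_deriv \<omega>) v"
    and "L2_inner K v (weak_d K j \<omega>) = L2_inner K v (ext_deriv \<omega>)"
  using L2_inner_cong_AE[OF weak_d_poly(2)[OF K \<omega>] _ _ weak_d_poly(1)[OF K \<omega>], of v]
    poly_square_integrable(2)[OF K \<omega>] v
  by (auto simp: square_integrable_def)

text \<open>A field on \<open>\<Omega>\<close> that is adjoint to the exterior derivative on test forms supported in a cell
  represents the codifferential there.\<close>

lemma trace_pairing_poly:
  fixes v g :: "'n dform"
  assumes K: "K \<in> \<T>" and v: "v \<in> square_integrable \<Omega>" and g: "g \<in> L2_forms \<Omega> j"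
    and adj: "\<And>\<eta>. \<eta> \<in> test_forms \<Omega> j \<Longrightarrow> L2_inner \<Omega> (ext_deriv \<eta>) v = L2_inner \<Omega> \<eta> g"
    and \<omega>: "\<omega> \<in> poly_forms A j"
  shows "trace_pairing K j \<omega> v = L2_inner K (ext_deriv \<omega>) v - L2_inner K \<omega> g"
proof -
  \<comment> \<open>\<open>L2_forms K j\<close> prescribes the degree at every point of K, whereas g
    is known to have degree j only in \<Omega>; on the boundary of the cell it is therefore set to
    0.\<close>
  define g' where "g' x = (if x \<in> interior K then g x else 0)" for x
  have gK: "g \<in> square_integrable K"
    by (rule square_integrable_cell[OF K L2_forms_square_integrable[OF g]])
  have int: "interior K \<in> sets lebesgue" by simp
  have g'_ind: "g' = (\<lambda>x. indicator (interior K) x *\<^sub>R g x)"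
    by (auto simp: g'_def indicator_def)
  have g'm: "g' \<in> borel_measurable (lebesgue_on K)"
    unfolding g'_ind
  proof (rule borel_measurable_scaleR)
    show "indicator (interior K) \<in> borel_measurable (lebesgue_on K)"
      by (intro measurable_restrict_space1 borel_measurable_indicator) simp
  qed (use gK in \<open>simp add: square_integrable_def\<close>)
  have g'L2: "g' \<in> L2_forms K j"
    unfolding L2_forms_def
  proof (intro CollectI conjI ballI g'm)
    show "integrable (lebesgue_on K) (\<lambda>x. (norm (g' x))\<^sup>2)"
    proof (rule Bochner_Integration.integrable_bound)
      show "integrable (lebesgue_on K) (\<lambda>x. (norm (g x))\<^sup>2)" using gK by (simp add: square_integrable_def)
      show "(\<lambda>x. (norm (g' x))\<^sup>2) \<in> borel_measurable (lebesgue_on K)" using g'm by measurable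
    qed (auto simp: g'_def)
    show "has_degree j (g' x)" if "x \<in> K" for x
      using g cell(7)[OF K] by (auto simp: g'_def L2_forms_def)
  qed
  have local: "L2_inner K a b = L2_inner \<Omega> a b'" 
    if "\<And>x. x \<in> interior K \<Longrightarrow> b x = b' x" "\<And>x. x \<notin> interior K \<Longrightarrow> a x = 0" for a b b' :: "'n dform"
  proof -
    have "indicator K x *\<^sub>R (a x \<bullet> b x) = indicator \<Omega> x *\<^sub>R (a x \<bullet> b' x)" for x
      using that[of x] cell(7)[OF K] interior_subset[of K] by (cases "x \<in> interior K") (auto simp: indicator_def)
    then show ?thesis
      using cell(5)[OF K] \<Omega>(3) by (simp add: L2_inner_eq integral_restrict_space)
  qed
  have adjK: "L2_inner K (ext_deriv \<eta>) v = L2_inner K \<eta> g'" if \<eta>: "\<eta> \<in> test_forms K j" for \<eta>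
  proof -
    obtain C where C: "compact C" "C \<subseteq> interior K" "\<And>x. x \<notin> C \<Longrightarrow> \<eta> x = 0"
      using \<eta> by (auto simp: test_forms_def)
    have "\<eta> \<in> test_forms \<Omega> j"
      using \<eta> C cell(7)[OF K] \<Omega>(4) unfolding test_forms_def by blast
    have "ext_deriv \<eta> x = 0" if "x \<notin> C" for x
    proof -
      have "open (- C)" using compact_imp_closed[OF C(1)] by (rule open_Compl)
      then have "(\<eta> has_derivative (\<lambda>h. 0)) (at x)"
        by (rule has_derivative_transform_within_open[OF has_derivative_const]) (use that C(3) in auto)
      then show ?thesis by (simp add: ext_deriv_def partial_eq linear_0[OF linear_wedge_right])
    qed
    then have 1: "L2_inner K (ext_deriv \<eta>) v = L2_inner \<Omega> (ext_deriv \<eta>) v"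
      using C(2) by (intro local) auto
    have 2: "L2_inner K \<eta> g' = L2_inner \<Omega> \<eta> g"
      using C by (intro local) (auto simp: g'_def)
    show ?thesis unfolding 1 2 by (rule adj) fact
  qed
  have cod: "AE x in lebesgue_on K. weak_codiff K (j + 1) v x = g' x"
    "weak_codiff K (j + 1) v \<in> borel_measurable (lebesgue_on K)"
    by (rule weak_codiff_AE_eq[OF g'L2 _ cell(4,5,6)[OF K]], erule adjK)+
  have "AE x in lebesgue. x \<notin> K - interior K"
    using cell(6)[OF K] by (intro AE_not_in) (simp add: negligible_iff_null_sets)
  then have "AE x in lebesgue. x \<in> K \<longrightarrow> x \<in> interior K"
    by eventually_elim auto
  then have "AE x in lebesgue_on K. x \<in> interior K"
    using cell(5)[OF K] by (simp add: AE_restrict_space_iff)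
  with cod(1) have AE: "AE x in lebesgue_on K. weak_codiff K (j + 1) v x = g x"
    by eventually_elim (simp add: g'_def)
  have \<omega>m: "\<omega> \<in> borel_measurable (lebesgue_on K)" and gm: "g \<in> borel_measurable (lebesgue_on K)"
    using poly_square_integrable[OF K \<omega>] gK by (auto simp: square_integrable_def)
  have "L2_inner K \<omega> (weak_codiff K (j + 1) v) = L2_inner K \<omega> g"
    by (rule L2_inner_cong_AE(2)[OF cod(2) gm \<omega>m AE])
  then show ?thesis
    using L2_inner_weak_d_poly(1)[OF K \<omega> square_integrable_cell[OF K v]] by (simp add: trace_pairing_def)
qed

section \<open>Localizing mesh-wide identities to one cell\<close>

lemma sum_single_cell:
  assumes "K \<in> \<T>" "\<And>K'. K' \<in> \<T> \<Longrightarrow> K' \<noteq> K \<Longrightarrow> g K' = 0"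
  shows "(\<Sum>K'\<in>\<T>. g K') = g K"
proof -
  have "(\<Sum>K'\<in>\<T>. g K') = (\<Sum>K'\<in>\<T>. if K' = K then g K else 0)"
    using assms by (intro sum.cong) auto
  then show ?thesis using finite_mesh assms(1) by simp
qed

text \<open>Broken spaces impose no continuity between cells, so the extension by zero is an
  admissible test form and reduces a sum over the mesh to one term.\<close>

definition on_cell :: "'n pt set \<Rightarrow> 'n dform \<Rightarrow> 'n broken" where
  "on_cell K \<omega> = (\<lambda>K'. if K' = K then \<omega> else 0)"

lemma on_cell_same [simp]: "on_cell K \<omega> K = \<omega>"
  by (simp add: on_cell_def)

lemma on_cell_other [simp]: "K' \<noteq> K \<Longrightarrow> on_cell K \<omega> K' = 0"
  by (simp add: on_cell_def)

lemma on_cell_broken_space: "\<omega> \<in> poly_forms A j \<Longrightarrow> on_cell K \<omega> \<in> broken_space \<T> A j"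
  using subspace_0[OF subspace_poly_forms] by (auto simp: broken_space_def on_cell_def)

lemma broken_inner_on_cell:
  "K \<in> \<T> \<Longrightarrow> broken_inner \<T> v (on_cell K \<omega>) = L2_inner K (v K) \<omega>"
  unfolding broken_inner_def by (subst sum_single_cell[of K]) (auto simp: L2_inner_eq)

lemma bd_form_zero_right [simp]: "bd_form K v 0 = 0"
  by (simp add: bd_form_def linear_0[OF linear_tan_part])

lemma mesh_bd_inner_on_cell:
  "K \<in> \<T> \<Longrightarrow> mesh_bd_inner \<T> (tan_trace P) (tan_trace (on_cell K \<omega>)) = bd_form K (P K) \<omega>"
  unfolding mesh_bd_inner_def bd_inner_tan_trace by (subst sum_single_cell[of K]) auto

lemma ext_deriv_zero: "ext_deriv (0 :: 'n dform) = 0"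
  by (rule ext) (simp add: zero_fun_def ext_deriv_def linear_0[OF linear_wedge_right])

text \<open>Even for the zero form \<open>weak_d\<close> is a choice, which vanishes only almost
  everywhere; the terms of the other cells are removed through their integrals.\<close>

lemma L2_inner_weak_d_zero:
  assumes "K \<in> \<T>" "v \<in> square_integrable K"
  shows "L2_inner K v (weak_d K j (0 :: 'n dform)) = 0" "L2_inner K (weak_d K j (0 :: 'n dform)) v = 0"
proof -
  have "(0 :: 'n dform) \<in> poly_forms (Full 0) j" by (rule subspace_0[OF subspace_poly_forms])
  from L2_inner_weak_d_poly[OF assms(1) this assms(2)]
  show "L2_inner K v (weak_d K j (0 :: 'n dform)) = 0" "L2_inner K (weak_d K j (0 :: 'n dform)) v = 0"
    by (simp_all add: ext_deriv_zero L2_inner_eq)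
qed

lemma broken_inner_weak_d_on_cell:
  assumes K: "K \<in> \<T>" and v: "v \<in> square_integrable \<Omega>" and \<omega>: "\<omega> \<in> poly_forms A j"
  shows "broken_inner \<T> (\<lambda>K. v) (\<lambda>K'. weak_d K' j (on_cell K \<omega> K')) = L2_inner K v (ext_deriv \<omega>)"
  unfolding broken_inner_def
  by (subst sum_single_cell[OF K])
    (auto simp: L2_inner_weak_d_zero square_integrable_cell v L2_inner_weak_d_poly[OF K \<omega>] K)

text \<open>One field g on \<Omega> represents the codifferential of v on all cells simultaneously;
  testing with forms supported on a single cell then turns the definition of the projection into a
  volume identity there.\<close>

lemma is_nor_proj_cell:
  fixes v g :: "'n dform"
  assumes q: "is_nor_proj \<T> A j v q" and v: "v \<in> square_integrable \<Omega>" and g: "g \<in> L2_forms \<Omega> j"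
    and adj: "\<And>\<eta>. \<eta> \<in> test_forms \<Omega> j \<Longrightarrow> L2_inner \<Omega> (ext_deriv \<eta>) v = L2_inner \<Omega> \<eta> g"
  obtains P where "q = tan_trace P" "\<And>K. K \<in> \<T> \<Longrightarrow> P K \<in> poly_forms A j"
    "\<And>K \<omega>. K \<in> \<T> \<Longrightarrow> \<omega> \<in> poly_forms A j \<Longrightarrow>
      bd_form K (P K) \<omega> = L2_inner K (ext_deriv \<omega>) v - L2_inner K \<omega> g"
proof -
  obtain P where P: "q = tan_trace P" "P \<in> broken_space \<T> A j"
    using q by (auto simp: is_nor_proj_def hat_space_def)
  show ?thesis
  proof (rule that[OF P(1)])
    show "P K \<in> poly_forms A j" if "K \<in> \<T>" for K
      using P(2) that by (simp add: broken_space_def)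
    fix K and \<omega> :: "'n dform" assume K: "K \<in> \<T>" and \<omega>: "\<omega> \<in> poly_forms A j"
    have "bd_form K (P K) \<omega> = (\<Sum>K'\<in>\<T>. trace_pairing K' j (on_cell K \<omega> K') v)"
      using q on_cell_broken_space[OF \<omega>, of K] mesh_bd_inner_on_cell[OF K, of P \<omega>]
      by (simp add: is_nor_proj_def P(1))
    also have "\<dots> = trace_pairing K j \<omega> v"
    proof (subst sum_single_cell[OF K])
      fix K' assume "K' \<in> \<T>" "K' \<noteq> K"
      then show "trace_pairing K' j (on_cell K \<omega> K') v = 0"
        by (simp add: trace_pairing_def L2_inner_weak_d_zero square_integrable_cell v)
          (simp add: L2_inner_eq)
    qed simp
    also have "\<dots> = L2_inner K (ext_deriv \<omega>) v - L2_inner K \<omega> g"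
      by (rule trace_pairing_poly[OF K v g adj \<omega>])
    finally show "bd_form K (P K) \<omega> = L2_inner K (ext_deriv \<omega>) v - L2_inner K \<omega> g" .
  qed
qed

text \<open>\<open>broken_proj\<close> is a choice, so a projection is first constructed cell by
  cell from the Riesz representation; the property of the chosen one is then localized.\<close>

lemma broken_proj_cell:
  fixes v :: "'n dform"
  assumes v: "v \<in> square_integrable \<Omega>"
  shows "\<And>K. K \<in> \<T> \<Longrightarrow> broken_proj \<T> A j v K \<in> poly_forms A j"
    and "\<And>K \<omega>. K \<in> \<T> \<Longrightarrow> \<omega> \<in> poly_forms A j \<Longrightarrow>
      L2_inner K (broken_proj \<T> A j v K) \<omega> = L2_inner K v \<omega>"
proof -
  obtain B where B: "finite B" "(poly_forms A j :: 'n dform set) \<subseteq> span B"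
    using poly_forms_finite_span by blast
  have "\<exists>w\<in>poly_forms A j. \<forall>z\<in>poly_forms A j. L2_inner K w z = L2_inner K v z" if K: "K \<in> \<T>" for K
  proof -
    interpret L2: semi_inner "square_integrable K" "L2_inner K" by (rule semi_inner_L2)
    have sub: "poly_forms A j \<subseteq> square_integrable K" using poly_square_integrable(1)[OF K] by blast
    interpret P: semi_inner "poly_forms A j" "L2_inner K"
      by (rule L2.subset[OF sub subspace_poly_forms])
    have vK: "v \<in> square_integrable K" by (rule square_integrable_cell[OF K v])
    have vP: "L2_inner K v x = L2_inner K x v" if "x \<in> poly_forms A j" for x
      using that sub vK by (intro L2.commute) auto
    obtain w where "w \<in> poly_forms A j" "\<And>z. z \<in> poly_forms A j \<Longrightarrow> L2_inner K w z = L2_inner K v z"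
    proof (rule P.representation[of B "L2_inner K v"])
      fix x y :: "'n dform" and c assume x: "x \<in> poly_forms A j"
      show "L2_inner K v (c *\<^sub>R x) = c * L2_inner K v x"
        unfolding vP[OF P.mem(2)[OF x]] vP[OF x] by (rule L2.scale_left[OF subsetD[OF sub x] vK])
      show "L2_inner K v x = 0" if "L2_inner K x x = 0"
        by (rule L2.null_right[OF vK subsetD[OF sub x] that])
      assume y: "y \<in> poly_forms A j"
      show "L2_inner K v (x + y) = L2_inner K v x + L2_inner K v y"
        unfolding vP[OF P.mem(1)[OF x y]] vP[OF x] vP[OF y]
        by (rule L2.add_left[OF subsetD[OF sub x] subsetD[OF sub y] vK])
    qed (use B in auto)
    then show ?thesis by blast
  qed
  then obtain W where W: "\<And>K. K \<in> \<T> \<Longrightarrow> W K \<in> poly_forms A j"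
    "\<And>K z. K \<in> \<T> \<Longrightarrow> z \<in> poly_forms A j \<Longrightarrow> L2_inner K (W K) z = L2_inner K v z"
    by metis
  let ?Q = "\<lambda>w. w \<in> broken_space \<T> A j \<and> (\<forall>z\<in>broken_space \<T> A j. broken_inner \<T> w z = broken_inner \<T> (\<lambda>K. v) z)"
  have "?Q W"
    using W by (auto simp: broken_space_def broken_inner_def intro!: sum.cong)
  then have Q: "?Q (broken_proj \<T> A j v)"
    unfolding broken_proj_def by (rule someI[where P = ?Q])
  show "broken_proj \<T> A j v K \<in> poly_forms A j" if "K \<in> \<T>" for K
    using Q that by (simp add: broken_space_def)
  show "L2_inner K (broken_proj \<T> A j v K) \<omega> = L2_inner K v \<omega>"
    if K: "K \<in> \<T>" and \<omega>: "\<omega> \<in> poly_forms A j" for K \<omega>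
  proof -
    have "broken_inner \<T> (broken_proj \<T> A j v) (on_cell K \<omega>) = broken_inner \<T> (\<lambda>K. v) (on_cell K \<omega>)"
      using Q on_cell_broken_space[OF \<omega>] by blast
    then show ?thesis by (simp add: broken_inner_on_cell[OF K])
  qed
qed

text \<open>Cell boundaries are null and the interiors are disjoint subsets of \<Omega>, so the
  squared norms add up to at most the integral over \<Omega>.\<close>

lemma sum_L2_norm_cells_le:
  fixes g :: "'n dform"
  assumes g: "g \<in> square_integrable \<Omega>"
  shows "L2_set (\<lambda>K. L2_norm K g) \<T> \<le> L2_norm \<Omega> g"
proof -
  let ?f = "\<lambda>x. g x \<bullet> g x"
  have int: "set_integrable lebesgue \<Omega> ?f"
    using g \<Omega>(3) by (simp add: square_integrable_def set_integrable_def integrable_restrict_space power2_norm_eq_inner)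
  have sub: "set_integrable lebesgue (interior K) ?f" if "K \<in> \<T>" for K
    using that by (intro set_integrable_subset[OF int]) (auto intro: subsetD[OF cell(7)])
  have cell_eq: "(L2_norm K g)\<^sup>2 = (LINT x:interior K|lebesgue. ?f x)" if K: "K \<in> \<T>" for K
  proof -
    have "(L2_norm K g)\<^sup>2 = (LINT x|lebesgue_on K. ?f x)"
      by (simp add: L2_norm_def L2_inner_eq Bochner_Integration.integral_nonneg)
    also have "\<dots> = (LINT x|lebesgue. indicator K x *\<^sub>R ?f x)"
      using cell(5)[OF K] by (simp add: integral_restrict_space)
    also have "\<dots> = (LINT x|lebesgue. indicator (interior K) x *\<^sub>R ?f x)"
    proof (rule integral_cong_AE)
      have "integrable (lebesgue_on K) ?f"
        using square_integrable_inner[OF square_integrable_cell[OF K g] square_integrable_cell[OF K g]] .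
      then show "(\<lambda>x. indicator K x *\<^sub>R ?f x) \<in> borel_measurable lebesgue"
        using cell(5)[OF K] by (simp add: integrable_restrict_space borel_measurable_integrable)
      show "(\<lambda>x. indicator (interior K) x *\<^sub>R ?f x) \<in> borel_measurable lebesgue"
        using sub[OF K] by (simp add: set_integrable_def borel_measurable_integrable)
      have "AE x in lebesgue. x \<notin> K - interior K"
        using cell(6)[OF K] by (intro AE_not_in) (simp add: negligible_iff_null_sets)
      then show "AE x in lebesgue. indicator K x *\<^sub>R ?f x = indicator (interior K) x *\<^sub>R ?f x"
        by eventually_elim (use interior_subset in \<open>auto simp: indicator_def\<close>)
    qed
    finally show ?thesis by (simp add: set_lebesgue_integral_def)
  qed
  have "(\<Sum>K\<in>\<T>. (L2_norm K g)\<^sup>2) = (\<Sum>K\<in>\<T>. LINT x|lebesgue. indicator (interior K) x *\<^sub>R ?f x)"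
    using cell_eq by (intro sum.cong) (auto simp: set_lebesgue_integral_def)
  also have "\<dots> = (LINT x|lebesgue. (\<Sum>K\<in>\<T>. indicator (interior K) x *\<^sub>R ?f x))"
    using sub by (intro Bochner_Integration.integral_sum[symmetric]) (auto simp: set_integrable_def)
  also have "\<dots> \<le> (LINT x|lebesgue. indicator \<Omega> x *\<^sub>R ?f x)"
  proof (rule integral_mono)
    show "integrable lebesgue (\<lambda>x. \<Sum>K\<in>\<T>. indicator (interior K) x *\<^sub>R ?f x)"
      using sub by (intro Bochner_Integration.integrable_sum) (auto simp: set_integrable_def)
    show "integrable lebesgue (\<lambda>x. indicator \<Omega> x *\<^sub>R ?f x)"
      using int by (simp add: set_integrable_def)
    show "(\<Sum>K\<in>\<T>. indicator (interior K) x *\<^sub>R ?f x) \<le> indicator \<Omega> x *\<^sub>R ?f x" for x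
    proof (cases "\<exists>K\<in>\<T>. x \<in> interior K")
      case True
      then obtain K where K: "K \<in> \<T>" "x \<in> interior K" by blast
      have "(\<Sum>K'\<in>\<T>. indicator (interior K') x *\<^sub>R ?f x) = indicator (interior K) x *\<^sub>R ?f x"
      proof (rule sum_single_cell[OF K(1)])
        fix K' assume "K' \<in> \<T>" "K' \<noteq> K"
        then have "x \<notin> interior K'" using disjoint_interiors[of K' K] K by blast
        then show "indicator (interior K') x *\<^sub>R ?f x = 0" by simp
      qed
      moreover have "x \<in> \<Omega>" using K cell(7) by blast
      ultimately show ?thesis using K(2) by simp
    next
      case False
      then have "(\<Sum>K\<in>\<T>. indicator (interior K) x *\<^sub>R ?f x) = 0"
        by (intro sum.neutral) auto
      then show ?thesis by simp
    qed
  qed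
  also have "\<dots> = L2_inner \<Omega> g g"
    using \<Omega>(3) by (simp add: L2_inner_eq integral_restrict_space)
  finally show ?thesis
    by (simp add: L2_set_def L2_norm_def)
qed

end


section \<open>The error estimates\<close>

text \<open>Turns integrals of wedge products into inner products, so that integrability follows
  from square integrability of the factors.\<close>

lemma wedge_UNIV_inner: "wedge \<alpha> \<beta> $ UNIV = \<alpha> \<bullet> inv hodge \<beta>"
proof -
  have "hodge (inv hodge \<beta>) = \<beta>"
    by (simp add: bij_hodge bij_is_surj surj_f_inv_f)
  then show ?thesis using wedge_hodge[of \<alpha> "inv hodge \<beta>"] by simp
qed

lemma square_integrable_inv_hodge:
  assumes "v \<in> square_integrable S"
  shows "(\<lambda>x. inv hodge (v x)) \<in> square_integrable S"
proof -
  have "norm (inv hodge \<beta>) = norm \<beta>" for \<beta> :: "'a form"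
    using norm_hodge[of "inv hodge \<beta>"] by (simp add: bij_hodge bij_is_surj surj_f_inv_f)
  then show ?thesis
    using assms borel_measurable_linear_compose[OF _ linear_inv_hodge, of v "lebesgue_on S"]
    by (simp add: square_integrable_def)
qed

lemma L2_forms_diff:
  assumes "v \<in> L2_forms S j" "w \<in> L2_forms S j"
  shows "v - w \<in> L2_forms S j"
proof -
  have "v - w \<in> square_integrable S"
    using assms by (intro subspace_diff[OF subspace_square_integrable] L2_forms_square_integrable)
  then show ?thesis
    using assms by (auto simp: L2_forms_def square_integrable_def intro: has_degree_diff)
qed

lemma L2_norm_nonneg [simp]: "0 \<le> L2_norm S v"
  by (simp add: L2_norm_def L2_inner_eq Bochner_Integration.integral_nonneg)

lemma L2_inner_commute: "L2_inner S v w = L2_inner S w v"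
  by (simp add: L2_inner_eq inner_commute)

lemma L2_Cauchy_Schwarz:
  "v \<in> square_integrable S \<Longrightarrow> w \<in> square_integrable S \<Longrightarrow> \<bar>L2_inner S v w\<bar> \<le> L2_norm S v * L2_norm S w"
  unfolding L2_norm_def by (rule semi_inner.Cauchy_Schwarz[OF semi_inner_L2])

lemma L2_inner_diff_left:
  "v \<in> square_integrable S \<Longrightarrow> v' \<in> square_integrable S \<Longrightarrow> w \<in> square_integrable S \<Longrightarrow>
    L2_inner S (v - v') w = L2_inner S v w - L2_inner S v' w"
  by (rule semi_inner.diff_left[OF semi_inner_L2])

lemma L2_inner_diff_right:
  "v \<in> square_integrable S \<Longrightarrow> v' \<in> square_integrable S \<Longrightarrow> w \<in> square_integrable S \<Longrightarrow>
    L2_inner S w (v - v') = L2_inner S w v - L2_inner S w v'"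
  using L2_inner_diff_left[of v S v' w] by (simp add: L2_inner_commute[of S w])

text \<open>Since w - w' has seminorm zero, the square of the boundary norm of w equals the product
  of w with its lifting w', to which the dual estimate applies. After multiplication by the
  diameter, one factor of the scaled norm is divided out.\<close>

lemma trace_bound:
  fixes w :: "'n::{finite,linorder} dform"
  assumes K: "polytope K" and w: "w \<in> poly_forms A j"
    and lift: "trace_lifting_bound C K (poly_forms A j)"
    and dual: "\<And>\<tau>. \<tau> \<in> poly_forms A j \<Longrightarrow> bd_form K w \<tau> \<le> a * L2_norm K (ext_deriv \<tau>) + c * L2_norm K \<tau>"
    and nonneg: "0 \<le> a" "0 \<le> c" "0 \<le> C"
  shows "sqrt (diameter K) * sqrt (bd_form K w w) \<le> C * (a + diameter K * c)"
proof -
  interpret bd: semi_inner "poly_forms A j" "bd_form K"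
    by (rule semi_inner_bd_form_poly[OF K])
  let ?h = "diameter K" and ?q = "bd_form K w w"
  have h: "0 \<le> ?h" using K by (simp add: diameter_ge_0 polytope_imp_bounded)
  have q: "0 \<le> ?q" by (rule bd.nonneg[OF w])
  obtain w' where w': "w' \<in> poly_forms A j" "bd_form K (w - w') (w - w') = 0"
    "L2_norm K w' \<le> C * sqrt ?h * sqrt ?q" "?h * L2_norm K (ext_deriv w') \<le> C * sqrt ?h * sqrt ?q"
    using lift w unfolding trace_lifting_bound_def by blast
  have "bd_form K (w - w') w = 0"
    using bd.null_right[OF w bd.mem(4)[OF w w'(1)] w'(2)] bd.commute[OF w bd.mem(4)[OF w w'(1)]] by simp
  then have "?q = bd_form K w w'"
    using bd.diff_left[OF w w'(1) w] bd.commute[OF w w'(1)] by simp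
  also have "\<dots> \<le> a * L2_norm K (ext_deriv w') + c * L2_norm K w'"
    by (rule dual[OF w'(1)])
  finally have "?h * ?q \<le> ?h * (a * L2_norm K (ext_deriv w') + c * L2_norm K w')"
    using h by (rule mult_left_mono)
  also have "\<dots> = a * (?h * L2_norm K (ext_deriv w')) + ?h * c * L2_norm K w'"
    by (simp add: algebra_simps)
  also have "\<dots> \<le> a * (C * sqrt ?h * sqrt ?q) + ?h * c * (C * sqrt ?h * sqrt ?q)"
    using w'(3,4) nonneg h by (intro add_mono mult_left_mono) auto
  finally have "(sqrt ?h * sqrt ?q) * (sqrt ?h * sqrt ?q) \<le> (C * (a + ?h * c)) * (sqrt ?h * sqrt ?q)"
    using h q by (simp add: algebra_simps real_sqrt_mult[symmetric])
  moreover have "0 \<le> C * (a + ?h * c)" using nonneg h by simp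
  moreover have "0 \<le> sqrt ?h * sqrt ?q" using h q by simp
  ultimately show ?thesis
    by (cases "sqrt ?h * sqrt ?q = 0") (auto simp: mult_le_cancel_right)
qed

lemma tan_trace_diff: "tan_trace P - tan_trace Q = tan_trace (\<lambda>K. P K - Q K)"
  by (simp add: tan_trace_def fun_eq_iff linear_diff[OF linear_tan_part])

lemma scaled_bd_norm_tan_trace: "scaled_bd_norm K (tan_trace w) = sqrt (diameter K) * sqrt (bd_form K (w K) (w K))"
  by (simp add: scaled_bd_norm_def bd_inner_tan_trace)

section \<open>Weak derivatives on the domain and assembly of the estimates\<close>

context mesh
begin

lemma H_formsD:
  assumes "v \<in> H_forms \<Omega> j"
  shows "v \<in> L2_forms \<Omega> j" "has_weak_d \<Omega> j v (weak_d \<Omega> j v)" "weak_d \<Omega> j v \<in> L2_forms \<Omega> (j + 1)"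
proof -
  obtain w where v: "v \<in> L2_forms \<Omega> j" and w: "has_weak_d \<Omega> j v w"
    using assms by (auto simp: H_forms_def)
  show "v \<in> L2_forms \<Omega> j" by (rule v)
  show "has_weak_d \<Omega> j v (weak_d \<Omega> j v)"
    using someI[of "has_weak_d \<Omega> j v" w, OF w] by (simp add: weak_d_def)
  then show "weak_d \<Omega> j v \<in> L2_forms \<Omega> (j + 1)"
    by (simp add: has_weak_d_def)
qed

lemma weak_d_domain_AE: "has_weak_d \<Omega> j v w \<Longrightarrow> AE x in lebesgue_on \<Omega>. weak_d \<Omega> j v x = w x"
  by (rule weak_d_AE_eq) (simp_all add: \<Omega>)

text \<open>Compactly supported smooth forms are admissible in the weak formulation. Testing with
  them yields the adjoint identities that determine the codifferentials of u and \<rho>.\<close>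

lemma test_form:
  assumes \<eta>: "\<eta> \<in> test_forms \<Omega> j"
  shows "\<eta> \<in> H_forms \<Omega> j" "\<eta> \<in> square_integrable \<Omega>" "ext_deriv \<eta> \<in> square_integrable \<Omega>"
    "v \<in> square_integrable \<Omega> \<Longrightarrow> L2_inner \<Omega> v (weak_d \<Omega> j \<eta>) = L2_inner \<Omega> v (ext_deriv \<eta>)"
proof -
  obtain C where C: "smooth \<eta>" "\<And>x. has_degree j (\<eta> x)" "compact C" "C \<subseteq> \<Omega>" "\<And>x. x \<notin> C \<Longrightarrow> \<eta> x = 0"
    using \<eta> \<Omega>(4) by (auto simp: test_forms_def)
  have weak: "has_weak_d \<Omega> j \<eta> (ext_deriv \<eta>)"
    by (rule has_weak_d_smooth[OF C(1,2) \<Omega>(2,3)])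
  then show ext: "ext_deriv \<eta> \<in> square_integrable \<Omega>"
    unfolding has_weak_d_def using L2_forms_square_integrable by blast
  have cont: "continuous_on UNIV \<eta>" by (rule smooth_continuous_on[OF C(1)])
  have "\<eta> \<in> borel_measurable (lebesgue_on \<Omega>)"
    using borel_measurable_continuous_onI[OF cont]
    by (intro measurable_restrict_space1 measurable_completion) simp
  moreover have "integrable (lebesgue_on \<Omega>) (\<lambda>x. (norm (\<eta> x))\<^sup>2)"
    by (rule integral_lebesgue_on_compact_support(3)[OF _ C(3,4) \<Omega>(3)])
      (use C(5) cont in \<open>auto intro!: continuous_intros\<close>)
  ultimately have L2: "\<eta> \<in> L2_forms \<Omega> j"
    using C(2) by (simp add: L2_forms_def)
  then show "\<eta> \<in> square_integrable \<Omega>" by (rule L2_forms_square_integrable)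
  show H: "\<eta> \<in> H_forms \<Omega> j" using L2 weak by (auto simp: H_forms_def)
  assume v: "v \<in> square_integrable \<Omega>"
  show "L2_inner \<Omega> v (weak_d \<Omega> j \<eta>) = L2_inner \<Omega> v (ext_deriv \<eta>)"
    by (rule L2_inner_cong_AE(2)[OF _ _ _ weak_d_domain_AE[OF weak]])
      (use v ext H_formsD(3)[OF H] in \<open>auto simp: square_integrable_def L2_forms_def\<close>)
qed

lemma has_weak_d_diff:
  assumes "has_weak_d \<Omega> j v w" "has_weak_d \<Omega> j v' w'" "v \<in> square_integrable \<Omega>" "v' \<in> square_integrable \<Omega>"
  shows "has_weak_d \<Omega> j (v - v') (w - w')"
  unfolding has_weak_d_def
proof (intro conjI ballI)
  have w: "w \<in> L2_forms \<Omega> (j + 1)" "w' \<in> L2_forms \<Omega> (j + 1)"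
    using assms by (auto simp: has_weak_d_def)
  then show "w - w' \<in> L2_forms \<Omega> (j + 1)" by (rule L2_forms_diff)
  fix \<eta> assume \<eta>: "\<eta> \<in> test_forms \<Omega> (int CARD('n) - j - 1)"
  have lin: "form_integral \<Omega> (\<lambda>x. wedge ((a - b) x) (c x))
      = form_integral \<Omega> (\<lambda>x. wedge (a x) (c x)) - form_integral \<Omega> (\<lambda>x. wedge (b x) (c x))"
    if "a \<in> square_integrable \<Omega>" "b \<in> square_integrable \<Omega>" "c \<in> square_integrable \<Omega>" for a b c :: "'n dform"
    using that square_integrable_inner[OF that(1) square_integrable_inv_hodge[OF that(3)]]
      square_integrable_inner[OF that(2) square_integrable_inv_hodge[OF that(3)]]
    by (simp add: form_integral_def wedge_UNIV_inner inner_diff_left)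
  show "form_integral \<Omega> (\<lambda>x. wedge ((w - w') x) (\<eta> x))
      = (-1) powi (j + 1) * form_integral \<Omega> (\<lambda>x. wedge ((v - v') x) (ext_deriv \<eta> x))"
    using assms(1,2) \<eta>
    unfolding lin[OF L2_forms_square_integrable[OF w(1)] L2_forms_square_integrable[OF w(2)] test_form(2)[OF \<eta>]]
      lin[OF assms(3,4) test_form(3)[OF \<eta>]]
    by (simp add: has_weak_d_def right_diff_distrib)
qed

text \<open>The operator \<open>weak_d\<close>, being a choice, is additive only almost everywhere;
  this follows from uniqueness.\<close>

lemma weak_d_diff_AE:
  assumes "v \<in> H_forms \<Omega> j" "v' \<in> H_forms \<Omega> j"
  shows "AE x in lebesgue_on \<Omega>. weak_d \<Omega> j (v - v') x = (weak_d \<Omega> j v - weak_d \<Omega> j v') x"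
    "weak_d \<Omega> j (v - v') \<in> square_integrable \<Omega>"
proof -
  have H: "has_weak_d \<Omega> j (v - v') (weak_d \<Omega> j v - weak_d \<Omega> j v')"
    using assms by (intro has_weak_d_diff H_formsD L2_forms_square_integrable)
  then show "AE x in lebesgue_on \<Omega>. weak_d \<Omega> j (v - v') x = (weak_d \<Omega> j v - weak_d \<Omega> j v') x"
    by (rule weak_d_domain_AE)
  have "v - v' \<in> H_forms \<Omega> j"
    using H L2_forms_diff[OF H_formsD(1)[OF assms(1)] H_formsD(1)[OF assms(2)]] by (auto simp: H_forms_def)
  then show "weak_d \<Omega> j (v - v') \<in> square_integrable \<Omega>"
    by (rule L2_forms_square_integrable[OF H_formsD(3)])
qed

lemma L2_inner_weak_d_diff_cell:
  assumes K: "K \<in> \<T>" and v: "v \<in> H_forms \<Omega> j" "v' \<in> H_forms \<Omega> j" and a: "a \<in> square_integrable K"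
  shows "L2_inner K a (weak_d \<Omega> j (v - v')) = L2_inner K a (weak_d \<Omega> j v) - L2_inner K a (weak_d \<Omega> j v')"
proof -
  note sq = square_integrable_cell[OF K L2_forms_square_integrable[OF H_formsD(3)[OF v(1)]]]
    square_integrable_cell[OF K L2_forms_square_integrable[OF H_formsD(3)[OF v(2)]]]
    square_integrable_cell[OF K weak_d_diff_AE(2)[OF v]]
  have meas: "b \<in> borel_measurable (lebesgue_on K)" if "b \<in> square_integrable K" for b
    using that by (simp add: square_integrable_def)
  have "AE x in lebesgue. x \<in> \<Omega> \<longrightarrow> weak_d \<Omega> j (v - v') x = (weak_d \<Omega> j v - weak_d \<Omega> j v') x"
    using weak_d_diff_AE(1)[OF v] \<Omega>(3) by (simp add: AE_restrict_space_iff)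
  from AE_cell[OF K this]
  have "L2_inner K a (weak_d \<Omega> j (v - v')) = L2_inner K a (weak_d \<Omega> j v - weak_d \<Omega> j v')"
    by (rule L2_inner_cong_AE(2)[OF meas[OF sq(3)] meas[OF subspace_diff[OF subspace_square_integrable sq(1,2)]] meas[OF a]])
  then show ?thesis
    using L2_inner_diff_right[OF sq(1,2) a] by simp
qed

text \<open>Minkowski's inequality for the l2 norm over the cells, followed by replacing each
  diameter by the largest one.\<close>

lemma scaled_mesh_bd_norm_le:
  assumes le: "\<And>K. K \<in> \<T> \<Longrightarrow> scaled_bd_norm K e \<le> C * (a K + diameter K * b K)"
    and nonneg: "\<And>K. K \<in> \<T> \<Longrightarrow> 0 \<le> b K" "0 \<le> C"
  shows "scaled_mesh_bd_norm \<T> e \<le> C * (L2_set a \<T> + mesh_size \<T> * L2_set b \<T>)"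
proof -
  have h: "0 \<le> diameter K" "diameter K \<le> mesh_size \<T>" if "K \<in> \<T>" for K
    using that finite_mesh cell(4)[OF that] by (auto simp: mesh_size_def diameter_ge_0)
  have "0 \<le> mesh_size \<T>" using h mesh_nonempty by (meson all_not_in_conv order_trans)
  have "scaled_mesh_bd_norm \<T> e = L2_set (\<lambda>K. scaled_bd_norm K e) \<T>"
    by (simp add: scaled_mesh_bd_norm_def L2_set_def)
  also have "\<dots> \<le> L2_set (\<lambda>K. C * (a K + diameter K * b K)) \<T>"
  proof (rule L2_set_mono[OF le])
    fix K assume "K \<in> \<T>"
    then show "0 \<le> scaled_bd_norm K e"
      using h by (auto simp: scaled_bd_norm_def bd_inner_def intro!: mult_nonneg_nonneg sum_nonneg Bochner_Integration.integral_nonneg)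
  qed
  also have "\<dots> = C * L2_set (\<lambda>K. a K + diameter K * b K) \<T>"
    by (rule L2_set_right_distrib[OF nonneg(2), symmetric])
  also have "\<dots> \<le> C * (L2_set a \<T> + L2_set (\<lambda>K. diameter K * b K) \<T>)"
    by (rule mult_left_mono[OF L2_set_triangle_ineq nonneg(2)])
  also have "L2_set (\<lambda>K. diameter K * b K) \<T> \<le> L2_set (\<lambda>K. mesh_size \<T> * b K) \<T>"
    using h nonneg by (intro L2_set_mono mult_right_mono) auto
  also have "\<dots> = mesh_size \<T> * L2_set b \<T>"
    by (rule L2_set_right_distrib[symmetric]) fact
  finally show ?thesis
    using nonneg(2) by (simp add: mult_left_mono)
qed

text \<open>The shape of the cell enters only through the two lifting bounds. The estimates arise in
  parallel: the codifferential is \<sigma> for u and f - d\<sigma> - p for \<rho>, and the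
  projections are onto the spaces containing the exterior derivatives of the respective test
  forms.\<close>

lemma trace_error_estimates:
  fixes k :: int and A B D :: poly_family
  assumes stable: "stable_pair A B"
    and complex: "ext_deriv ` poly_forms B k \<subseteq> (poly_forms D (k + 1) :: 'n dform set)"
    and f: "f \<in> L2_forms \<Omega> k"
    and exact: "hodge_laplace \<Omega> k (H_forms \<Omega> (k - 1)) (H_forms \<Omega> k) f \<sigma> u p"
    and feec: "hodge_laplace \<Omega> k (fe_space \<Omega> \<T> A (k - 1)) (fe_space \<Omega> \<T> B k) f \<sigma>h uh ph"
    and hybrid: "hybrid_traces \<Omega> \<T> A B k f \<sigma>h uh ph uhat rhohat"
    and Pu: "is_nor_proj \<T> A (k - 1) u Puhat"
    and Prho: "is_nor_proj \<T> B k (weak_d \<Omega> k u) Prhohat"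
    and K: "K \<in> \<T>" and C: "0 \<le> C"
    and liftA: "trace_lifting_bound C K (poly_forms A (k - 1))"
    and liftB: "trace_lifting_bound C K (poly_forms B k)"
  shows "scaled_bd_norm K (Puhat - uhat)
      \<le> C * (L2_norm K (broken_proj \<T> B k u K - uh) + diameter K * L2_norm K (\<sigma> - \<sigma>h))"
    and "scaled_bd_norm K (Prhohat - rhohat)
      \<le> C * (L2_norm K (broken_proj \<T> D (k + 1) (weak_d \<Omega> k (u - uh)) K)
          + diameter K * (L2_norm K (weak_d \<Omega> (k - 1) (\<sigma> - \<sigma>h)) + L2_norm K (p - ph)))"
proof -
  have H: "\<sigma> \<in> H_forms \<Omega> (k - 1)" "u \<in> H_forms \<Omega> k" "p \<in> H_forms \<Omega> k"
    "\<sigma>h \<in> H_forms \<Omega> (k - 1)" "uh \<in> H_forms \<Omega> k" "ph \<in> H_forms \<Omega> k"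
    using exact feec by (auto simp: hodge_laplace_def harmonic_def fe_space_def)
  let ?\<rho> = "weak_d \<Omega> k u" and ?\<rho>h = "weak_d \<Omega> k uh"
  let ?d\<sigma> = "weak_d \<Omega> (k - 1) \<sigma>" and ?d\<sigma>h = "weak_d \<Omega> (k - 1) \<sigma>h"
  have d\<sigma>: "?d\<sigma> \<in> L2_forms \<Omega> k" "?d\<sigma>h \<in> L2_forms \<Omega> k"
    using H_formsD(3)[OF H(1)] H_formsD(3)[OF H(4)] by simp_all
  have sq: "\<sigma> \<in> square_integrable \<Omega>" "u \<in> square_integrable \<Omega>" "p \<in> square_integrable \<Omega>"
    "\<sigma>h \<in> square_integrable \<Omega>" "uh \<in> square_integrable \<Omega>" "ph \<in> square_integrable \<Omega>"
    "?\<rho> \<in> square_integrable \<Omega>" "?\<rho>h \<in> square_integrable \<Omega>" "?d\<sigma> \<in> square_integrable \<Omega>"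
    "?d\<sigma>h \<in> square_integrable \<Omega>" "f \<in> square_integrable \<Omega>"
    using H d\<sigma> f by (auto intro: L2_forms_square_integrable H_formsD(1) H_formsD(3))
  note sqK = sq[THEN square_integrable_cell[OF K]]
  note diffK = subspace_diff[OF subspace_square_integrable[of K]]
  note diff\<Omega> = subspace_diff[OF subspace_square_integrable[of \<Omega>]]
  note polyK = poly_square_integrable[OF K]
  note polytope = cell(2)[OF K]

  \<comment> \<open>The first equation of the continuous problem, tested with compactly supported
    forms, says that \<sigma> is the codifferential of u.\<close>
  have adj1: "L2_inner \<Omega> (ext_deriv \<eta>) u = L2_inner \<Omega> \<eta> \<sigma>" if \<eta>: "\<eta> \<in> test_forms \<Omega> (k - 1)" for \<eta>
  proof -
    have "L2_inner \<Omega> \<sigma> \<eta> - L2_inner \<Omega> u (weak_d \<Omega> (k - 1) \<eta>) = 0"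
      using exact test_form(1)[OF \<eta>] by (simp add: hodge_laplace_def)
    then show ?thesis
      using test_form(4)[OF \<eta> sq(2)] by (simp add: L2_inner_commute[of \<Omega> _ \<eta>] L2_inner_commute[of \<Omega> u])
  qed
  obtain P where P: "Puhat = tan_trace P" "P K \<in> poly_forms A (k - 1)"
    "\<And>\<omega>. \<omega> \<in> poly_forms A (k - 1) \<Longrightarrow> bd_form K (P K) \<omega> = L2_inner K (ext_deriv \<omega>) u - L2_inner K \<omega> \<sigma>"
    using is_nor_proj_cell[OF Pu sq(2) H_formsD(1)[OF H(1)] adj1] K by metis
  obtain U where U: "uhat = tan_trace U" "U \<in> broken_space \<T> A (k - 1)"
    using hybrid by (auto simp: hybrid_traces_def hat_space_def)
  have UK: "U K \<in> poly_forms A (k - 1)" using U(2) K by (simp add: broken_space_def)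
  have hyb1: "bd_form K (U K) \<omega> = L2_inner K uh (ext_deriv \<omega>) - L2_inner K \<sigma>h \<omega>"
    if \<omega>: "\<omega> \<in> poly_forms A (k - 1)" for \<omega>
  proof -
    have "broken_inner \<T> (\<lambda>K. \<sigma>h) (on_cell K \<omega>)
        - broken_inner \<T> (\<lambda>K. uh) (\<lambda>K'. weak_d K' (k - 1) (on_cell K \<omega> K'))
        + mesh_bd_inner \<T> uhat (tan_trace (on_cell K \<omega>)) = 0"
      using hybrid on_cell_broken_space[OF \<omega>] by (simp add: hybrid_traces_def)
    then show ?thesis
      by (simp add: U(1) mesh_bd_inner_on_cell[OF K] broken_inner_on_cell[OF K]
          broken_inner_weak_d_on_cell[OF K sq(5) \<omega>])
  qed
  interpret bdA: semi_inner "poly_forms A (k - 1)" "bd_form K"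
    by (rule semi_inner_bd_form_poly[OF polytope])
  let ?Pu = "broken_proj \<T> B k u K"
  have PuK: "?Pu \<in> square_integrable K"
    by (rule polyK(1)[OF broken_proj_cell(1)[OF sq(2) K]])
  have "sqrt (diameter K) * sqrt (bd_form K (P K - U K) (P K - U K))
      \<le> C * (L2_norm K (?Pu - uh) + diameter K * L2_norm K (\<sigma> - \<sigma>h))"
  proof (rule trace_bound[OF polytope _ liftA])
    show "P K - U K \<in> poly_forms A (k - 1)"
      by (rule bdA.mem(4)[OF P(2) UK])
    fix \<omega> :: "'n dform" assume \<omega>: "\<omega> \<in> poly_forms A (k - 1)"
    \<comment> \<open>Stability of the pair enters here: against this derivative, u and its
      projection onto the space of B have the same inner product.\<close>
    have ext: "ext_deriv \<omega> \<in> poly_forms B k"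
      using stable_pair_ext_deriv[OF stable \<omega>] by simp
    have "bd_form K (P K - U K) \<omega> = bd_form K (P K) \<omega> - bd_form K (U K) \<omega>"
      by (rule bdA.diff_left[OF P(2) UK \<omega>])
    also have "\<dots> = L2_inner K (?Pu - uh) (ext_deriv \<omega>) - L2_inner K (\<sigma> - \<sigma>h) \<omega>"
      using L2_inner_diff_left[OF PuK sqK(5) polyK(2)[OF \<omega>]] L2_inner_diff_left[OF sqK(1,4) polyK(1)[OF \<omega>]]
        broken_proj_cell(2)[OF sq(2) K ext]
      by (simp add: P(3)[OF \<omega>] hyb1[OF \<omega>] L2_inner_commute[of K "ext_deriv \<omega>"] L2_inner_commute[of K \<omega>])
    also have "\<dots> \<le> L2_norm K (?Pu - uh) * L2_norm K (ext_deriv \<omega>) + L2_norm K (\<sigma> - \<sigma>h) * L2_norm K \<omega>"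
      using L2_Cauchy_Schwarz[OF diffK[OF PuK sqK(5)] polyK(2)[OF \<omega>]]
        L2_Cauchy_Schwarz[OF diffK[OF sqK(1,4)] polyK(1)[OF \<omega>]] by linarith
    finally show "bd_form K (P K - U K) \<omega>
        \<le> L2_norm K (?Pu - uh) * L2_norm K (ext_deriv \<omega>) + L2_norm K (\<sigma> - \<sigma>h) * L2_norm K \<omega>" .
  qed (use C in auto)
  then show "scaled_bd_norm K (Puhat - uhat)
      \<le> C * (L2_norm K (?Pu - uh) + diameter K * L2_norm K (\<sigma> - \<sigma>h))"
    by (simp add: P(1) U(1) tan_trace_diff scaled_bd_norm_tan_trace)

  \<comment> \<open>The codifferential of \<rho> according to the second equation of the continuous
    problem.\<close>
  let ?g = "f - ?d\<sigma> - p"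
  have g: "?g \<in> L2_forms \<Omega> k"
    by (rule L2_forms_diff[OF L2_forms_diff[OF f d\<sigma>(1)] H_formsD(1)[OF H(3)]])
  have adj2: "L2_inner \<Omega> (ext_deriv \<eta>) ?\<rho> = L2_inner \<Omega> \<eta> ?g" if \<eta>: "\<eta> \<in> test_forms \<Omega> k" for \<eta>
  proof -
    have "L2_inner \<Omega> ?d\<sigma> \<eta> + L2_inner \<Omega> ?\<rho> (weak_d \<Omega> k \<eta>) + L2_inner \<Omega> p \<eta> = L2_inner \<Omega> f \<eta>"
      using exact test_form(1)[OF \<eta>] by (simp add: hodge_laplace_def)
    moreover have "L2_inner \<Omega> ?g \<eta> = L2_inner \<Omega> f \<eta> - L2_inner \<Omega> ?d\<sigma> \<eta> - L2_inner \<Omega> p \<eta>"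
      using L2_inner_diff_left[OF diff\<Omega>[OF sq(11,9)] sq(3) test_form(2)[OF \<eta>]]
        L2_inner_diff_left[OF sq(11,9) test_form(2)[OF \<eta>]] by simp
    ultimately show ?thesis
      using test_form(4)[OF \<eta> sq(7)] by (simp add: L2_inner_commute[of \<Omega> \<eta>] L2_inner_commute[of \<Omega> "ext_deriv \<eta>"])
  qed
  obtain Q where Q: "Prhohat = tan_trace Q" "Q K \<in> poly_forms B k"
    "\<And>\<omega>. \<omega> \<in> poly_forms B k \<Longrightarrow> bd_form K (Q K) \<omega> = L2_inner K (ext_deriv \<omega>) ?\<rho> - L2_inner K \<omega> ?g"
    using is_nor_proj_cell[OF Prho sq(7) g adj2] K by metis
  obtain R where R: "rhohat = tan_trace R" "R \<in> broken_space \<T> B k"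
    using hybrid by (auto simp: hybrid_traces_def hat_space_def)
  have RK: "R K \<in> poly_forms B k" using R(2) K by (simp add: broken_space_def)
  have hyb2: "bd_form K (R K) \<omega> = L2_inner K ?d\<sigma>h \<omega> + L2_inner K ?\<rho>h (ext_deriv \<omega>) + L2_inner K ph \<omega> - L2_inner K f \<omega>"
    if \<omega>: "\<omega> \<in> poly_forms B k" for \<omega>
  proof -
    have "broken_inner \<T> (\<lambda>K. ?d\<sigma>h) (on_cell K \<omega>)
        + broken_inner \<T> (\<lambda>K. ?\<rho>h) (\<lambda>K'. weak_d K' k (on_cell K \<omega> K'))
        + broken_inner \<T> (\<lambda>K. ph) (on_cell K \<omega>)
        - mesh_bd_inner \<T> rhohat (tan_trace (on_cell K \<omega>)) = broken_inner \<T> (\<lambda>K. f) (on_cell K \<omega>)"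
      using hybrid on_cell_broken_space[OF \<omega>] by (simp add: hybrid_traces_def)
    then show ?thesis
      by (simp add: R(1) mesh_bd_inner_on_cell[OF K] broken_inner_on_cell[OF K]
          broken_inner_weak_d_on_cell[OF K sq(8) \<omega>])
  qed
  interpret bdB: semi_inner "poly_forms B k" "bd_form K"
    by (rule semi_inner_bd_form_poly[OF polytope])
  let ?du = "weak_d \<Omega> k (u - uh)" and ?ds = "weak_d \<Omega> (k - 1) (\<sigma> - \<sigma>h)"
  have du: "?du \<in> square_integrable \<Omega>" and ds: "?ds \<in> square_integrable \<Omega>"
    using weak_d_diff_AE(2) H by blast+
  note dsK = square_integrable_cell[OF K ds]
  let ?Pdu = "broken_proj \<T> D (k + 1) ?du K"
  have PduK: "?Pdu \<in> square_integrable K"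
    by (rule polyK(1)[OF broken_proj_cell(1)[OF du K]])
  have "sqrt (diameter K) * sqrt (bd_form K (Q K - R K) (Q K - R K))
      \<le> C * (L2_norm K ?Pdu + diameter K * (L2_norm K ?ds + L2_norm K (p - ph)))"
  proof (rule trace_bound[OF polytope _ liftB])
    show "Q K - R K \<in> poly_forms B k"
      by (rule bdB.mem(4)[OF Q(2) RK])
    fix \<omega> :: "'n dform" assume \<omega>: "\<omega> \<in> poly_forms B k"
    note \<omega>K = polyK(1)[OF \<omega>] and extK = polyK(2)[OF \<omega>]
    have ext: "ext_deriv \<omega> \<in> poly_forms D (k + 1)"
      using complex \<omega> by blast
    have e1: "L2_inner K \<omega> ?g = L2_inner K \<omega> f - L2_inner K \<omega> ?d\<sigma> - L2_inner K \<omega> p"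
      using L2_inner_diff_right[OF diffK[OF sqK(11,9)] sqK(3) \<omega>K] L2_inner_diff_right[OF sqK(11,9) \<omega>K] by simp
    \<comment> \<open>The derivative of the test form lies in the space of D, so the projection may
      be dropped; the derivative of the difference then splits almost everywhere on the
      cell.\<close>
    have e2: "L2_inner K ?Pdu (ext_deriv \<omega>) = L2_inner K (ext_deriv \<omega>) ?\<rho> - L2_inner K (ext_deriv \<omega>) ?\<rho>h"
      using broken_proj_cell(2)[OF du K ext] L2_inner_weak_d_diff_cell[OF K H(2,5) extK]
      by (simp add: L2_inner_commute[of K ?du])
    have e3: "L2_inner K \<omega> ?ds = L2_inner K \<omega> ?d\<sigma> - L2_inner K \<omega> ?d\<sigma>h"
      by (rule L2_inner_weak_d_diff_cell[OF K H(1,4) \<omega>K])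
    have e4: "L2_inner K \<omega> (p - ph) = L2_inner K \<omega> p - L2_inner K \<omega> ph"
      by (rule L2_inner_diff_right[OF sqK(3,6) \<omega>K])
    have "bd_form K (Q K - R K) \<omega> = bd_form K (Q K) \<omega> - bd_form K (R K) \<omega>"
      by (rule bdB.diff_left[OF Q(2) RK \<omega>])
    \<comment> \<open>The datum f occurs in both trace identities and cancels, so that only errors
      remain.\<close>
    also have "\<dots> = L2_inner K ?Pdu (ext_deriv \<omega>) + L2_inner K \<omega> ?ds + L2_inner K \<omega> (p - ph)"
      unfolding Q(3)[OF \<omega>] hyb2[OF \<omega>] e1 e2 e3 e4
        L2_inner_commute[of K ?d\<sigma>h \<omega>] L2_inner_commute[of K ph \<omega>] L2_inner_commute[of K f \<omega>]
        L2_inner_commute[of K ?\<rho>h "ext_deriv \<omega>"] by simp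
    also have "\<dots> \<le> L2_norm K ?Pdu * L2_norm K (ext_deriv \<omega>) + (L2_norm K ?ds + L2_norm K (p - ph)) * L2_norm K \<omega>"
      using L2_Cauchy_Schwarz[OF PduK extK] L2_Cauchy_Schwarz[OF \<omega>K dsK]
        L2_Cauchy_Schwarz[OF \<omega>K diffK[OF sqK(3,6)]]
      by (simp add: algebra_simps)
    finally show "bd_form K (Q K - R K) \<omega>
        \<le> L2_norm K ?Pdu * L2_norm K (ext_deriv \<omega>) + (L2_norm K ?ds + L2_norm K (p - ph)) * L2_norm K \<omega>" .
  qed (use C in auto)
  then show "scaled_bd_norm K (Prhohat - rhohat)
      \<le> C * (L2_norm K ?Pdu + diameter K * (L2_norm K ?ds + L2_norm K (p - ph)))"
    by (simp add: Q(1) R(1) tan_trace_diff scaled_bd_norm_tan_trace)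
qed

end

theorem theorem4p7:
  fixes \<Omega> :: "'n::{finite,linorder} pt set"
    and MM :: "'n pt set set set"
    and k :: int
    and A B D :: poly_family
  assumes "lipschitz_polyhedral_domain \<Omega>"
    and "shape_regular_family \<Omega> MM"
    and "0 \<le> k" and "k \<le> int CARD('n)"
    and "stable_pair A B"
    and "ext_deriv ` poly_forms B k \<subseteq> (poly_forms D (k + 1) :: 'n dform set)"
  shows "\<exists>C>0. \<forall>\<T>\<in>MM. \<forall>f \<sigma> u p \<sigma>\<^sub>h u\<^sub>h p\<^sub>h uhat rhohat Puhat Prhohat.
    f \<in> L2_forms \<Omega> k \<longrightarrow>
    hodge_laplace \<Omega> k (H_forms \<Omega> (k - 1)) (H_forms \<Omega> k) f \<sigma> u p \<longrightarrow>
    hodge_laplace \<Omega> k (fe_space \<Omega> \<T> A (k - 1)) (fe_space \<Omega> \<T> B k) f \<sigma>\<^sub>h u\<^sub>h p\<^sub>h \<longrightarrow>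
    hybrid_traces \<Omega> \<T> A B k f \<sigma>\<^sub>h u\<^sub>h p\<^sub>h uhat rhohat \<longrightarrow>
    is_nor_proj \<T> A (k - 1) u Puhat \<longrightarrow>
    is_nor_proj \<T> B k (weak_d \<Omega> k u) Prhohat \<longrightarrow>
    (let e\<^sub>u = Puhat - uhat;
         e\<^sub>\<rho> = Prhohat - rhohat;
         Pu = (\<lambda>K. broken_proj \<T> B k u K - u\<^sub>h);
         Pdu = broken_proj \<T> D (k + 1) (weak_d \<Omega> k (u - u\<^sub>h));
         d\<sigma> = weak_d \<Omega> (k - 1) (\<sigma> - \<sigma>\<^sub>h)
     in (\<forall>K\<in>\<T>.
          scaled_bd_norm K e\<^sub>u \<le> C * (L2_norm K (Pu K) + diameter K * L2_norm K (\<sigma> - \<sigma>\<^sub>h)) \<and>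
          scaled_bd_norm K e\<^sub>\<rho>
            \<le> C * (L2_norm K (Pdu K) + diameter K * (L2_norm K d\<sigma> + L2_norm K (p - p\<^sub>h)))) \<and>
        scaled_mesh_bd_norm \<T> e\<^sub>u
          \<le> C * (broken_norm \<T> Pu + mesh_size \<T> * L2_norm \<Omega> (\<sigma> - \<sigma>\<^sub>h)) \<and>
        scaled_mesh_bd_norm \<T> e\<^sub>\<rho>
          \<le> C * (broken_norm \<T> Pdu + mesh_size \<T> * (L2_norm \<Omega> d\<sigma> + L2_norm \<Omega> (p - p\<^sub>h))))"
proof -
  obtain \<gamma> where \<gamma>: "0 < \<gamma>" "\<And>\<T> K. \<T> \<in> MM \<Longrightarrow> K \<in> \<T> \<Longrightarrow> diameter K \<le> \<gamma> * inball_diameter K"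
    and meshes: "\<And>\<T>. \<T> \<in> MM \<Longrightarrow> simplicial_mesh \<Omega> \<T>"
    using assms(2) by (auto simp: shape_regular_family_def)
  obtain CA where CA: "0 \<le> CA" "\<And>K :: 'n pt set. int CARD('n) simplex K \<Longrightarrow>
      diameter K \<le> \<gamma> * inball_diameter K \<Longrightarrow> trace_lifting_bound CA K (poly_forms A (k - 1))"
    using trace_lifting[OF \<gamma>(1), of A "k - 1"] by blast
  obtain CB where CB: "0 \<le> CB" "\<And>K :: 'n pt set. int CARD('n) simplex K \<Longrightarrow>
      diameter K \<le> \<gamma> * inball_diameter K \<Longrightarrow> trace_lifting_bound CB K (poly_forms B k)"
    using trace_lifting[OF \<gamma>(1), of B k] by blast
  \<comment> \<open>One constant serves both traces; 1 is added to make it strictly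
    positive.\<close>
  define C where "C = CA + CB + 1"
  have C: "0 < C" "0 \<le> C" "CA \<le> C" "CB \<le> C" using CA(1) CB(1) by (auto simp: C_def)
  show ?thesis
  proof (intro exI[of _ C] conjI C(1) ballI allI impI, goal_cases)
    case (1 \<T> f \<sigma> u p \<sigma>h uh ph uhat rhohat Puhat Prhohat)
    interpret mesh \<Omega> \<T>
      using assms(1) meshes[OF 1(1)] by unfold_locales
    have liftA: "trace_lifting_bound C K (poly_forms A (k - 1))"
      and liftB: "trace_lifting_bound C K (poly_forms B k)" if K: "K \<in> \<T>" for K
      using trace_lifting_bound_mono[OF CA(2)[OF cell(1)[OF K] \<gamma>(2)[OF 1(1) K]] C(3) cell(2)[OF K]]
        trace_lifting_bound_mono[OF CB(2)[OF cell(1)[OF K] \<gamma>(2)[OF 1(1) K]] C(4) cell(2)[OF K]]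
      by auto
    note est = trace_error_estimates[OF assms(5,6) 1(2-7) _ C(2) liftA liftB]
    let ?Pu = "\<lambda>K. broken_proj \<T> B k u K - uh" and ?Pdu = "broken_proj \<T> D (k + 1) (weak_d \<Omega> k (u - uh))"
      and ?ds = "weak_d \<Omega> (k - 1) (\<sigma> - \<sigma>h)"
    have H: "\<sigma> \<in> H_forms \<Omega> (k - 1)" "\<sigma>h \<in> H_forms \<Omega> (k - 1)" "p \<in> H_forms \<Omega> k" "ph \<in> H_forms \<Omega> k"
      using 1(3,4) by (auto simp: hodge_laplace_def harmonic_def fe_space_def)
    have sq: "\<sigma> - \<sigma>h \<in> square_integrable \<Omega>" "p - ph \<in> square_integrable \<Omega>" "?ds \<in> square_integrable \<Omega>"
      using H by (auto intro: L2_forms_square_integrable L2_forms_diff H_formsD(1) weak_d_diff_AE(2))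
    have h: "0 \<le> mesh_size \<T>"
      using finite_mesh mesh_nonempty cell(4) diameter_ge_0 by (auto simp: mesh_size_def Max_ge_iff)
    have broken: "broken_norm \<T> v = L2_set (\<lambda>K. L2_norm K (v K)) \<T>" for v :: "'n broken"
      by (simp add: broken_norm_def L2_set_def)
    have "scaled_mesh_bd_norm \<T> (Puhat - uhat)
        \<le> C * (L2_set (\<lambda>K. L2_norm K (?Pu K)) \<T> + mesh_size \<T> * L2_set (\<lambda>K. L2_norm K (\<sigma> - \<sigma>h)) \<T>)"
      by (rule scaled_mesh_bd_norm_le) (use est(1) C(2) in auto)
    also have "\<dots> \<le> C * (broken_norm \<T> ?Pu + mesh_size \<T> * L2_norm \<Omega> (\<sigma> - \<sigma>h))"
      using sum_L2_norm_cells_le[OF sq(1)] h C(2) unfolding broken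
      by (intro mult_left_mono add_left_mono) auto
    finally have mesh1: "scaled_mesh_bd_norm \<T> (Puhat - uhat) \<le> \<dots>" .
    have "scaled_mesh_bd_norm \<T> (Prhohat - rhohat)
        \<le> C * (L2_set (\<lambda>K. L2_norm K (?Pdu K)) \<T>
          + mesh_size \<T> * L2_set (\<lambda>K. L2_norm K ?ds + L2_norm K (p - ph)) \<T>)"
      by (rule scaled_mesh_bd_norm_le) (use est(2) C(2) in auto)
    also have "\<dots> \<le> C * (broken_norm \<T> ?Pdu + mesh_size \<T> * (L2_norm \<Omega> ?ds + L2_norm \<Omega> (p - ph)))"
    proof -
      have "L2_set (\<lambda>K. L2_norm K ?ds + L2_norm K (p - ph)) \<T> \<le> L2_norm \<Omega> ?ds + L2_norm \<Omega> (p - ph)"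
        using L2_set_triangle_ineq[of "\<lambda>K. L2_norm K ?ds" "\<lambda>K. L2_norm K (p - ph)" \<T>]
          sum_L2_norm_cells_le[OF sq(3)] sum_L2_norm_cells_le[OF sq(2)] by linarith
      then show ?thesis
        using h C(2) unfolding broken by (intro mult_left_mono add_left_mono) auto
    qed
    finally have mesh2: "scaled_mesh_bd_norm \<T> (Prhohat - rhohat) \<le> \<dots>" .
    show ?case
      unfolding Let_def using est mesh1 mesh2 by blast
  qed
qed


end
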